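(* Let $\mathcal{H}$ be a complex separable Hilbert space and let $\{\Lambda_t\}_{t\ge 0}$ be a dynamical map on $\mathcal{B}_1(\mathcal{H})$. (1) If $\{\Lambda_t\}_{t\ge 0}$ is P-divisible, then for every Hermitian operator $X\in\mathcal{B}_1(\mathcal{H})$ the function $t\mapsto \|\Lambda_t(X)\|_1$ is non-increasing; if this function is differentiable, then $\frac{\mathrm{d}}{\mathrm{d}t}\|\Lambda_t(X)\|_1\le 0$. (2) If $\{\Lambda_t\}_{t\ge 0}$ is CP-divisible, then for every Hermitian operator $Y\in\mathcal{B}_1(\mathcal{H}\otimes\mathcal{H})$ the function $t\mapsto \|(\mathcal{I}\otimes\Lambda_t)(Y)\|_1$ is non-increasing; if this function is differentiable, then $\frac{\mathrm{d}}{\mathrm{d}t}\|(\mathcal{I}\otimes\Lambda_t)(Y)\|_1\le 0$. If furthermore $\{\Lambda_t\}_{t\ge 0}$ is surjective (i.e. each $\Lambda_t:\mathcal{B}_1(\mathcal{H})\to\mathcal{B}_1(\mathcal{H})$ is surjective), then the converses also hold: if $t\mapsto\|\Lambda_t(X)\|_1$ is non-increasing for every Hermitian $X\in\mathcal{B}_1(\mathcal{H})$, then $\{\Lambda_t\}_{t\ge 0}$ is P-divisible; and if $t\mapsto\|(\mathcal{I}\otimes\Lambda_t)(Y)\|_1$ is non-increasing for every Hermitian $Y\in\mathcal{B}_1(\mathcal{H}\otimes\mathcal{H})$, then $\{\Lambda_t\}_{t\ge 0}$ is CP-divisible.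
   Context: $\mathcal{B}_1(\mathcal{H})$ is the space of trace class operators on $\mathcal{H}$ with trace norm $\|X\|_1=\mathrm{Tr}|X|$, and $\mathcal{I}$ is the identity map on $\mathcal{B}_1(\mathcal{H})$. A dynamical map $\{\Lambda_t\}_{t\ge0}$ is a family of completely positive and trace preserving linear maps $\Lambda_t:\mathcal{B}_1(\mathcal{H})\to\mathcal{B}_1(\mathcal{H})$, $t\ge 0$. It is divisible if for all $0\le s\le t$ there is a linear map $\Phi_{t,s}:\mathcal{B}_1(\mathcal{H})\to\mathcal{B}_1(\mathcal{H})$ with $\Lambda_t=\Phi_{t,s}\Lambda_s$. It is P-divisible if it is divisible and the maps $\Phi_{t,s}$ ($0\le s\le t$) can be chosen positive and trace preserving; it is CP-divisible if it is divisible and the maps $\Phi_{t,s}$ ($0\le s\le t$) can be chosen completely positive and trace preserving. *)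

theory Defs
  imports "HOL-Analysis.Analysis"
begin

section \<open>Complex Hilbert spaces\<close>

text \<open>
  The inner product is antilinear in its first and linear in its second argument; the norm is
  the one induced by \<open>cinner\<close>, since \<open>norm x = sqrt (inner x x)\<close> in \<^class>\<open>real_inner\<close>.
\<close>

class complex_hilbert_space = real_inner + complete_space +
  fixes scaleC :: "complex \<Rightarrow> 'a \<Rightarrow> 'a"  (infixr "*\<^sub>C" 75)
    and cinner :: "'a \<Rightarrow> 'a \<Rightarrow> complex"
  assumes scaleC_add_right: "c *\<^sub>C (x + y) = c *\<^sub>C x + c *\<^sub>C y"
    and scaleC_add_left: "(c + d) *\<^sub>C x = c *\<^sub>C x + d *\<^sub>C x"
    and scaleC_scaleC: "c *\<^sub>C d *\<^sub>C x = (c * d) *\<^sub>C x"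
    and scaleC_of_real: "complex_of_real r *\<^sub>C x = r *\<^sub>R x"
    and cinner_commute: "cinner x y = cnj (cinner y x)"
    and cinner_add_right: "cinner x (y + z) = cinner x y + cinner x z"
    and cinner_scaleC_right: "cinner x (c *\<^sub>C y) = c * cinner x y"
    and Re_cinner: "Re (cinner x y) = inner x y"

definition is_onb :: "'a::complex_hilbert_space set \<Rightarrow> bool" where
  "is_onb B \<longleftrightarrow>
     (\<forall>e\<in>B. \<forall>f\<in>B. cinner e f = (if e = f then 1 else 0)) \<and>
     (\<forall>x. (\<forall>e\<in>B. cinner e x = 0) \<longrightarrow> x = 0)"

text \<open>A fixed orthonormal basis; it exists by \<open>is_onb_onb\<close> below.\<close>

definition onb :: "'a::complex_hilbert_space set" where
  "onb = (SOME B. is_onb B)"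

lemma cinner_zero_right [simp]: "cinner x 0 = 0"
  using cinner_add_right[of x 0 0] by simp

lemma cinner_zero_left [simp]: "cinner 0 x = 0"
  by (subst cinner_commute) simp

lemma cinner_add_left: "cinner (x + y) z = cinner x z + cinner y z"
  by (subst (1 2 3) cinner_commute) (simp add: cinner_add_right)

lemma cinner_scaleC_left: "cinner (c *\<^sub>C x) y = cnj c * cinner x y"
  by (subst (1 2) cinner_commute) (simp add: cinner_scaleC_right)

lemma cinner_minus_right: "cinner x (- y) = - cinner x y"
  using cinner_add_right[of x y "- y"] by (simp add: eq_neg_iff_add_eq_0 add.commute)

lemma cinner_diff_right: "cinner x (y - z) = cinner x y - cinner x z"
  using cinner_add_right[of x y "- z"] by (simp add: cinner_minus_right)

lemma cinner_diff_left: "cinner (x - y) z = cinner x z - cinner y z"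
  by (subst (1 2 3) cinner_commute) (simp add: cinner_diff_right)

lemma cinner_sum_right: "cinner x (\<Sum>i\<in>A. f i) = (\<Sum>i\<in>A. cinner x (f i))"
  by (induction A rule: infinite_finite_induct) (simp_all add: cinner_add_right)

lemma cinner_sum_left: "cinner (\<Sum>i\<in>A. f i) x = (\<Sum>i\<in>A. cinner (f i) x)"
  by (induction A rule: infinite_finite_induct) (simp_all add: cinner_add_left)

lemma cinner_self: "cinner x x = complex_of_real ((norm x)\<^sup>2)"
proof -
  have "Im (cinner x x) = 0"
    using arg_cong[OF cinner_commute[of x x], of Im] by simp
  moreover have "Re (cinner x x) = (norm x)\<^sup>2"
    by (simp add: Re_cinner power2_norm_eq_inner)
  ultimately show ?thesis by (simp add: complex_eq_iff)
qed

lemma norm_scaleC: "norm (c *\<^sub>C x) = cmod c * norm x"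
proof -
  have "complex_of_real ((norm (c *\<^sub>C x))\<^sup>2) = complex_of_real ((cmod c * norm x)\<^sup>2)"
    unfolding cinner_self[symmetric] cinner_scaleC_left cinner_scaleC_right
    by (simp add: cinner_self power_mult_distrib complex_norm_square mult.commute
        del: of_real_power)
  then have "(norm (c *\<^sub>C x))\<^sup>2 = (cmod c * norm x)\<^sup>2"
    using of_real_eq_iff by blast
  then show ?thesis
    by (simp add: power2_eq_iff_nonneg)
qed

lemma cmod_cinner_le: "cmod (cinner x y) \<le> norm x * norm y"
proof (cases "cinner x y = 0")
  case True
  then show ?thesis by simp
next
  case False
  define u where "u = cnj (sgn (cinner x y))"
  have "cinner x (u *\<^sub>C y) = complex_of_real (cmod (cinner x y))"
  proof -
    have "cnj (cinner x y) * cinner x y = (complex_of_real (cmod (cinner x y)))\<^sup>2"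
      by (metis complex_norm_square mult.commute of_real_power)
    then show ?thesis
      unfolding u_def cinner_scaleC_right sgn_eq
      using False by (simp add: power2_eq_square)
  qed
  then have "cmod (cinner x y) = inner x (u *\<^sub>C y)"
    by (metis Re_cinner Re_complex_of_real)
  also have "\<dots> \<le> norm x * norm (u *\<^sub>C y)"
    by (rule norm_cauchy_schwarz)
  also have "norm (u *\<^sub>C y) = norm y"
    using False by (simp add: norm_scaleC u_def norm_sgn)
  finally show ?thesis .
qed

lemma bounded_linear_cinner_right: "bounded_linear (cinner x)"
proof (rule bounded_linear_intro[where K = "norm x"])
  show "cinner x (r *\<^sub>R y) = r *\<^sub>R cinner x y" for r y
    by (metis cinner_scaleC_right scaleC_of_real scaleR_conv_of_real)
  show "norm (cinner x y) \<le> norm y * norm x" for y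
    using cmod_cinner_le[of x y] by (simp add: mult.commute)
qed (rule cinner_add_right)

lemma is_onb_onb: "is_onb (onb :: 'a::complex_hilbert_space set)"
proof -
  define ON where "ON = {B :: 'a set. \<forall>e\<in>B. \<forall>f\<in>B. cinner e f = (if e = f then 1 else 0)}"
  have "\<exists>M\<in>ON. \<forall>X\<in>ON. M \<subseteq> X \<longrightarrow> X = M"
  proof (rule subset_Zorn_nonempty)
    show "ON \<noteq> {}" by (auto simp: ON_def)
    fix C assume C: "C \<noteq> {}" "subset.chain ON C"
    show "\<Union>C \<in> ON"
      unfolding ON_def mem_Collect_eq
    proof (intro ballI)
      fix e f assume "e \<in> \<Union>C" "f \<in> \<Union>C"
      then obtain A B where AB: "A \<in> C" "B \<in> C" "e \<in> A" "f \<in> B" by blast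
      have "A \<subseteq> B \<or> B \<subseteq> A" "A \<in> ON" "B \<in> ON"
        using C AB by (auto simp: subset.chain_def)
      then show "cinner e f = (if e = f then 1 else 0)"
        using AB unfolding ON_def by blast
    qed
  qed
  then obtain M where M: "M \<in> ON" "\<And>X. X \<in> ON \<Longrightarrow> M \<subseteq> X \<Longrightarrow> X = M" by blast
  have "x = 0" if x: "\<forall>e\<in>M. cinner e x = 0" for x
  proof (rule ccontr)
    assume "x \<noteq> 0"
    define u where "u = complex_of_real (inverse (norm x)) *\<^sub>C x"
    have u: "cinner e u = 0" "cinner u e = 0" if "e \<in> M" for e
    proof -
      show "cinner e u = 0" using x that by (simp add: u_def cinner_scaleC_right)
      then show "cinner u e = 0" by (subst cinner_commute) simp
    qed
    have "norm u = 1" using \<open>x \<noteq> 0\<close> by (simp add: u_def norm_scaleC norm_inverse)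
    then have uu: "cinner u u = 1" by (simp add: cinner_self)
    then have "u \<notin> M" using u by force
    have "insert u M \<in> ON" using M(1) u uu \<open>u \<notin> M\<close> by (auto simp: ON_def)
    then have "insert u M = M" using M(2) by blast
    with \<open>u \<notin> M\<close> show False by blast
  qed
  then have "is_onb M" using M(1) by (simp add: is_onb_def ON_def)
  then show ?thesis unfolding onb_def by (rule someI)
qed

lemma cinner_onb: "e \<in> onb \<Longrightarrow> f \<in> onb \<Longrightarrow> cinner e f = (if e = f then 1 else 0)"
  using is_onb_onb unfolding is_onb_def by blast

lemma onb_total: "(\<And>e. e \<in> onb \<Longrightarrow> cinner e x = 0) \<Longrightarrow> x = 0"
  using is_onb_onb unfolding is_onb_def by blast

lemma norm_diff_onb_sum:
  assumes "finite F" "F \<subseteq> onb"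
  shows "(norm (x - (\<Sum>e\<in>F. cinner e x *\<^sub>C e)))\<^sup>2 = (norm x)\<^sup>2 - (\<Sum>e\<in>F. (cmod (cinner e x))\<^sup>2)"
proof -
  define p where "p = (\<Sum>e\<in>F. cinner e x *\<^sub>C e)"
  have ep: "cinner e p = cinner e x" if "e \<in> F" for e
  proof -
    have "cinner e p = (\<Sum>f\<in>F. cinner f x * (if e = f then 1 else 0))"
      unfolding p_def cinner_sum_right cinner_scaleC_right
      using assms that by (intro sum.cong) (auto simp: cinner_onb subset_iff)
    also have "\<dots> = cinner e x"
      using assms that by (simp add: if_distrib cong: if_cong)
    finally show ?thesis .
  qed
  have px: "cinner p y = (\<Sum>e\<in>F. cnj (cinner e x) * cinner e y)" for y
    by (simp add: p_def cinner_sum_left cinner_scaleC_left)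
  define s where "s = (\<Sum>e\<in>F. (cmod (cinner e x))\<^sup>2)"
  have pp: "cinner p p = of_real s" "cinner p x = of_real s"
    by (simp_all add: px ep s_def complex_norm_square mult.commute del: of_real_power)
  then have xp: "cinner x p = of_real s" by (subst cinner_commute) simp
  have "complex_of_real ((norm (x - p))\<^sup>2) = complex_of_real ((norm x)\<^sup>2 - s)"
    unfolding cinner_self[symmetric] cinner_diff_left cinner_diff_right pp xp
    by (simp add: cinner_self)
  then have "(norm (x - p))\<^sup>2 = (norm x)\<^sup>2 - s"
    using of_real_eq_iff by blast
  then show ?thesis by (simp add: p_def s_def)
qed

lemma bessel_finite:
  assumes "finite F" "F \<subseteq> onb"
  shows "(\<Sum>e\<in>F. (cmod (cinner e x))\<^sup>2) \<le> (norm x)\<^sup>2"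
  using norm_diff_onb_sum[OF assms, of x] by (smt (verit) zero_le_power2)

lemma onb_summable: "(\<lambda>e. (cmod (cinner e x))\<^sup>2) summable_on onb"
  by (rule nonneg_bounded_partial_sums_imp_summable_on[where C = "(norm x)\<^sup>2"])
    (auto intro!: eventually_finite_subsets_at_top_weakI bessel_finite)

lemma onb_expansion:
  fixes x :: "'a::complex_hilbert_space"
  shows "((\<lambda>e. cinner e x *\<^sub>C e) has_sum x) onb"
proof -
  define P where "P F = (\<Sum>e\<in>F. cinner e x *\<^sub>C e)" for F :: "'a set"
  define q where "q F = (\<Sum>e\<in>F. (cmod (cinner e x))\<^sup>2)" for F :: "'a set"
  define s where "s = infsum (\<lambda>e. (cmod (cinner e x))\<^sup>2) onb"
  have qs: "q F \<le> s" if "finite F" "F \<subseteq> onb" for F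
    unfolding q_def s_def using that by (intro finite_sum_le_infsum onb_summable) auto
  have "\<exists>F. finite F \<and> F \<subseteq> onb \<and> s - q F < r" if "r > 0" for r
  proof -
    have "\<exists>F. finite F \<and> F \<subseteq> onb \<and> dist (q F) s \<le> r/2"
      using infsum_finite_approximation[OF onb_summable[of x], of "r/2"] that
      unfolding q_def s_def by auto
    then obtain F where "finite F" "F \<subseteq> onb" "dist (q F) s \<le> r/2" by blast
    moreover from this have "s - q F < r" using that unfolding dist_real_def by linarith
    ultimately show ?thesis by blast
  qed
  then have "\<exists>F. finite F \<and> F \<subseteq> onb \<and> s - q F < inverse (real (Suc n))" for n
    by simp
  then obtain F where F: "\<And>n. finite (F n)" "\<And>n. F n \<subseteq> onb"
    "\<And>n. s - q (F n) < inverse (real (Suc n))" by metis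
  define G where "G n = (\<Union>i\<le>n. F i)" for n
  have G: "finite (G n)" "G n \<subseteq> onb" "mono G" for n
    using F by (auto simp: G_def mono_def intro: order_trans) 
  have qG: "s - q (G n) < inverse (real (Suc n))" for n
  proof -
    have "q (F n) \<le> q (G n)"
      unfolding q_def using G(1)[of n] by (intro sum_mono2) (auto simp: G_def)
    with F(3)[of n] show ?thesis by linarith
  qed
  have PP: "(norm (P B - P A))\<^sup>2 = q B - q A" if "finite B" "B \<subseteq> onb" "A \<subseteq> B" for A B
  proof -
    have fA: "finite A" "A \<subseteq> onb" using that finite_subset by auto
    have BA: "P B - P A = P (B - A)" "q B - q A = q (B - A)"
      unfolding P_def q_def using that by (simp_all add: sum_diff)
    have "(norm (P C))\<^sup>2 = q C" if C: "finite C" "C \<subseteq> onb" for C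
    proof -
      have "cinner e (P C) = cinner e x" if "e \<in> C" for e
      proof -
        have "cinner e (P C) = (\<Sum>f\<in>C. cinner f x * (if e = f then 1 else 0))"
          unfolding P_def cinner_sum_right cinner_scaleC_right
          using C that by (intro sum.cong) (auto simp: cinner_onb subset_iff)
        also have "\<dots> = cinner e x" using C that by (simp add: if_distrib cong: if_cong)
        finally show ?thesis .
      qed
      then have "cinner (P C) (P C) = of_real (q C)"
        by (subst P_def) (simp add: cinner_sum_left cinner_scaleC_left q_def
            complex_norm_square mult.commute del: of_real_power)
      then show ?thesis
        by (metis cinner_self of_real_eq_iff)
    qed
    then show ?thesis using that unfolding BA by auto
  qed
  have "Cauchy (\<lambda>n. P (G n))"
  proof (rule metric_CauchyI)
    fix r :: real assume "r > 0"
    then obtain N where N: "inverse (real (Suc N)) < (r/2)\<^sup>2"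
      using reals_Archimedean[of "(r/2)\<^sup>2"] by auto
    have *: "dist (P (G n)) (P (G N)) < r/2" if "n \<ge> N" for n
    proof -
      have "(norm (P (G n) - P (G N)))\<^sup>2 = q (G n) - q (G N)"
        using G that by (intro PP) (auto simp: mono_def)
      also have "\<dots> < (r/2)\<^sup>2" using qs[OF G(1,2)[of n]] qG[of N] N by linarith
      finally have "norm (P (G n) - P (G N)) < r/2"
        by (rule power2_less_imp_less) (use \<open>r > 0\<close> in simp)
      then show ?thesis by (simp add: dist_norm)
    qed
    then show "\<exists>M. \<forall>m\<ge>M. \<forall>n\<ge>M. dist (P (G m)) (P (G n)) < r"
      using dist_triangle_half_l[OF * *] by blast
  qed
  then obtain p where p: "(\<lambda>n. P (G n)) \<longlonglongrightarrow> p"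
    using Cauchy_convergent convergent_def by blast
  have "x - p = 0"
  proof (rule onb_total)
    fix e :: 'a assume e: "e \<in> onb"
    have lim: "(\<lambda>n. cinner e (x - P (G n))) \<longlonglongrightarrow> cinner e (x - p)"
      by (intro bounded_linear.tendsto[OF bounded_linear_cinner_right] tendsto_intros p)
    have bd: "(cmod (cinner e (x - P (G n))))\<^sup>2 \<le> inverse (real (Suc n))" for n
    proof -
      have eP: "cinner e (P (G n)) = (if e \<in> G n then cinner e x else 0)"
      proof -
        have "cinner e (P (G n)) = (\<Sum>f\<in>G n. cinner f x * (if e = f then 1 else 0))"
          unfolding P_def cinner_sum_right cinner_scaleC_right
          using G(2)[of n] e by (intro sum.cong) (auto simp: cinner_onb subset_iff)
        then show ?thesis using G(1)[of n] by (simp add: if_distrib cong: if_cong)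
      qed
      show ?thesis
      proof (cases "e \<in> G n")
        case True
        then show ?thesis by (simp add: cinner_diff_right eP)
      next
        case False
        have "q (insert e (G n)) \<le> s" using e G by (intro qs) auto
        moreover have "q (insert e (G n)) = (cmod (cinner e x))\<^sup>2 + q (G n)"
          unfolding q_def using False G(1)[of n] by simp
        ultimately show ?thesis
          using False qG[of n] by (simp add: cinner_diff_right eP)
      qed
    qed
    have "(\<lambda>n. (cmod (cinner e (x - P (G n))))\<^sup>2) \<longlonglongrightarrow> 0"
      by (rule tendsto_sandwich[OF always_eventually always_eventually[OF allI[OF bd]]
            tendsto_const LIMSEQ_inverse_real_of_nat]) simp
    moreover have "(\<lambda>n. (cmod (cinner e (x - P (G n))))\<^sup>2) \<longlonglongrightarrow> (cmod (cinner e (x - p)))\<^sup>2"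
      by (intro tendsto_intros lim)
    ultimately have "(cmod (cinner e (x - p)))\<^sup>2 = 0" using LIMSEQ_unique by blast
    then show "cinner e (x - p) = 0" by simp
  qed
  then have p: "(\<lambda>n. P (G n)) \<longlonglongrightarrow> x" using p by simp
  have "(P \<longlongrightarrow> x) (finite_subsets_at_top onb)"
  proof (rule tendstoI)
    fix r :: real assume "r > 0"
    then obtain n where n: "dist (P (G n)) x < r"
      using metric_LIMSEQ_D[OF p] by blast
    have "dist (P B) x < r" if B: "finite B" "G n \<subseteq> B" "B \<subseteq> onb" for B
    proof -
      have "q (G n) \<le> q B" unfolding q_def using B by (intro sum_mono2) auto
      then have "(norm (x - P B))\<^sup>2 \<le> (norm (x - P (G n)))\<^sup>2"
        using norm_diff_onb_sum[OF B(1,3), of x] norm_diff_onb_sum[OF G(1,2), of x n]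
        unfolding P_def q_def by simp
      then have "norm (x - P B) \<le> norm (x - P (G n))"
        by (rule power2_le_imp_le) simp
      then show ?thesis using n by (simp add: dist_norm norm_minus_commute)
    qed
    then show "\<forall>\<^sub>F B in finite_subsets_at_top onb. dist (P B) x < r"
      unfolding eventually_finite_subsets_at_top
      by (intro exI[of _ "G n"]) (simp add: G(1,2))
  qed
  then show ?thesis unfolding has_sum_def P_def .
qed

lemma parseval: "((\<lambda>e. cnj (cinner e x) * cinner e y) has_sum cinner x y) onb"
proof -
  have "((\<lambda>e. cinner x (cinner e y *\<^sub>C e)) has_sum cinner x y) onb"
    by (rule has_sum_bounded_linear[OF bounded_linear_cinner_right onb_expansion])
  moreover have "cinner x (cinner e y *\<^sub>C e) = cnj (cinner e x) * cinner e y" for e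
    by (metis cinner_commute cinner_scaleC_right mult.commute)
  ultimately show ?thesis by simp
qed


section \<open>The Hilbert space tensor product\<close>

text \<open>
  A vector of the tensor product is represented by its square summable coefficient family with
  respect to the product of the chosen orthonormal bases. By \<open>cinner_tensor\<close> and
  \<open>tensor_total\<close> below this is a Hilbert space tensor product in the basis-free sense:
  \<open>\<langle>x \<otimes> y, x' \<otimes> y'\<rangle> = \<langle>x, x'\<rangle> \<langle>y, y'\<rangle>\<close>, and the product vectors are total.
\<close>

definition l2_coeffs ::
  "('a::complex_hilbert_space \<times> 'b::complex_hilbert_space \<Rightarrow> complex) set" where
  "l2_coeffs = {c. (\<forall>p. p \<notin> onb \<times> onb \<longrightarrow> c p = 0) \<and>
                   (\<lambda>p. (cmod (c p))\<^sup>2) summable_on onb \<times> onb}"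

lemma l2_coeffs_zero: "(\<lambda>p. 0) \<in> l2_coeffs"
  by (simp add: l2_coeffs_def)

lemma l2_coeffs_cmult: "f \<in> l2_coeffs \<Longrightarrow> (\<lambda>p. c * f p) \<in> l2_coeffs"
  by (auto simp: l2_coeffs_def norm_mult power_mult_distrib intro!: summable_on_cmult_right)

lemma l2_coeffs_add:
  assumes "f \<in> l2_coeffs" "g \<in> l2_coeffs"
  shows "(\<lambda>p. f p + g p) \<in> l2_coeffs"
proof -
  have "(\<lambda>p. 2 * (cmod (f p))\<^sup>2 + 2 * (cmod (g p))\<^sup>2) summable_on onb \<times> onb"
    using assms by (intro summable_on_add summable_on_cmult_right) (auto simp: l2_coeffs_def)
  moreover have "(cmod (f p + g p))\<^sup>2 \<le> 2 * (cmod (f p))\<^sup>2 + 2 * (cmod (g p))\<^sup>2" for p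
  proof -
    have "(cmod (f p + g p))\<^sup>2 \<le> (cmod (f p) + cmod (g p))\<^sup>2"
      by (intro power_mono norm_triangle_ineq) simp
    also have "\<dots> \<le> 2 * (cmod (f p))\<^sup>2 + 2 * (cmod (g p))\<^sup>2"
      using sum_squares_bound[of "cmod (f p)" "cmod (g p)"] by (simp add: power2_sum)
    finally show ?thesis .
  qed
  ultimately have "(\<lambda>p. (cmod (f p + g p))\<^sup>2) summable_on onb \<times> onb"
    by (rule summable_on_comparison_test) auto
  then show ?thesis using assms by (simp add: l2_coeffs_def)
qed

lemma l2_coeffs_diff:
  assumes "f \<in> l2_coeffs" "g \<in> l2_coeffs"
  shows "(\<lambda>p. f p - g p) \<in> l2_coeffs"
  using l2_coeffs_add[OF assms(1) l2_coeffs_cmult[OF assms(2), of "-1"]] by simp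

lemma l2_coeffs_prod_summable:
  assumes "f \<in> l2_coeffs" "g \<in> l2_coeffs"
  shows "(\<lambda>p. cnj (f p) * g p) summable_on onb \<times> onb"
proof (rule abs_summable_summable)
  have "(\<lambda>p. (cmod (f p))\<^sup>2 + (cmod (g p))\<^sup>2) summable_on onb \<times> onb"
    using assms by (intro summable_on_add) (auto simp: l2_coeffs_def)
  then show "(\<lambda>p. norm (cnj (f p) * g p)) summable_on onb \<times> onb"
  proof (rule summable_on_comparison_test)
    fix p
    have "2 * (cmod (f p) * cmod (g p)) \<le> (cmod (f p))\<^sup>2 + (cmod (g p))\<^sup>2"
      using sum_squares_bound[of "cmod (f p)" "cmod (g p)"] by simp
    moreover have "0 \<le> cmod (f p) * cmod (g p)" by simp
    moreover have "norm (cnj (f p) * g p) = cmod (f p) * cmod (g p)"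
      by (simp add: norm_mult)
    ultimately show "norm (cnj (f p) * g p) \<le> (cmod (f p))\<^sup>2 + (cmod (g p))\<^sup>2"
      by linarith
  qed simp
qed

typedef (overloaded) ('a::complex_hilbert_space, 'b::complex_hilbert_space) tensor =
  "l2_coeffs :: ('a \<times> 'b \<Rightarrow> complex) set"
  morphisms tcoeffs Abs_tensor
  using l2_coeffs_zero by blast

setup_lifting type_definition_tensor

lemma tcoeffs_outside: "p \<notin> onb \<times> onb \<Longrightarrow> tcoeffs t p = 0"
  using tcoeffs[of t] unfolding l2_coeffs_def by blast

instantiation tensor :: (complex_hilbert_space, complex_hilbert_space) real_vector
begin

lift_definition zero_tensor :: "('a, 'b) tensor" is "\<lambda>p. 0"
  by (rule l2_coeffs_zero)

lift_definition plus_tensor :: "('a, 'b) tensor \<Rightarrow> ('a, 'b) tensor \<Rightarrow> ('a, 'b) tensor"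
  is "\<lambda>f g p. f p + g p"
  by (rule l2_coeffs_add)

lift_definition minus_tensor :: "('a, 'b) tensor \<Rightarrow> ('a, 'b) tensor \<Rightarrow> ('a, 'b) tensor"
  is "\<lambda>f g p. f p - g p"
  by (rule l2_coeffs_diff)

lift_definition uminus_tensor :: "('a, 'b) tensor \<Rightarrow> ('a, 'b) tensor"
  is "\<lambda>f p. - f p"
  using l2_coeffs_cmult[where c = "-1"] by simp

lift_definition scaleR_tensor :: "real \<Rightarrow> ('a, 'b) tensor \<Rightarrow> ('a, 'b) tensor"
  is "\<lambda>r f p. of_real r * f p"
  by (rule l2_coeffs_cmult)

instance
proof
  fix s t u :: "('a, 'b) tensor" and a b :: real
  show "s + t + u = s + (t + u)" "s + t = t + s" "0 + s = s" "- s + s = 0" "s - t = s + - t"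
    by (transfer; auto simp: fun_eq_iff)+
  show "a *\<^sub>R (s + t) = a *\<^sub>R s + a *\<^sub>R t" "(a + b) *\<^sub>R s = a *\<^sub>R s + b *\<^sub>R s"
    "a *\<^sub>R b *\<^sub>R s = (a * b) *\<^sub>R s" "1 *\<^sub>R s = s"
    by (transfer; simp add: fun_eq_iff algebra_simps)+
qed

end

instantiation tensor :: (complex_hilbert_space, complex_hilbert_space) real_inner
begin

definition inner_tensor :: "('a, 'b) tensor \<Rightarrow> ('a, 'b) tensor \<Rightarrow> real" where
  "inner_tensor s t = Re (\<Sum>\<^sub>\<infinity>p\<in>onb \<times> onb. cnj (tcoeffs s p) * tcoeffs t p)"

definition norm_tensor :: "('a, 'b) tensor \<Rightarrow> real" where
  "norm_tensor t = sqrt (inner t t)"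

definition dist_tensor :: "('a, 'b) tensor \<Rightarrow> ('a, 'b) tensor \<Rightarrow> real" where
  "dist_tensor s t = norm (s - t)"

definition sgn_tensor :: "('a, 'b) tensor \<Rightarrow> ('a, 'b) tensor" where
  "sgn_tensor t = inverse (norm t) *\<^sub>R t"

definition uniformity_tensor :: "(('a, 'b) tensor \<times> ('a, 'b) tensor) filter" where
  "uniformity_tensor = (INF e\<in>{0<..}. principal {(s, t). dist s t < e})"

definition open_tensor :: "('a, 'b) tensor set \<Rightarrow> bool" where
  "open_tensor U \<longleftrightarrow> (\<forall>s\<in>U. \<forall>\<^sub>F (s', t) in uniformity. s' = s \<longrightarrow> t \<in> U)"

lemma coeffs_prod_summable:
  "(\<lambda>p. cnj (tcoeffs (s :: ('a, 'b) tensor) p) * tcoeffs t p) summable_on onb \<times> onb"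
  using tcoeffs l2_coeffs_prod_summable by blast

lemma inner_tensor_self:
  "inner (t :: ('a, 'b) tensor) t = (\<Sum>\<^sub>\<infinity>p\<in>onb \<times> onb. (cmod (tcoeffs t p))\<^sup>2)"
proof -
  have "inner t t = (\<Sum>\<^sub>\<infinity>p\<in>onb \<times> onb. Re (cnj (tcoeffs t p) * tcoeffs t p))"
    unfolding inner_tensor_def by (intro infsum_Re[symmetric] coeffs_prod_summable)
  also have "(\<lambda>p. Re (cnj (tcoeffs t p) * tcoeffs t p)) = (\<lambda>p. (cmod (tcoeffs t p))\<^sup>2)"
    unfolding cmod_power2 by (simp add: power2_eq_square)
  finally show ?thesis .
qed

instance
proof
  fix s t u :: "('a, 'b) tensor" and a b :: real
  show "dist s t = norm (s - t)" "sgn s = s /\<^sub>R norm s"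
    by (rule dist_tensor_def sgn_tensor_def)+
  show "uniformity = (INF e\<in>{0<..}. principal {(s, t :: ('a, 'b) tensor). dist s t < e})"
    by (rule uniformity_tensor_def)
  show "open U \<longleftrightarrow> (\<forall>s\<in>U. \<forall>\<^sub>F (s', t) in uniformity. s' = s \<longrightarrow> t \<in> U)"
    for U :: "('a, 'b) tensor set"
    by (rule open_tensor_def)
  show "inner s t = inner t s"
  proof -
    have "(\<Sum>\<^sub>\<infinity>p\<in>onb \<times> onb. cnj (tcoeffs s p) * tcoeffs t p) =
        cnj (\<Sum>\<^sub>\<infinity>p\<in>onb \<times> onb. cnj (tcoeffs t p) * tcoeffs s p)"
      by (simp add: infsum_cnj[symmetric] mult.commute)
    then show ?thesis by (simp add: inner_tensor_def)
  qed
  show "inner (s + t) u = inner s u + inner t u"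
    by (simp add: inner_tensor_def plus_tensor.rep_eq ring_distribs
        infsum_add[OF coeffs_prod_summable coeffs_prod_summable])
  show "inner (a *\<^sub>R s) t = a * inner s t"
    by (simp add: inner_tensor_def scaleR_tensor.rep_eq mult.assoc infsum_cmult_right')
  show "0 \<le> inner s s"
    by (simp add: inner_tensor_self infsum_nonneg)
  show "inner s s = 0 \<longleftrightarrow> s = 0"
  proof
    assume "inner s s = 0"
    then have "(cmod (tcoeffs s p))\<^sup>2 = 0" if "p \<in> onb \<times> onb" for p
      using tcoeffs[of s] that unfolding inner_tensor_self
      by (intro nonneg_infsum_le_0D[where A = "onb \<times> onb"]) (auto simp: l2_coeffs_def)
    then have "tcoeffs s p = 0" for p
      by (cases "p \<in> onb \<times> onb") (simp_all add: tcoeffs_outside)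
    then show "s = 0" by transfer auto
  qed (simp add: inner_tensor_self zero_tensor.rep_eq)
  show "norm s = sqrt (inner s s)"
    by (rule norm_tensor_def)
qed

end

lemma norm_tensor_sq_has_sum:
  "((\<lambda>p. (cmod (tcoeffs t p))\<^sup>2) has_sum (norm t)\<^sup>2) (onb \<times> onb)"
  using tcoeffs[of t]
  by (auto simp: power2_norm_eq_inner inner_tensor_self l2_coeffs_def intro: has_sum_infsum)

lemma sum_coeffs_le_norm:
  assumes "finite F" "F \<subseteq> onb \<times> onb"
  shows "(\<Sum>p\<in>F. (cmod (tcoeffs t p))\<^sup>2) \<le> (norm t)\<^sup>2"
  using norm_tensor_sq_has_sum by (rule finite_sum_le_has_sum) (use assms in auto)

lemma cmod_coeffs_le_norm: "cmod (tcoeffs t p) \<le> norm t"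
proof (cases "p \<in> onb \<times> onb")
  case True
  then show ?thesis
    using sum_coeffs_le_norm[of "{p}" t] by (auto intro: power2_le_imp_le)
next
  case False
  then show ?thesis by (simp add: tcoeffs_outside)
qed

instance tensor :: (complex_hilbert_space, complex_hilbert_space) complete_space
proof
  fix X :: "nat \<Rightarrow> ('a, 'b) tensor"
  assume X: "Cauchy X"
  have "Cauchy (\<lambda>n. tcoeffs (X n) p)" for p
  proof (rule metric_CauchyI)
    fix r :: real assume "r > 0"
    then obtain N where N: "\<And>m n. m \<ge> N \<Longrightarrow> n \<ge> N \<Longrightarrow> dist (X m) (X n) < r"
      using X unfolding Cauchy_def by meson
    have "dist (tcoeffs (X m) p) (tcoeffs (X n) p) \<le> dist (X m) (X n)" for m n
      using cmod_coeffs_le_norm[of "X m - X n" p] by (simp add: dist_norm minus_tensor.rep_eq)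
    then show "\<exists>M. \<forall>m\<ge>M. \<forall>n\<ge>M. dist (tcoeffs (X m) p) (tcoeffs (X n) p) < r"
      using N by (meson order_le_less_trans)
  qed
  then obtain l where l: "\<And>p. (\<lambda>n. tcoeffs (X n) p) \<longlonglongrightarrow> l p"
    unfolding Cauchy_convergent_iff convergent_def by metis
  have bound: "\<exists>N. \<forall>n\<ge>N. \<forall>F. finite F \<and> F \<subseteq> onb \<times> onb \<longrightarrow>
      (\<Sum>p\<in>F. (cmod (l p - tcoeffs (X n) p))\<^sup>2) \<le> r\<^sup>2" if "r > 0" for r
  proof -
    obtain N where N: "\<And>m n. m \<ge> N \<Longrightarrow> n \<ge> N \<Longrightarrow> norm (X m - X n) < r"
      using X \<open>r > 0\<close> unfolding Cauchy_def dist_norm by meson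
    have "(\<Sum>p\<in>F. (cmod (l p - tcoeffs (X n) p))\<^sup>2) \<le> r\<^sup>2"
      if "n \<ge> N" "finite F" "F \<subseteq> onb \<times> onb" for n F
    proof (rule LIMSEQ_le_const2)
      show "(\<lambda>m. \<Sum>p\<in>F. (cmod (tcoeffs (X m) p - tcoeffs (X n) p))\<^sup>2)
          \<longlonglongrightarrow> (\<Sum>p\<in>F. (cmod (l p - tcoeffs (X n) p))\<^sup>2)"
        by (intro tendsto_intros l)
      have "(\<Sum>p\<in>F. (cmod (tcoeffs (X m) p - tcoeffs (X n) p))\<^sup>2) \<le> r\<^sup>2" if "m \<ge> N" for m
      proof -
        have "(\<Sum>p\<in>F. (cmod (tcoeffs (X m) p - tcoeffs (X n) p))\<^sup>2) \<le> (norm (X m - X n))\<^sup>2"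
          using sum_coeffs_le_norm[OF \<open>finite F\<close> \<open>F \<subseteq> onb \<times> onb\<close>, of "X m - X n"]
          by (simp add: minus_tensor.rep_eq)
        also have "\<dots> \<le> r\<^sup>2"
          using N[OF \<open>m \<ge> N\<close> \<open>n \<ge> N\<close>] by (intro power_mono) auto
        finally show ?thesis .
      qed
      then show "\<exists>M. \<forall>m\<ge>M. (\<Sum>p\<in>F. (cmod (tcoeffs (X m) p - tcoeffs (X n) p))\<^sup>2) \<le> r\<^sup>2"
        by blast
    qed
    then show ?thesis by blast
  qed
  have l0: "l p = 0" if "p \<notin> onb \<times> onb" for p
  proof -
    have "tcoeffs (X n) p = 0" for n using that by (rule tcoeffs_outside)
    then show ?thesis using l[of p] by (simp add: LIMSEQ_const_iff)
  qed
  obtain N where N: "\<And>F. finite F \<Longrightarrow> F \<subseteq> onb \<times> onb \<Longrightarrow>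
      (\<Sum>p\<in>F. (cmod (l p - tcoeffs (X N) p))\<^sup>2) \<le> 1"
    using bound[of 1] by auto
  have "(\<lambda>p. (cmod (l p - tcoeffs (X N) p))\<^sup>2) summable_on onb \<times> onb"
    by (rule nonneg_bounded_partial_sums_imp_summable_on[where C = 1])
      (auto intro!: eventually_finite_subsets_at_top_weakI N)
  then have "(\<lambda>p. l p - tcoeffs (X N) p) \<in> l2_coeffs"
    using l0 tcoeffs[of "X N"] by (simp add: l2_coeffs_def)
  from l2_coeffs_add[OF this tcoeffs[of "X N"]] have "l \<in> l2_coeffs" by simp
  then have L: "tcoeffs (Abs_tensor l) = l" by (rule Abs_tensor_inverse)
  have "X \<longlonglongrightarrow> Abs_tensor l"
  proof (rule metric_LIMSEQ_I)
    fix r :: real assume "r > 0"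
    then obtain N where N: "\<And>n F. n \<ge> N \<Longrightarrow> finite F \<Longrightarrow> F \<subseteq> onb \<times> onb \<Longrightarrow>
      (\<Sum>p\<in>F. (cmod (l p - tcoeffs (X n) p))\<^sup>2) \<le> (r/2)\<^sup>2"
      using bound[of "r/2"] by auto
    have "dist (X n) (Abs_tensor l) < r" if "n \<ge> N" for n
    proof -
      have "(norm (Abs_tensor l - X n))\<^sup>2 \<le> (r/2)\<^sup>2"
        by (rule has_sum_le_finite_sums[OF norm_tensor_sq_has_sum])
          (simp add: minus_tensor.rep_eq L N[OF that])
      then have "norm (Abs_tensor l - X n) \<le> r/2"
        by (rule power2_le_imp_le) (use \<open>r > 0\<close> in simp)
      then show ?thesis using \<open>r > 0\<close> by (simp add: dist_norm norm_minus_commute)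
    qed
    then show "\<exists>N. \<forall>n\<ge>N. dist (X n) (Abs_tensor l) < r" by blast
  qed
  then show "convergent X" by (auto simp: convergent_def)
qed

instantiation tensor :: (complex_hilbert_space, complex_hilbert_space) complex_hilbert_space
begin

lift_definition scaleC_tensor :: "complex \<Rightarrow> ('a, 'b) tensor \<Rightarrow> ('a, 'b) tensor"
  is "\<lambda>c f p. c * f p"
  by (rule l2_coeffs_cmult)

definition cinner_tensor :: "('a, 'b) tensor \<Rightarrow> ('a, 'b) tensor \<Rightarrow> complex" where
  "cinner_tensor s t = (\<Sum>\<^sub>\<infinity>p\<in>onb \<times> onb. cnj (tcoeffs s p) * tcoeffs t p)"

instance
proof
  fix s t u :: "('a, 'b) tensor" and c d :: complex and r :: real
  show "c *\<^sub>C (s + t) = c *\<^sub>C s + c *\<^sub>C t" "(c + d) *\<^sub>C s = c *\<^sub>C s + d *\<^sub>C s"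
    "c *\<^sub>C d *\<^sub>C s = (c * d) *\<^sub>C s" "complex_of_real r *\<^sub>C s = r *\<^sub>R s"
    by (transfer; simp add: fun_eq_iff algebra_simps)+
  show "cinner s t = cnj (cinner t s)"
    by (simp add: cinner_tensor_def infsum_cnj[symmetric] mult.commute)
  show "cinner s (t + u) = cinner s t + cinner s u"
    by (simp add: cinner_tensor_def plus_tensor.rep_eq ring_distribs
        infsum_add[OF coeffs_prod_summable coeffs_prod_summable])
  show "cinner s (c *\<^sub>C t) = c * cinner s t"
    by (simp add: cinner_tensor_def scaleC_tensor.rep_eq infsum_cmult_right'[symmetric] mult_ac)
  show "Re (cinner s t) = inner s t"
    by (simp add: cinner_tensor_def inner_tensor_def)
qed

end

lift_definition tensor_vec ::
  "'a::complex_hilbert_space \<Rightarrow> 'b::complex_hilbert_space \<Rightarrow> ('a, 'b) tensor"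
    (infixr "\<otimes>\<^sub>v" 70)
  is "\<lambda>x y (e, f). if e \<in> onb \<and> f \<in> onb then cinner e x * cinner f y else 0"
proof -
  fix x :: 'a and y :: 'b
  have "((\<lambda>f. (cmod (cinner e x))\<^sup>2 * (cmod (cinner f y))\<^sup>2) has_sum
      (cmod (cinner e x))\<^sup>2 * infsum (\<lambda>f. (cmod (cinner f y))\<^sup>2) onb) onb" for e
    by (intro has_sum_cmult_right has_sum_infsum onb_summable)
  then have "(\<lambda>p. (cmod (cinner (fst p) x))\<^sup>2 * (cmod (cinner (snd p) y))\<^sup>2)
      summable_on onb \<times> onb"
    by (intro summable_on_SigmaI[where
          g = "\<lambda>e. (cmod (cinner e x))\<^sup>2 * infsum (\<lambda>f. (cmod (cinner f y))\<^sup>2) onb"])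
      (auto intro!: summable_on_cmult_left onb_summable)
  also have "?this \<longleftrightarrow> (\<lambda>p. (cmod (case p of (e, f) \<Rightarrow>
      if e \<in> onb \<and> f \<in> onb then cinner e x * cinner f y else 0))\<^sup>2) summable_on onb \<times> onb"
    by (intro summable_on_cong) (auto simp: norm_mult power_mult_distrib)
  finally show "(\<lambda>(e, f). if e \<in> onb \<and> f \<in> onb then cinner e x * cinner f y else 0) \<in> l2_coeffs"
    by (auto simp: l2_coeffs_def)
qed

lemma cinner_tensor_vec:
  "cinner (x \<otimes>\<^sub>v y) (x' \<otimes>\<^sub>v y') = cinner x x' * cinner y y'"
proof -
  define c where "c p = cnj (tcoeffs (x \<otimes>\<^sub>v y) p) * tcoeffs (x' \<otimes>\<^sub>v y') p" for p
  have c: "c (e, f) = (cnj (cinner e x) * cinner e x') * (cnj (cinner f y) * cinner f y')"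
    if "e \<in> onb" "f \<in> onb" for e f
    using that by (simp add: c_def tensor_vec.rep_eq)
  have "(c has_sum cinner x x' * cinner y y') (onb \<times> onb)"
  proof (rule has_sum_SigmaI)
    fix e :: 'a assume e: "e \<in> onb"
    have "((\<lambda>f. (cnj (cinner e x) * cinner e x') * (cnj (cinner f y) * cinner f y')) has_sum
        (cnj (cinner e x) * cinner e x') * cinner y y') onb"
      by (intro has_sum_cmult_right parseval)
    also have "?this \<longleftrightarrow> ((\<lambda>f. c (e, f)) has_sum
        (cnj (cinner e x) * cinner e x') * cinner y y') onb"
      by (intro has_sum_cong) (simp add: c e)
    finally show "((\<lambda>f. c (e, f)) has_sum
        (cnj (cinner e x) * cinner e x') * cinner y y') onb" .
  next
    show "((\<lambda>e. (cnj (cinner e x) * cinner e x') * cinner y y') has_sum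
        cinner x x' * cinner y y') onb"
      by (intro has_sum_cmult_left parseval)
    show "c summable_on onb \<times> onb"
      unfolding c_def by (rule coeffs_prod_summable)
  qed
  then show ?thesis
    unfolding cinner_tensor_def c_def by (rule infsumI)
qed

lemma tensor_total:
  fixes t :: "('a::complex_hilbert_space, 'b::complex_hilbert_space) tensor"
  assumes "\<And>x y. cinner (x \<otimes>\<^sub>v y) t = 0"
  shows "t = 0"
proof -
  have "tcoeffs t (e, f) = 0" if ef: "e \<in> onb" "f \<in> onb" for e f
  proof -
    have "cinner (e \<otimes>\<^sub>v f) t =
        (\<Sum>\<^sub>\<infinity>p\<in>onb \<times> onb. if p = (e, f) then tcoeffs t (e, f) else 0)"
      unfolding cinner_tensor_def
    proof (intro infsum_cong)
      fix p :: "'a \<times> 'b" assume p: "p \<in> onb \<times> onb"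
      obtain a b where ab: "p = (a, b)" by (cases p)
      have "cinner a e = (if a = e then 1 else 0)" "cinner b f = (if b = f then 1 else 0)"
        using p ab ef by (auto simp: cinner_onb)
      then show "cnj (tcoeffs (e \<otimes>\<^sub>v f) p) * tcoeffs t p =
          (if p = (e, f) then tcoeffs t (e, f) else 0)"
        using p ab by (simp add: tensor_vec.rep_eq)
    qed
    also have "\<dots> = (\<Sum>\<^sub>\<infinity>p\<in>{(e, f)}. tcoeffs t (e, f))"
      using ef by (intro infsum_cong_neutral) auto
    finally show ?thesis using assms by simp
  qed
  then have "tcoeffs t p = 0" for p
    using tcoeffs_outside[of p t] by (cases p) blast
  then show ?thesis by transfer auto
qed

section \<open>Trace class operators\<close>

definition bounded_clinear ::
  "('a::complex_hilbert_space \<Rightarrow> 'b::complex_hilbert_space) \<Rightarrow> bool" where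
  "bounded_clinear A \<longleftrightarrow> bounded_linear A \<and> (\<forall>c x. A (c *\<^sub>C x) = c *\<^sub>C A x)"

definition cadjoint :: "('a::complex_hilbert_space \<Rightarrow> 'a) \<Rightarrow> 'a \<Rightarrow> 'a" where
  "cadjoint A = (THE B. bounded_clinear B \<and> (\<forall>x y. cinner (B x) y = cinner x (A y)))"

definition hermitian_op :: "('a::complex_hilbert_space \<Rightarrow> 'a) \<Rightarrow> bool" where
  "hermitian_op A \<longleftrightarrow> bounded_clinear A \<and> cadjoint A = A"

definition positive_op :: "('a::complex_hilbert_space \<Rightarrow> 'a) \<Rightarrow> bool" where
  "positive_op A \<longleftrightarrow> bounded_clinear A \<and> (\<forall>x. cinner x (A x) \<in> \<real>\<^sub>\<ge>\<^sub>0)"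

text \<open>\<open>|A|\<close>, the positive square root of \<open>A\<^sup>* A\<close>.\<close>

definition abs_op :: "('a::complex_hilbert_space \<Rightarrow> 'a) \<Rightarrow> 'a \<Rightarrow> 'a" where
  "abs_op A = (THE P. positive_op P \<and> P \<circ> P = cadjoint A \<circ> A)"

definition trace_class :: "('a::complex_hilbert_space \<Rightarrow> 'a) set" where
  "trace_class = {A. bounded_clinear A \<and> (\<lambda>e. cinner e (abs_op A e)) summable_on onb}"

definition op_trace :: "('a::complex_hilbert_space \<Rightarrow> 'a) \<Rightarrow> complex" where
  "op_trace A = (\<Sum>\<^sub>\<infinity>e\<in>onb. cinner e (A e))"

definition trace_norm :: "('a::complex_hilbert_space \<Rightarrow> 'a) \<Rightarrow> real" where
  "trace_norm A = Re (op_trace (abs_op A))"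

section \<open>Maps on the trace class\<close>

text \<open>
  A map on the trace class is a function on all functions \<open>'a \<Rightarrow> 'a\<close> of which only the values on
  \<open>trace_class\<close> matter.
\<close>

type_synonym 'a superop = "('a \<Rightarrow> 'a) \<Rightarrow> 'a \<Rightarrow> 'a"

definition linear_superop :: "'a::complex_hilbert_space superop \<Rightarrow> bool" where
  "linear_superop \<Phi> \<longleftrightarrow>
     (\<forall>A\<in>trace_class. \<Phi> A \<in> trace_class) \<and>
     (\<forall>A\<in>trace_class. \<forall>B\<in>trace_class. \<Phi> (\<lambda>x. A x + B x) = (\<lambda>x. \<Phi> A x + \<Phi> B x)) \<and>
     (\<forall>c. \<forall>A\<in>trace_class. \<Phi> (\<lambda>x. c *\<^sub>C A x) = (\<lambda>x. c *\<^sub>C \<Phi> A x))"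

definition trace_preserving :: "'a::complex_hilbert_space superop \<Rightarrow> bool" where
  "trace_preserving \<Phi> \<longleftrightarrow> (\<forall>A\<in>trace_class. op_trace (\<Phi> A) = op_trace A)"

definition positive_map :: "'a::complex_hilbert_space superop \<Rightarrow> bool" where
  "positive_map \<Phi> \<longleftrightarrow> (\<forall>A\<in>trace_class. positive_op A \<longrightarrow> positive_op (\<Phi> A))"

text \<open>
  \<open>X i j\<close> with \<open>i, j < n\<close> are the blocks of an operator on \<open>\<complex>\<^sup>n \<otimes> H\<close>, the \<open>n\<close>-fold direct sum
  of \<open>H\<close>; \<open>id\<^sub>n \<otimes> \<Phi>\<close> applies \<open>\<Phi>\<close> to each block.
\<close>

definition positive_block ::
  "nat \<Rightarrow> (nat \<Rightarrow> nat \<Rightarrow> 'a::complex_hilbert_space \<Rightarrow> 'a) \<Rightarrow> bool" where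
  "positive_block n X \<longleftrightarrow>
     (\<forall>v. (\<Sum>i<n. \<Sum>j<n. cinner (v i) (X i j (v j))) \<in> \<real>\<^sub>\<ge>\<^sub>0)"

definition completely_positive :: "'a::complex_hilbert_space superop \<Rightarrow> bool" where
  "completely_positive \<Phi> \<longleftrightarrow>
     (\<forall>n X. (\<forall>i<n. \<forall>j<n. X i j \<in> trace_class) \<and> positive_block n X
        \<longrightarrow> positive_block n (\<lambda>i j. \<Phi> (X i j)))"

text \<open>The operator \<open>A \<otimes> B\<close> on the Hilbert space tensor product.\<close>

definition tensor_op ::
  "('a::complex_hilbert_space \<Rightarrow> 'a) \<Rightarrow> ('b::complex_hilbert_space \<Rightarrow> 'b) \<Rightarrow>
     ('a, 'b) tensor \<Rightarrow> ('a, 'b) tensor" where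
  "tensor_op A B = (THE C. bounded_clinear C \<and> (\<forall>x y. C (x \<otimes>\<^sub>v y) = A x \<otimes>\<^sub>v B y))"

text \<open>
  The map \<open>id \<otimes> \<Phi>\<close> on the trace class of the tensor product: the linear map, bounded in trace norm,
  with \<open>A \<otimes> B \<mapsto> A \<otimes> \<Phi> B\<close>. Its values on \<open>trace_class\<close> are unique, as the span of the
  operators \<open>A \<otimes> B\<close> is dense in trace norm; it exists for every completely positive and trace
  preserving linear \<open>\<Phi>\<close>. (\<open>SOME\<close> rather than \<open>THE\<close> only because of the irrelevant values
  outside \<open>trace_class\<close>.)
\<close>

definition id_tensor ::
  "'b::complex_hilbert_space superop \<Rightarrow> ('a::complex_hilbert_space, 'b) tensor superop" where
  "id_tensor \<Phi> = (SOME F. linear_superop F \<and>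
     (\<exists>K. \<forall>Y\<in>trace_class. trace_norm (F Y) \<le> K * trace_norm Y) \<and>
     (\<forall>A\<in>trace_class. \<forall>B\<in>trace_class. F (tensor_op A B) = tensor_op A (\<Phi> B)))"

section \<open>Dynamical maps and divisibility\<close>

definition dynamical_map :: "(real \<Rightarrow> 'a::complex_hilbert_space superop) \<Rightarrow> bool" where
  "dynamical_map \<Lambda> \<longleftrightarrow>
     (\<forall>t\<ge>0. linear_superop (\<Lambda> t) \<and> completely_positive (\<Lambda> t) \<and> trace_preserving (\<Lambda> t))"

definition propagator ::
  "(real \<Rightarrow> 'a::complex_hilbert_space superop) \<Rightarrow> real \<Rightarrow> real \<Rightarrow> 'a superop \<Rightarrow> bool" where
  "propagator \<Lambda> t s \<Phi> \<longleftrightarrow> linear_superop \<Phi> \<and> (\<forall>A\<in>trace_class. \<Lambda> t A = \<Phi> (\<Lambda> s A))"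

definition P_divisible :: "(real \<Rightarrow> 'a::complex_hilbert_space superop) \<Rightarrow> bool" where
  "P_divisible \<Lambda> \<longleftrightarrow> (\<forall>s t. 0 \<le> s \<and> s \<le> t \<longrightarrow>
     (\<exists>\<Phi>. propagator \<Lambda> t s \<Phi> \<and> positive_map \<Phi> \<and> trace_preserving \<Phi>))"

definition CP_divisible :: "(real \<Rightarrow> 'a::complex_hilbert_space superop) \<Rightarrow> bool" where
  "CP_divisible \<Lambda> \<longleftrightarrow> (\<forall>s t. 0 \<le> s \<and> s \<le> t \<longrightarrow>
     (\<exists>\<Phi>. propagator \<Lambda> t s \<Phi> \<and> completely_positive \<Phi> \<and> trace_preserving \<Phi>))"

end

theory Submission
  imports Defs
begin

text \<open>
  A positive trace preserving map contracts the trace norm of Hermitian operators, because it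
  preserves the trace norms of the two parts of the Jordan decomposition. Conversely, if a trace
  preserving map \<open>\<Phi>\<close> contracts and \<open>A\<close> is positive, then \<open>\<parallel>\<Phi> A\<parallel>\<^sub>1 \<le> \<parallel>A\<parallel>\<^sub>1 = Tr A = Tr (\<Phi> A)\<close> forces the
  negative part of \<open>\<Phi> A\<close> to vanish. Surjectivity of \<open>\<Lambda>\<^sub>s\<close> and the inclusion of kernels implied by
  monotonicity make \<open>\<Lambda>\<^sub>s X \<mapsto> \<Lambda>\<^sub>t X\<close> a well-defined propagator.

  The theory of trace class operators rests on two facts: positive operators have unique square
  roots, and trace class operators are the products of two Hilbert--Schmidt operators. The map
  \<open>id \<otimes> \<Phi>\<close> is constructed from the blocks of an operator with respect to an orthonormal basis of the
  first factor: for a positive operator with blocks \<open>Y\<^sub>e\<^sub>f\<close>, the sesquilinear form with blocks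
  \<open>\<Phi> Y\<^sub>e\<^sub>f\<close> is positive and bounded by \<open>Tr Y\<close>. It agrees with \<open>id_tensor \<Phi>\<close> since finite rank
  truncations in a product basis are dense in trace norm.
\<close>

text \<open>The converse for CP-divisibility meets two obstacles. Moreover, surjectivity of
  \<open>\<Lambda> s\<close> is given on the trace class of \<open>'h\<close>, not for its
  ampliation to the tensor product. Both obstacles disappear on operators with finitely many nonzero
  blocks: preimages under the ampliation of \<open>\<Lambda> s\<close> are found block by block, and
  \<open>\<Phi>\<close> acts on finitely many blocks.

  Monotonicity is known for Hermitian operators only. Preimages are therefore replaced by their real
  parts, which works because a positive map acts on real and imaginary parts separately.

  The Jordan decomposition is obtained without the spectral theorem: positivity of
  \<open>|A| + A\<close> and \<open>|A| - A\<close> is read off from the kernels of these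
  operators.\<close>

section \<open>Algebra and continuity of scalar multiplication and inner product\<close>

lemma scaleC_zero_left [simp]: "(0::complex) *\<^sub>C (x::'a::complex_hilbert_space) = 0"
  using scaleC_of_real[of 0 x] by simp

lemma scaleC_one [simp]: "(1::complex) *\<^sub>C (x::'a::complex_hilbert_space) = x"
  using scaleC_of_real[of 1 x] by simp

lemma scaleC_zero_right [simp]: "c *\<^sub>C (0::'a::complex_hilbert_space) = 0"
  using scaleC_add_right[of c 0 "0::'a"] by simp

lemma scaleC_minus_right: "c *\<^sub>C (- x) = - (c *\<^sub>C (x::'a::complex_hilbert_space))"
  using scaleC_add_right[of c x "- x"] by (simp add: eq_neg_iff_add_eq_0 add.commute)

lemma scaleC_minus_left: "(- c) *\<^sub>C x = - (c *\<^sub>C (x::'a::complex_hilbert_space))"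
  using scaleC_add_left[of c "-c" x] by (simp add: eq_neg_iff_add_eq_0 add.commute)

lemma scaleC_diff_right: "c *\<^sub>C (x - y) = c *\<^sub>C x - c *\<^sub>C (y::'a::complex_hilbert_space)"
  using scaleC_add_right[of c x "- y"] by (simp add: scaleC_minus_right)

lemma scaleC_sum_left:
  "(\<Sum>i\<in>I. c i) *\<^sub>C (x::'a::complex_hilbert_space) = (\<Sum>i\<in>I. c i *\<^sub>C x)"
  by (induction I rule: infinite_finite_induct) (simp_all add: scaleC_add_left)

lemma scaleR_scaleC: "r *\<^sub>R x = complex_of_real r *\<^sub>C (x::'a::complex_hilbert_space)"
  by (simp add: scaleC_of_real)

lemma cinner_scaleR_left: "cinner (r *\<^sub>R x) y = of_real r * cinner x y"
  by (simp add: scaleR_scaleC cinner_scaleC_left)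

lemma cinner_scaleR_right: "cinner x (r *\<^sub>R y) = of_real r * cinner x y"
  by (simp add: scaleR_scaleC cinner_scaleC_right)

lemma cinner_minus_left: "cinner (- x) y = - cinner x y"
  using cinner_diff_left[of 0 x y] by simp

lemmas cinner_simps = cinner_add_left cinner_add_right cinner_diff_left cinner_diff_right
  cinner_scaleC_left cinner_scaleC_right cinner_minus_left cinner_minus_right
  cinner_scaleR_left cinner_scaleR_right

lemma cinner_eqI: "(\<And>z. cinner z x = cinner z y) \<Longrightarrow> x = y"
proof -
  assume "\<And>z. cinner z x = cinner z y"
  then have "cinner (x - y) (x - y) = 0" by (simp add: cinner_diff_right)
  then show ?thesis by (simp add: cinner_self)
qed

lemma cinner_eqI_left: "(\<And>z. cinner x z = cinner y z) \<Longrightarrow> x = y"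
  by (rule cinner_eqI) (metis cinner_commute)

lemma tendsto_cinner_right: "(f \<longlongrightarrow> y) F \<Longrightarrow> ((\<lambda>n. cinner x (f n)) \<longlongrightarrow> cinner x y) F"
  by (rule bounded_linear.tendsto[OF bounded_linear_cinner_right])

lemma tendsto_cinner_left: "(f \<longlongrightarrow> y) F \<Longrightarrow> ((\<lambda>n. cinner (f n) x) \<longlongrightarrow> cinner y x) F"
  using tendsto_cnj[OF tendsto_cinner_right[of f y F x]] by (simp add: cinner_commute[of _ x])

text \<open>Joint continuity comes from the real inner product: the imaginary part of
  \<open>cinner u v\<close> is the real inner product of \<open>\<i> *\<^sub>C u\<close> and
  \<open>v\<close>.\<close>

lemma tendsto_cinner:
  fixes x y :: "'a::complex_hilbert_space"
  assumes "(f \<longlongrightarrow> x) F" "(g \<longlongrightarrow> y) F"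
  shows "((\<lambda>n. cinner (f n) (g n)) \<longlongrightarrow> cinner x y) F"
proof -
  have "Re (cinner u v) = inner u v" "Im (cinner u v) = inner (\<i> *\<^sub>C u) v"
    for u v :: 'a
    by (simp_all add: Re_cinner[symmetric] cinner_scaleC_left)
  moreover have "bounded_linear (\<lambda>u::'a. \<i> *\<^sub>C u)"
    by (rule bounded_linear_intro[where K = 1])
      (simp_all add: scaleC_add_right norm_scaleC scaleR_scaleC scaleC_scaleC mult.commute)
  then have "((\<lambda>n. \<i> *\<^sub>C f n) \<longlongrightarrow> \<i> *\<^sub>C x) F"
    using assms(1) bounded_linear.tendsto by blast
  ultimately show ?thesis
    using assms by (auto simp: tendsto_complex_iff intro!: tendsto_inner)
qed

lemma tendsto_scaleC: "(f \<longlongrightarrow> x) F \<Longrightarrow> ((\<lambda>n. c *\<^sub>C f n) \<longlongrightarrow> c *\<^sub>C (x::'a::complex_hilbert_space)) F"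
  by (rule bounded_linear.tendsto[OF bounded_linear_intro[where K = "cmod c"]])
    (simp_all add: scaleC_add_right norm_scaleC scaleR_scaleC scaleC_scaleC mult.commute)

section \<open>Bounded operators\<close>

lemma bounded_clinearI:
  assumes "\<And>x y. A (x + y) = A x + A y" "\<And>c x. A (c *\<^sub>C x) = c *\<^sub>C A x"
    "\<And>x. norm (A x) \<le> K * norm x"
  shows "bounded_clinear A"
  unfolding bounded_clinear_def
  using assms by (auto intro!: bounded_linear_intro[where K = K] simp: scaleR_scaleC mult.commute)

lemma bounded_clinear_bound:
  assumes "bounded_clinear A"
  obtains K where "K > 0" "\<And>x. norm (A x) \<le> K * norm x"
  using assms bounded_linear.pos_bounded[of A] unfolding bounded_clinear_def
  by (metis mult.commute)

context
  fixes A :: "'a::complex_hilbert_space \<Rightarrow> 'b::complex_hilbert_space"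
  assumes A: "bounded_clinear A"
begin

lemma bclin_linear: "linear A"
  using A bounded_linear.linear unfolding bounded_clinear_def by blast

lemma bclin_add: "A (x + y) = A x + A y"
  by (rule linear_add[OF bclin_linear])

lemma bclin_diff: "A (x - y) = A x - A y"
  by (rule linear_diff[OF bclin_linear])

lemma bclin_minus: "A (- x) = - A x"
  by (rule linear_neg[OF bclin_linear])

lemma bclin_zero: "A 0 = 0"
  by (rule linear_0[OF bclin_linear])

lemma bclin_sum: "A (\<Sum>i\<in>I. f i) = (\<Sum>i\<in>I. A (f i))"
  by (rule linear_sum[OF bclin_linear])

lemma bclin_scaleC: "A (c *\<^sub>C x) = c *\<^sub>C A x"
  using A unfolding bounded_clinear_def by blast

lemma bclin_scaleR: "A (c *\<^sub>R x) = c *\<^sub>R A x"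
  by (simp add: scaleR_scaleC bclin_scaleC)

lemma bclin_tendsto: "(f \<longlongrightarrow> x) F \<Longrightarrow> ((\<lambda>n. A (f n)) \<longlongrightarrow> A x) F"
  using A bounded_linear.tendsto unfolding bounded_clinear_def by blast

end

lemmas bclin_simps = bclin_add bclin_diff bclin_minus bclin_scaleC bclin_scaleR

lemma bounded_clinear_id: "bounded_clinear (\<lambda>x. x)"
  by (rule bounded_clinearI[where K = 1]) auto

lemma bounded_clinear_zero: "bounded_clinear (\<lambda>x. 0)"
  by (rule bounded_clinearI[where K = 0]) auto

lemma bounded_clinear_comp:
  assumes "bounded_clinear A" "bounded_clinear B"
  shows "bounded_clinear (\<lambda>x. A (B x))"
  using assms bounded_linear_compose[of A B] unfolding bounded_clinear_def by auto

lemma bounded_clinear_add: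
  assumes "bounded_clinear A" "bounded_clinear B"
  shows "bounded_clinear (\<lambda>x. A x + B x)"
  using assms bounded_linear_add[of A B] unfolding bounded_clinear_def
  by (auto simp: scaleC_add_right)

lemma bounded_clinear_diff:
  assumes "bounded_clinear A" "bounded_clinear B"
  shows "bounded_clinear (\<lambda>x. A x - B x)"
  using assms bounded_linear_sub[of A B] unfolding bounded_clinear_def
  by (auto simp: scaleC_diff_right)

lemma bounded_clinear_scaleC_fun: "bounded_clinear (\<lambda>x::'a::complex_hilbert_space. c *\<^sub>C x)"
  by (rule bounded_clinearI[where K = "cmod c"])
    (simp_all add: scaleC_add_right scaleC_scaleC mult.commute norm_scaleC)

lemma bounded_clinear_scaleC:
  "bounded_clinear A \<Longrightarrow> bounded_clinear (\<lambda>x. c *\<^sub>C A x)"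
  using bounded_clinear_comp[OF bounded_clinear_scaleC_fun] .

lemma bounded_clinear_scaleR:
  "bounded_clinear A \<Longrightarrow> bounded_clinear (\<lambda>x. r *\<^sub>R A x)"
  unfolding scaleR_scaleC by (rule bounded_clinear_scaleC)

lemma bounded_clinear_sum:
  "(\<And>i. i \<in> I \<Longrightarrow> bounded_clinear (A i)) \<Longrightarrow> bounded_clinear (\<lambda>x. \<Sum>i\<in>I. A i x)"
  by (induction I rule: infinite_finite_induct)
    (simp_all add: bounded_clinear_zero bounded_clinear_add)

lemma bounded_clinear_cinner: "bounded_clinear (\<lambda>x. cinner a x *\<^sub>C b)"
  by (rule bounded_clinearI[where K = "norm a * norm b"])
    (auto simp: cinner_simps scaleC_add_left scaleC_scaleC norm_scaleC
      intro!: order_trans[OF mult_right_mono[OF cmod_cinner_le]])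

lemmas bounded_clinear_intros = bounded_clinear_id bounded_clinear_zero bounded_clinear_add
  bounded_clinear_diff bounded_clinear_scaleC bounded_clinear_scaleR bounded_clinear_sum
  bounded_clinear_cinner

section \<open>Projection theorem, Riesz representation, adjoints\<close>

text \<open>The parallelogram law for \<open>x - y\<close> and \<open>x - z\<close>, solved for the
  distance of \<open>y\<close> and \<open>z\<close>. When both are nearly closest to
  \<open>x\<close> and their midpoint cannot be closer, they must be near each other.\<close>

lemma parallelogram_midpoint:
  fixes x y z :: "'a::real_inner"
  shows "(norm (y - z))\<^sup>2 =
    2 * (norm (x - y))\<^sup>2 + 2 * (norm (x - z))\<^sup>2 - 4 * (norm (x - (1/2) *\<^sub>R (y + z)))\<^sup>2"
  by (simp add: power2_norm_eq_inner inner_diff_left inner_diff_right inner_add_left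
      inner_add_right inner_commute algebra_simps)

text \<open>A sequence in \<open>S\<close> that minimizes the distance from \<open>x\<close> is
  Cauchy because midpoints stay in \<open>S\<close>. Its limit is the nearest point, and minimality
  gives orthogonality.\<close>

lemma projection_exists:
  fixes S :: "'a::complex_hilbert_space set"
  assumes "closed S" "0 \<in> S" and add: "\<And>x y. x \<in> S \<Longrightarrow> y \<in> S \<Longrightarrow> x + y \<in> S"
    and scale: "\<And>c x. x \<in> S \<Longrightarrow> c *\<^sub>C x \<in> S"
  obtains p where "p \<in> S" "\<And>s. s \<in> S \<Longrightarrow> cinner s (x - p) = 0"
proof -
  define D where "D = (\<lambda>s. (norm (x - s))\<^sup>2) ` S"
  define d where "d = Inf D"
  have D: "D \<noteq> {}" "bdd_below D" using assms(2) by (auto simp: D_def intro: bdd_belowI[of _ 0])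
  have dle: "d \<le> (norm (x - s))\<^sup>2" if "s \<in> S" for s
    unfolding d_def using that D by (intro cInf_lower) (auto simp: D_def)
  have "\<exists>s\<in>S. (norm (x - s))\<^sup>2 < d + inverse (real (Suc n))" for n
    using cInf_lessD[OF D(1), of "d + inverse (real (Suc n))"] by (auto simp: d_def D_def)
  then obtain s where s: "\<And>n. s n \<in> S" "\<And>n. (norm (x - s n))\<^sup>2 < d + inverse (real (Suc n))"
    by metis
  have diff: "(norm (s m - s n))\<^sup>2 \<le> 2 * inverse (real (Suc m)) + 2 * inverse (real (Suc n))" for m n
  proof -
    have "(1/2) *\<^sub>R (s m + s n) \<in> S" unfolding scaleR_scaleC using s add scale by blast
    from dle[OF this] show ?thesis
      using parallelogram_midpoint[of "s m" "s n" x] s(2)[of m] s(2)[of n] by linarith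
  qed
  have "Cauchy s"
  proof (rule metric_CauchyI)
    fix r :: real assume "r > 0"
    then obtain N where N: "inverse (real (Suc N)) < r\<^sup>2 / 4"
      using reals_Archimedean[of "r\<^sup>2/4"] by auto
    have "dist (s m) (s n) < r" if "m \<ge> N" "n \<ge> N" for m n
    proof -
      have "inverse (real (Suc m)) \<le> inverse (real (Suc N))"
        "inverse (real (Suc n)) \<le> inverse (real (Suc N))" using that by auto
      then have "(norm (s m - s n))\<^sup>2 < r\<^sup>2" using diff[of m n] N by linarith
      then show ?thesis using \<open>r > 0\<close> by (simp add: dist_norm power2_less_imp_less)
    qed
    then show "\<exists>M. \<forall>m\<ge>M. \<forall>n\<ge>M. dist (s m) (s n) < r" by blast
  qed
  then obtain p where p: "s \<longlonglongrightarrow> p" using Cauchy_convergent convergent_def by blast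
  have pS: "p \<in> S" using closed_sequentially[OF assms(1) _ p] s by auto
  have "(\<lambda>n. (norm (x - s n))\<^sup>2) \<longlonglongrightarrow> (norm (x - p))\<^sup>2" by (intro tendsto_intros p)
  moreover have "(\<lambda>n. d + inverse (real (Suc n))) \<longlonglongrightarrow> d + 0"
    by (intro tendsto_intros LIMSEQ_inverse_real_of_nat)
  ultimately have dp: "(norm (x - p))\<^sup>2 \<le> d"
    using s(2) by (intro LIMSEQ_le[of _ _ _ "d"]) (auto intro: less_imp_le)
  have orth: "inner s (x - p) = 0" if "s \<in> S" for s
  proof (rule ccontr)
    assume ne: "inner s (x - p) \<noteq> 0"
    then have s0: "inner s s \<noteq> 0" by auto
    \<comment> \<open>This \<open>r\<close> minimizes the distance from \<open>x\<close> along the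
      line through \<open>p\<close> in direction \<open>s\<close>. The squared distance drops by
      \<open>(inner s (x - p))\<^sup>2 / inner s s\<close>, against minimality of
      \<open>p\<close>.\<close>
    define r where "r = inner s (x - p) / inner s s"
    have "p + r *\<^sub>R s \<in> S" unfolding scaleR_scaleC using pS that add scale by blast
    from dle[OF this] dp have "(norm (x - p))\<^sup>2 \<le> (norm ((x - p) - r *\<^sub>R s))\<^sup>2"
      unfolding diff_diff_eq by linarith
    also have "\<dots> = (norm (x - p))\<^sup>2 - 2 * r * inner s (x - p) + r * (r * inner s s)"
      unfolding power2_norm_eq_inner inner_diff_left[of "x - p"] inner_diff_right[of _ "x - p"]
      by (simp add: inner_commute[of "x - p" s])
    also have "r * (r * inner s s) = r * inner s (x - p)" using s0 by (simp add: r_def)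
    finally have "r * inner s (x - p) \<le> 0" by simp
    moreover have "r * inner s (x - p) = (inner s (x - p))\<^sup>2 / inner s s"
      by (simp add: r_def power2_eq_square)
    moreover have "\<dots> > 0" using ne s0 by (metis divide_pos_pos inner_ge_zero
          less_eq_real_def zero_less_power2)
    ultimately show False by linarith
  qed
  have "cinner s (x - p) = 0" if "s \<in> S" for s
  proof -
    have "Re (cinner s (x - p)) = 0" using orth[OF that] by (simp add: Re_cinner)
    \<comment> \<open>Real orthogonality to \<open>\<i> *\<^sub>C s\<close>, which is also in
      \<open>S\<close>, is the vanishing of the imaginary part.\<close>
    moreover have "Im (cinner s (x - p)) = 0"
      using orth[OF scale[OF that, of \<i>]] by (simp add: Re_cinner[symmetric] cinner_scaleC_left)
    ultimately show ?thesis by (simp add: complex_eq_iff)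
  qed
  with pS that show ?thesis by blast
qed

text \<open>If \<open>f\<close> is not zero, \<open>z\<close> is taken orthogonal to its closed
  kernel. Since \<open>y - (f y / f z) z\<close> lies in the kernel, \<open>f\<close> is a multiple
  of \<open>cinner z\<close>; the scalar is conjugated because \<open>cinner\<close> is antilinear
  on the left.\<close>

lemma riesz_representation:
  fixes f :: "'a::complex_hilbert_space \<Rightarrow> complex"
  assumes add: "\<And>x y. f (x + y) = f x + f y" and scale: "\<And>c x. f (c *\<^sub>C x) = c * f x"
    and bound: "\<And>x. cmod (f x) \<le> K * norm x"
  obtains z where "\<And>x. f x = cinner z x"
proof (cases "\<forall>x. f x = 0")
  case True
  then show ?thesis using that[of 0] by simp
next
  case False
  then obtain x where x: "f x \<noteq> 0" by blast
  have "bounded_linear f"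
    using add scale bound by (intro bounded_linear_intro[where K = K])
      (auto simp: scaleR_scaleC scaleR_conv_of_real mult.commute)
  then have "closed {x. f x = 0}"
    by (intro closed_Collect_eq continuous_intros) (simp add: linear_continuous_on)
  then obtain p where p: "f p = 0" "\<And>s. f s = 0 \<Longrightarrow> cinner s (x - p) = 0"
  proof (rule projection_exists[where x = x])
    show "0 \<in> {x. f x = 0}" using scale[of 0 0] by simp
  qed (auto simp: add scale)
  define z where "z = x - p"
  have fz: "f z \<noteq> 0" using x p(1) add[of "x - p" p] by (simp add: z_def)
  have zz: "cinner z z \<noteq> 0"
  proof
    assume "cinner z z = 0"
    then have "z = 0" by (simp add: cinner_self)
    then show False using fz scale[of 0 0] by simp
  qed
  have "f y = cinner ((cnj (f z) / cnj (cinner z z)) *\<^sub>C z) y" for y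
  proof -
    have "f (y + (- (f y / f z)) *\<^sub>C z) = 0" using fz by (simp add: add scale)
    from p(2)[OF this] have "cinner z (y + (- (f y / f z)) *\<^sub>C z) = 0"
      by (metis cinner_commute complex_cnj_zero z_def)
    then have "cinner z y = f y / f z * cinner z z" by (simp add: cinner_simps)
    then show ?thesis using fz zz by (simp add: cinner_scaleC_left)
  qed
  then show ?thesis by (rule that)
qed

text \<open>Unlike \<open>cadjoint\<close>, this covers maps between different spaces, as needed for
  factorizations through another space and for \<open>slice\<close>.\<close>

definition adj :: "('a::complex_hilbert_space \<Rightarrow> 'b::complex_hilbert_space) \<Rightarrow> 'b \<Rightarrow> 'a" where
  "adj A y = (SOME z. \<forall>x. cinner z x = cinner y (A x))"

lemma cinner_adj:
  assumes "bounded_clinear A"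
  shows "cinner (adj A y) x = cinner y (A x)"
proof -
  obtain K where K: "\<And>x. norm (A x) \<le> K * norm x" using bounded_clinear_bound[OF assms] by blast
  have "cmod (cinner y (A x)) \<le> (norm y * K) * norm x" for x
    using order_trans[OF cmod_cinner_le mult_left_mono[OF K]] by (simp add: mult.assoc)
  then obtain z where "\<And>x. cinner y (A x) = cinner z x"
    using riesz_representation[of "\<lambda>x. cinner y (A x)" "norm y * K"] assms
    by (auto simp: bclin_simps cinner_simps)
  then have "\<exists>z. \<forall>x. cinner z x = cinner y (A x)" by metis
  from someI_ex[OF this] show ?thesis unfolding adj_def by blast
qed

lemma cinner_adj_right: "bounded_clinear A \<Longrightarrow> cinner x (adj A y) = cinner (A x) y"
  by (metis cinner_adj cinner_commute)

text \<open>The square of \<open>norm (adj A y)\<close> is \<open>cinner y (A (adj A y))\<close>,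
  hence at most \<open>norm y * K * norm (adj A y)\<close>; one factor cancels.\<close>

lemma adj_bound:
  assumes "bounded_clinear A" "\<And>x. norm (A x) \<le> K * norm x" "K \<ge> 0"
  shows "norm (adj A y) \<le> K * norm y"
proof (cases "adj A y = 0")
  case False
  have "(norm (adj A y))\<^sup>2 = cmod (cinner y (A (adj A y)))"
    using arg_cong[OF cinner_adj[OF assms(1), of y "adj A y"], of cmod]
    by (simp add: cinner_self norm_power)
  also have "\<dots> \<le> norm y * (K * norm (adj A y))"
    using order_trans[OF cmod_cinner_le mult_left_mono[OF assms(2)]] by simp
  finally show ?thesis using False by (simp add: power2_eq_square mult.commute)
qed (use assms in simp)

lemma bounded_clinear_adj:
  assumes A: "bounded_clinear A"
  shows "bounded_clinear (adj A)"
proof -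
  obtain K where "K > 0" "\<And>x. norm (A x) \<le> K * norm x" using bounded_clinear_bound[OF A] by blast
  then show ?thesis
    by (intro bounded_clinearI[where K = K] adj_bound[OF A] cinner_eqI_left)
      (simp_all add: cinner_adj[OF A] cinner_simps)
qed

lemma adj_unique:
  assumes "bounded_clinear A" "\<And>x y. cinner (B x) y = cinner x (A y)"
  shows "adj A = B"
  by (intro ext cinner_eqI_left) (simp add: cinner_adj assms)

lemma adj_adj: "bounded_clinear A \<Longrightarrow> adj (adj A) = A"
  by (intro adj_unique bounded_clinear_adj) (simp_all add: cinner_adj_right)

lemma adj_comp:
  assumes "bounded_clinear A" "bounded_clinear B"
  shows "adj (\<lambda>x. A (B x)) = (\<lambda>x. adj B (adj A x))"
  by (rule adj_unique) (use assms in \<open>simp_all add: bounded_clinear_comp cinner_adj\<close>)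

lemma cadjoint_eq_adj:
  assumes "bounded_clinear A"
  shows "cadjoint A = adj A"
  unfolding cadjoint_def
proof (rule the_equality)
  show "bounded_clinear (adj A) \<and> (\<forall>x y. cinner (adj A x) y = cinner x (A y))"
    using assms by (simp add: bounded_clinear_adj cinner_adj)
qed (use assms adj_unique in blast)

lemma hermitian_op_iff:
  "hermitian_op A \<longleftrightarrow> bounded_clinear A \<and> (\<forall>x y. cinner (A x) y = cinner x (A y))"
  unfolding hermitian_op_def by (metis adj_unique cadjoint_eq_adj cinner_adj)

lemma hermitian_op_bclin: "hermitian_op A \<Longrightarrow> bounded_clinear A"
  by (simp add: hermitian_op_iff)

lemma hermitian_op_cinner: "hermitian_op A \<Longrightarrow> cinner (A x) y = cinner x (A y)"
  by (simp add: hermitian_op_iff)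

lemma hermitian_op_adj: "hermitian_op A \<Longrightarrow> adj A = A"
  by (metis cadjoint_eq_adj hermitian_op_def)

text \<open>Douglas' lemma: \<open>W\<close> is the extension of \<open>S y \<mapsto> T y\<close> to the closure of the range of \<open>S\<close> by
  continuity, and zero on the orthogonal complement.\<close>

lemma douglas_factorization:
  fixes S :: "'a::complex_hilbert_space \<Rightarrow> 'b::complex_hilbert_space"
    and T :: "'a \<Rightarrow> 'c::complex_hilbert_space"
  assumes S: "bounded_clinear S" and T: "bounded_clinear T" and TS: "\<And>y. norm (T y) \<le> norm (S y)"
  obtains W where "bounded_clinear W" "\<And>x. norm (W x) \<le> norm x" "\<And>y. W (S y) = T y"
proof -
  \<comment> \<open>\<open>p\<close> is the projection of \<open>x\<close> to the closed range of
    \<open>S\<close>, and \<open>w\<close> is the limit of \<open>T\<close> along an approximation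
    of \<open>p\<close>. With a relation, linearity and boundedness can be shown before
    single-valuedness, which follows from them.\<close>
  define R where "R x w \<longleftrightarrow> (\<exists>(y::nat \<Rightarrow> 'a) p. (\<lambda>n. S (y n)) \<longlonglongrightarrow> p \<and> (\<lambda>n. T (y n)) \<longlonglongrightarrow> w \<and>
     (\<forall>s. cinner (S s) (x - p) = 0))" for x w
  have ex: "\<exists>w. R x w" for x
  proof -
    have cl: "closed (closure (range S))" by simp
    have lim: "\<exists>u. (\<lambda>n. S (u n)) \<longlonglongrightarrow> z" if "z \<in> closure (range S)" for z
    proof -
      have "\<exists>v. (\<forall>n. v n \<in> range S) \<and> v \<longlonglongrightarrow> z" using that by (simp only: closure_sequential)
      then obtain v where v: "\<And>n. v n \<in> range S" "v \<longlonglongrightarrow> z" by blast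
      from v(1) have "\<exists>y. v n = S y" for n by (meson rangeE)
      then obtain u where "\<And>n. v n = S (u n)" by metis
      then have "v = (\<lambda>n. S (u n))" by (rule ext)
      with v(2) show ?thesis by auto
    qed
    have clI: "z \<in> closure (range S)" if "(\<lambda>n. S (u n)) \<longlonglongrightarrow> z" for u z
      using that by (auto simp only: closure_sequential intro!: exI[of _ "\<lambda>n. S (u n)"])
    obtain p where p: "p \<in> closure (range S)" "\<And>s. s \<in> closure (range S) \<Longrightarrow> cinner s (x - p) = 0"
    proof (rule projection_exists[OF cl, where x = x])
      show "0 \<in> closure (range S)" using bclin_zero[OF S] by (metis closure_subset rangeI subsetD)
      fix a b assume "a \<in> closure (range S)" "b \<in> closure (range S)"
      then obtain u v where "(\<lambda>n. S (u n)) \<longlonglongrightarrow> a" "(\<lambda>n. S (v n)) \<longlonglongrightarrow> b" using lim by blast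
      then have "(\<lambda>n. S (u n + v n)) \<longlonglongrightarrow> a + b" by (simp add: bclin_add[OF S] tendsto_add)
      then show "a + b \<in> closure (range S)" by (rule clI)
    next
      fix c a assume "a \<in> closure (range S)"
      then obtain u where "(\<lambda>n. S (u n)) \<longlonglongrightarrow> a" using lim by blast
      then have "(\<lambda>n. S (c *\<^sub>C u n)) \<longlonglongrightarrow> c *\<^sub>C a" by (simp add: bclin_scaleC[OF S] tendsto_scaleC)
      then show "c *\<^sub>C a \<in> closure (range S)" by (rule clI)
    qed blast
    obtain u where u: "(\<lambda>n. S (u n)) \<longlonglongrightarrow> p" using lim p(1) by blast
    have "Cauchy (\<lambda>n. T (u n))"
    proof (rule metric_CauchyI)
      fix r :: real assume "r > 0"
      then obtain M where "\<forall>m\<ge>M. \<forall>n\<ge>M. dist (S (u m)) (S (u n)) < r"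
        using u LIMSEQ_imp_Cauchy[OF u] unfolding Cauchy_def by meson
      moreover have "dist (T (u m)) (T (u n)) \<le> dist (S (u m)) (S (u n))" for m n
        using TS[of "u m - u n"] by (simp add: dist_norm bclin_diff S T)
      ultimately show "\<exists>M. \<forall>m\<ge>M. \<forall>n\<ge>M. dist (T (u m)) (T (u n)) < r"
        by (meson order_le_less_trans)
    qed
    then obtain w where "(\<lambda>n. T (u n)) \<longlonglongrightarrow> w" using Cauchy_convergent convergent_def by blast
    then show ?thesis unfolding R_def using u p(2) closure_subset by blast
  qed
  have add: "R (x + x') (w + w')" if R: "R x w" "R x' w'" for x x' w w'
  proof -
    obtain y p where "(\<lambda>n. S (y n)) \<longlonglongrightarrow> p" "(\<lambda>n. T (y n)) \<longlonglongrightarrow> w"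
      "\<forall>s. cinner (S s) (x - p) = 0"
      using R(1) unfolding R_def by blast
    moreover obtain y' p' where "(\<lambda>n. S (y' n)) \<longlonglongrightarrow> p'" "(\<lambda>n. T (y' n)) \<longlonglongrightarrow> w'"
      "\<forall>s. cinner (S s) (x' - p') = 0"
      using R(2) unfolding R_def by blast
    ultimately show ?thesis unfolding R_def
      by (intro exI[of _ "\<lambda>n. y n + y' n"] exI[of _ "p + p'"])
        (auto simp: bclin_add S T tendsto_add cinner_simps)
  qed
  have scale: "R (c *\<^sub>C x) (c *\<^sub>C w)" if R: "R x w" for x w c
  proof -
    obtain y p where "(\<lambda>n. S (y n)) \<longlonglongrightarrow> p" "(\<lambda>n. T (y n)) \<longlonglongrightarrow> w"
      "\<forall>s. cinner (S s) (x - p) = 0"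
      using R unfolding R_def by blast
    then show ?thesis unfolding R_def
      by (intro exI[of _ "\<lambda>n. c *\<^sub>C y n"] exI[of _ "c *\<^sub>C p"])
        (auto simp: bclin_scaleC S T tendsto_scaleC cinner_simps)
  qed
  have bd: "norm w \<le> norm x" if R: "R x w" for x w
  proof -
    obtain y p where y: "(\<lambda>n. S (y n)) \<longlonglongrightarrow> p" "(\<lambda>n. T (y n)) \<longlonglongrightarrow> w"
      "\<And>s. cinner (S s) (x - p) = 0"
      using R unfolding R_def by blast
    have "(\<lambda>n. cinner (S (y n)) (x - p)) \<longlonglongrightarrow> cinner p (x - p)" by (rule tendsto_cinner_left[OF y(1)])
    then have "cinner p (x - p) = 0" using y(3) by (simp add: LIMSEQ_const_iff)
    then have "(norm p)\<^sup>2 = Re (cinner p x)" by (simp add: cinner_diff_right cinner_self)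
    also have "\<dots> \<le> norm p * norm x" using complex_Re_le_cmod cmod_cinner_le order_trans by blast
    finally have "norm p \<le> norm x" by (cases "p = 0") (auto simp: power2_eq_square)
    moreover have "norm w \<le> norm p"
      by (rule LIMSEQ_le[OF tendsto_norm[OF y(2)] tendsto_norm[OF y(1)]]) (use TS in blast)
    ultimately show ?thesis by simp
  qed
  \<comment> \<open>Two values at \<open>x\<close> differ by a value at \<open>0\<close>, which
    \<open>bd\<close> forces to vanish.\<close>
  have uniq: "w = w'" if "R x w" "R x w'" for x w w'
    using bd[OF add[OF that(1) scale[OF that(2), of "-1"]]] by (simp add: scaleC_minus_left)
  define W where "W x = (SOME w. R x w)" for x
  have W: "R x (W x)" for x unfolding W_def by (rule someI_ex[OF ex])
  have "bounded_clinear W"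
  proof (rule bounded_clinearI[where K = 1])
    show "W (x + y) = W x + W y" for x y by (rule uniq[OF W add[OF W W]])
    show "W (c *\<^sub>C x) = c *\<^sub>C W x" for x c by (rule uniq[OF W scale[OF W]])
    show "norm (W x) \<le> 1 * norm x" for x using bd[OF W] by simp
  qed
  moreover have "R (S y) (T y)" for y
    unfolding R_def by (intro exI[of _ "\<lambda>n. y"] exI[of _ "S y"]) auto
  then have "W (S y) = T y" for y using uniq W by blast
  ultimately show ?thesis using that bd W by blast
qed


section \<open>Positive operators\<close>

lemma positive_op_bclin: "positive_op A \<Longrightarrow> bounded_clinear A"
  by (simp add: positive_op_def)

lemma positive_op_iff:
  "positive_op A \<longleftrightarrow> bounded_clinear A \<and>
     (\<forall>x. 0 \<le> Re (cinner x (A x)) \<and> Im (cinner x (A x)) = 0)"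
  by (simp add: positive_op_def complex_nonneg_Reals_iff)

lemma positive_op_Re: "positive_op A \<Longrightarrow> 0 \<le> Re (cinner x (A x))"
  by (simp add: positive_op_iff)

text \<open>Polarization: the form is real at \<open>x\<close>, \<open>y\<close>,
  \<open>x + y\<close> and \<open>x + \<i> *\<^sub>C y\<close>, which forces both the imaginary and
  the real part of \<open>cinner x (A y) - cnj (cinner y (A x))\<close> to vanish.\<close>

lemma positive_op_hermitian:
  assumes P: "positive_op A"
  shows "hermitian_op A"
proof -
  have A: "bounded_clinear A" using P by (rule positive_op_bclin)
  have "cinner (A x) y = cinner x (A y)" for x y
  proof -
    have "Im (cinner z (A z)) = 0" for z using P by (simp add: positive_op_iff)
    from this[of "x + y"] this[of "x + \<i> *\<^sub>C y"] this[of x] this[of y]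
    have "Im (cinner x (A y)) + Im (cinner y (A x)) = 0"
      "Re (cinner x (A y)) - Re (cinner y (A x)) = 0"
      by (simp_all add: bclin_simps[OF A] cinner_simps)
    then have "cinner x (A y) = cnj (cinner y (A x))" by (simp add: complex_eq_iff)
    then show ?thesis by (metis cinner_commute)
  qed
  then show ?thesis using A by (simp add: hermitian_op_iff)
qed

text \<open>Choosing \<open>c = - t * cnj z\<close> leaves the real polynomial
  \<open>p - 2 t |z|^2 + t^2 |z|^2 r\<close> in \<open>t\<close>, which cannot be negative.\<close>

lemma discriminant_complex:
  fixes z :: complex and p r :: real
  assumes "r \<ge> 0" and form: "\<And>c. 0 \<le> p + 2 * Re (c * z) + (cmod c)\<^sup>2 * r"
  shows "(cmod z)\<^sup>2 \<le> p * r"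
proof (cases "r = 0")
  case True
  have "z = 0"
  proof (rule ccontr)
    assume z: "z \<noteq> 0"
    \<comment> \<open>For \<open>r = 0\<close> the polynomial is linear in \<open>t\<close>; this
      \<open>t\<close> makes it \<open>p - 2 * (\<bar>p\<bar> + 1)\<close>, which is
      negative.\<close>
    define t where "t = (\<bar>p\<bar> + 1) / (cmod z)\<^sup>2"
    have "Re (- of_real t * cnj z * z) = - t * (cmod z)\<^sup>2"
      by (simp add: cmod_power2) (simp add: power2_eq_square algebra_simps)
    also have "\<dots> = - (\<bar>p\<bar> + 1)" using z by (simp add: t_def)
    finally show False using form[of "- of_real t * cnj z"]
      unfolding True mult_zero_right add_0_right by linarith
  qed
  then show ?thesis using True by simp
next
  case False
  with assms(1) have r: "r > 0" by simp
  \<comment> \<open>The minimizer of the polynomial, with value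
    \<open>p - |z|^2 / r\<close>.\<close>
  define t where "t = 1 / r"
  have "Re (- of_real t * cnj z * z) = - t * (cmod z)\<^sup>2"
    by (simp add: cmod_power2) (simp add: power2_eq_square algebra_simps)
  moreover have "(cmod (- of_real t * cnj z))\<^sup>2 * r = t * (cmod z)\<^sup>2"
  proof -
    have "cmod (- of_real t * cnj z) = t * cmod z" using r by (simp add: norm_mult norm_divide t_def)
    then show ?thesis using r by (simp add: t_def power2_eq_square)
  qed
  ultimately have "0 \<le> p - t * (cmod z)\<^sup>2"
    using form[of "- of_real t * cnj z"] by linarith
  then show ?thesis using r by (simp add: t_def field_simps)
qed

text \<open>The form of \<open>A\<close> at \<open>x + c *\<^sub>C y\<close> is nonnegative for
  every complex \<open>c\<close> and quadratic in \<open>c\<close>.\<close>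

lemma positive_op_cauchy_schwarz:
  assumes P: "positive_op A"
  shows "(cmod (cinner x (A y)))\<^sup>2 \<le> Re (cinner x (A x)) * Re (cinner y (A y))"
proof (rule discriminant_complex)
  show "0 \<le> Re (cinner y (A y))" by (rule positive_op_Re[OF P])
  fix c
  have A: "bounded_clinear A" using P by (rule positive_op_bclin)
  have yx: "cinner y (A x) = cnj (cinner x (A y))"
    using positive_op_hermitian[OF P] by (metis cinner_commute hermitian_op_cinner)
  have "cinner (x + c *\<^sub>C y) (A (x + c *\<^sub>C y)) = cinner x (A x) +
     (c * cinner x (A y) + cnj (c * cinner x (A y))) + of_real ((cmod c)\<^sup>2) * cinner y (A y)"
    by (simp add: bclin_simps[OF A] cinner_simps yx complex_norm_square algebra_simps
        del: of_real_power)
  then have "Re (cinner (x + c *\<^sub>C y) (A (x + c *\<^sub>C y))) = Re (cinner x (A x)) +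
     2 * Re (c * cinner x (A y)) + (cmod c)\<^sup>2 * Re (cinner y (A y))"
    by (simp del: of_real_power)
  then show "0 \<le> Re (cinner x (A x)) + 2 * Re (c * cinner x (A y)) + (cmod c)\<^sup>2 * Re (cinner y (A y))"
    using positive_op_Re[OF P] by metis
qed

lemma positive_op_eq_0:
  assumes P: "positive_op A" and "Re (cinner x (A x)) = 0"
  shows "A x = 0"
  using positive_op_cauchy_schwarz[OF P, of "A x" x] assms(2) by (simp add: cinner_self)

lemma positive_op_scaleR:
  "positive_op A \<Longrightarrow> 0 \<le> r \<Longrightarrow> positive_op (\<lambda>x. r *\<^sub>R A x)"
  by (simp add: positive_op_iff bounded_clinear_scaleR cinner_simps)

lemma hermitian_op_square_positive:
  assumes "hermitian_op A"
  shows "positive_op (\<lambda>x. A (A x))"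
proof -
  have "cinner x (A (A x)) = of_real ((norm (A x))\<^sup>2)" for x
    by (metis assms cinner_self hermitian_op_cinner)
  then show ?thesis
    using hermitian_op_bclin[OF assms] by (simp add: positive_op_iff bounded_clinear_comp)
qed

lemma positive_op_adj_comp:
  assumes "bounded_clinear A"
  shows "positive_op (\<lambda>x. adj A (A x))"
  using assms by (simp add: positive_op_iff bounded_clinear_comp bounded_clinear_adj
      cinner_adj_right cinner_self)

section \<open>Square roots and absolute values\<close>

text \<open>The square root of \<open>P\<close> with \<open>0 \<le> P \<le> 1\<close> is \<open>1 - L\<close>, where \<open>L\<close> is the limit of the iteration
  \<open>Z \<mapsto> (1 - P + Z\<^sup>2)/2\<close> from \<open>Z = 0\<close>. The increments are dominated by those of the bounded
  increasing scalar iteration \<open>z \<mapsto> (1 + z\<^sup>2)/2\<close>.\<close>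

lemma positive_sqrt_exists_contraction:
  fixes P :: "'a::complex_hilbert_space \<Rightarrow> 'a"
  assumes P: "positive_op P" and le: "\<And>x. norm (P x) \<le> norm x"
  obtains X where "positive_op X" "\<And>x. X (X x) = P x"
    "\<And>T x. bounded_clinear T \<Longrightarrow> (\<And>x. T (P x) = P (T x)) \<Longrightarrow> T (X x) = X (T x)"
proof -
  define A where "A x = x - P x" for x
  have bP: "bounded_clinear P" using P by (rule positive_op_bclin)
  have bA: "bounded_clinear A" unfolding A_def by (intro bounded_clinear_intros bP)
  have RePx: "Re (cinner x (P x)) \<le> (norm x)\<^sup>2" for x
    using order_trans[OF complex_Re_le_cmod order_trans[OF cmod_cinner_le mult_left_mono[OF le]]]
    by (simp add: power2_eq_square)
  have posA: "positive_op A"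
    using bA P RePx by (simp add: positive_op_iff A_def cinner_diff_right cinner_self)
  have ReAx: "Re (cinner x (A x)) \<le> (norm x)\<^sup>2" for x
    using positive_op_Re[OF P] by (simp add: A_def cinner_diff_right cinner_self)
  \<comment> \<open>From \<open>0 \<le> A \<le> 1\<close> in the sense of forms to a norm bound:
    Cauchy-Schwarz for the form of \<open>A\<close> at the pair \<open>A x\<close>,
    \<open>x\<close>.\<close>
  have leA: "norm (A x) \<le> norm x" for x
  proof -
    have "((norm (A x))\<^sup>2)\<^sup>2 = (cmod (cinner (A x) (A x)))\<^sup>2" by (simp add: cinner_self norm_power)
    also have "\<dots> \<le> Re (cinner (A x) (A (A x))) * Re (cinner x (A x))"
      by (rule positive_op_cauchy_schwarz[OF posA])
    also have "\<dots> \<le> (norm (A x))\<^sup>2 * (norm x)\<^sup>2"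
      by (intro mult_mono ReAx positive_op_Re[OF posA]) simp
    finally have "(norm (A x))\<^sup>2 * (norm (A x))\<^sup>2 \<le> (norm (A x))\<^sup>2 * (norm x)\<^sup>2"
      by (simp add: power2_eq_square)
    then have "(norm (A x))\<^sup>2 \<le> (norm x)\<^sup>2" if "A x \<noteq> 0"
      by (rule mult_left_le_imp_le) (use that in simp)
    then show ?thesis by (metis norm_ge_zero norm_zero power2_le_imp_le)
  qed
  define z where "z = rec_nat (0::real) (\<lambda>_ y. (1 + y\<^sup>2) / 2)"
  have z0: "z 0 = 0" and zS: "\<And>n. z (Suc n) = (1 + (z n)\<^sup>2) / 2" by (simp_all add: z_def)
  have z01: "0 \<le> z n \<and> z n \<le> 1" for n
    by (induction n) (auto simp: z0 zS power_le_one)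
  have zmono: "z n \<le> z (Suc n)" for n
    using zero_le_power2[of "1 - z n"] by (simp add: zS power2_diff)
  have inc: "incseq z" using zmono by (rule incseq_SucI)
  obtain \<zeta> where \<zeta>: "z \<longlonglongrightarrow> \<zeta>"
    using incseq_convergent[OF inc, of 1] z01 by blast
  define Z where "Z = rec_nat (\<lambda>x::'a. 0) (\<lambda>_ f x. (1/2) *\<^sub>R (A x + f (f x)))"
  have Z0: "Z 0 = (\<lambda>x. 0)" and ZS: "\<And>n. Z (Suc n) = (\<lambda>x. (1/2) *\<^sub>R (A x + Z n (Z n x)))"
    by (simp_all add: Z_def)
  have bZ: "bounded_clinear (Z n)" for n
  proof (induction n)
    case (Suc n)
    show ?case unfolding ZS
      by (intro bounded_clinear_scaleR bounded_clinear_add bA bounded_clinear_comp[OF Suc Suc])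
  qed (simp add: Z0 bounded_clinear_zero)
  have nZ: "norm (Z n x) \<le> z n * norm x" for n x
  proof (induction n arbitrary: x)
    case (Suc n)
    have "norm (Z n (Z n x)) \<le> z n * (z n * norm x)"
      using Suc[of "Z n x"] mult_left_mono[OF Suc[of x], of "z n"] z01[of n] by linarith
    then have "norm (A x + Z n (Z n x)) \<le> norm x + z n * (z n * norm x)"
      using norm_triangle_ineq[of "A x" "Z n (Z n x)"] leA[of x] by linarith
    moreover have "norm (Z (Suc n) x) = norm (A x + Z n (Z n x)) / 2" by (simp add: ZS)
    moreover have "z (Suc n) * norm x = (norm x + z n * (z n * norm x)) / 2"
      by (simp add: zS power2_eq_square ring_distribs)
    ultimately show ?case by (metis divide_right_mono zero_le_numeral)
  qed (simp add: Z0 z0)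
  have nZ1: "norm (Z n x) \<le> norm x" for n x
    using nZ[of n x] mult_right_mono[of "z n" 1 "norm x"] z01[of n] by simp
  \<comment> \<open>The next increment is half of \<open>Z' (Z' - Z) + (Z' - Z) Z\<close>. Bounding
    each factor by its scalar counterpart gives \<open>(z'\<^sup>2 - z\<^sup>2) / 2\<close>, the
    next scalar increment.\<close>
  have dZ: "norm (Z (Suc n) x - Z n x) \<le> (z (Suc n) - z n) * norm x" for n x
  proof (induction n arbitrary: x)
    case 0
    show ?case using leA[of x] by (simp add: ZS Z0 zS z0)
  next
    case (Suc n)
    let ?Z = "Z n" and ?Z' = "Z (Suc n)" and ?z = "z n" and ?z' = "z (Suc n)"
    have "u - v = (1/2) *\<^sub>R (a - b)"
      if "u = (1/2) *\<^sub>R (A x + a)" "v = (1/2) *\<^sub>R (A x + b)" for u v a b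
      using that by (simp flip: scaleR_diff_right)
    from this[OF fun_cong[OF ZS] fun_cong[OF ZS]]
    have "Z (Suc (Suc n)) x - ?Z' x = (1/2) *\<^sub>R (?Z' (?Z' x - ?Z x) + (?Z' (?Z x) - ?Z (?Z x)))"
      by (simp add: bclin_diff[OF bZ])
    also have "norm \<dots> = norm (?Z' (?Z' x - ?Z x) + (?Z' (?Z x) - ?Z (?Z x))) / 2" by simp
    also have "\<dots> \<le> (?z' * ((?z' - ?z) * norm x) + (?z' - ?z) * (?z * norm x)) / 2"
    proof -
      have "norm (?Z' (?Z' x - ?Z x)) \<le> ?z' * ((?z' - ?z) * norm x)"
        using order_trans[OF nZ mult_left_mono[OF Suc]] z01 by blast
      moreover have "norm (?Z' (?Z x) - ?Z (?Z x)) \<le> (?z' - ?z) * (?z * norm x)"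
        using order_trans[OF Suc mult_left_mono[OF nZ]] zmono[of n] by simp
      ultimately show ?thesis using norm_triangle_ineq[of "?Z' (?Z' x - ?Z x)"] by (smt (verit) divide_right_mono)
    qed
    also have "\<dots> = (z (Suc (Suc n)) - ?z') * norm x"
    proof -
      have "z (Suc (Suc n)) - ?z' = (?z'\<^sup>2 - ?z\<^sup>2) / 2"
        using zS[of n] zS[of "Suc n"] by (simp add: diff_divide_distrib add_divide_distrib)
      then show ?thesis by (simp only:) (simp add: power2_eq_square field_simps)
    qed
    finally show ?case .
  qed
  have dZ': "norm (Z (n + k) x - Z n x) \<le> (z (n + k) - z n) * norm x" for n k x
  proof (induction k)
    case (Suc k)
    have "norm (Z (n + Suc k) x - Z n x) \<le> norm (Z (Suc (n + k)) x - Z (n + k) x) + norm (Z (n + k) x - Z n x)"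
      using norm_triangle_ineq[of "Z (Suc (n + k)) x - Z (n + k) x" "Z (n + k) x - Z n x"] by simp
    then show ?case using Suc dZ[of "n + k" x] by (simp add: algebra_simps)
  qed simp
  have "convergent (\<lambda>n. Z n x)" for x
  proof (rule Cauchy_convergent, rule metric_CauchyI)
    fix r :: real assume "r > 0"
    have "Cauchy (\<lambda>n. z n * norm x)"
      by (intro LIMSEQ_imp_Cauchy[of _ "\<zeta> * norm x"] tendsto_intros \<zeta>)
    then obtain M where M: "\<And>m n. m \<ge> M \<Longrightarrow> n \<ge> M \<Longrightarrow> \<bar>z m * norm x - z n * norm x\<bar> < r"
      using \<open>r > 0\<close> unfolding Cauchy_def dist_real_def by meson
    have *: "dist (Z m x) (Z n x) < r" if "M \<le> n" "n \<le> m" for m n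
    proof -
      have "norm (Z (n + (m - n)) x - Z n x) \<le> (z (n + (m - n)) - z n) * norm x" by (rule dZ')
      then show ?thesis using M[of m n] that by (simp add: dist_norm left_diff_distrib)
    qed
    then have "dist (Z m x) (Z n x) < r" if "M \<le> n" "M \<le> m" for m n
      using that by (metis dist_commute linear)
    then show "\<exists>M. \<forall>m\<ge>M. \<forall>n\<ge>M. dist (Z m x) (Z n x) < r" by blast
  qed
  then obtain L where L: "\<And>x. (\<lambda>n. Z n x) \<longlonglongrightarrow> L x"
    unfolding convergent_def by metis
  have nL: "norm (L x) \<le> norm x" for x
    by (rule Lim_bounded[OF tendsto_norm[OF L[of x]], of 0]) (use nZ1 in blast)
  have bL: "bounded_clinear L"
  proof (rule bounded_clinearI[where K = 1])
    show "L (x + y) = L x + L y" for x y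
      using LIMSEQ_unique[OF L[of "x + y"]] tendsto_add[OF L[of x] L[of y]]
      by (simp add: bclin_add[OF bZ])
    show "L (c *\<^sub>C x) = c *\<^sub>C L x" for c x
      using LIMSEQ_unique[OF L[of "c *\<^sub>C x"]] tendsto_scaleC[OF L[of x], of c]
      by (simp add: bclin_scaleC[OF bZ])
  qed (use nL in simp)
  \<comment> \<open>Pointwise limits can be composed here because the \<open>Z n\<close> are
    contractions.\<close>
  have ZZ: "(\<lambda>n. Z n (Z n x)) \<longlonglongrightarrow> L (L x)" for x
  proof -
    have "(\<lambda>n. Z n (Z n x - L x)) \<longlonglongrightarrow> 0"
    proof (rule Lim_null_comparison)
      show "(\<lambda>n. norm (Z n x - L x)) \<longlonglongrightarrow> 0" using L LIM_zero tendsto_norm_zero by blast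
    qed (use nZ1 in auto)
    from tendsto_add[OF this L[of "L x"]] show ?thesis by (simp add: bclin_diff[OF bZ])
  qed
  \<comment> \<open>This equation yields
    \<open>(1 - L)\<^sup>2 = 1 - 2 L + L\<^sup>2 = 1 - A = P\<close>.\<close>
  have fix_eq: "L x = (1/2) *\<^sub>R (A x + L (L x))" for x
  proof (rule LIMSEQ_unique[OF LIMSEQ_Suc[OF L]])
    show "(\<lambda>n. Z (Suc n) x) \<longlonglongrightarrow> (1/2) *\<^sub>R (A x + L (L x))"
      unfolding ZS by (intro tendsto_intros ZZ)
  qed
  define X where "X x = x - L x" for x
  have XX: "X (X x) = P x" for x
  proof -
    have "X (X x) = x - L x - L x + L (L x)" by (simp add: X_def bclin_diff[OF bL])
    also have "L (L x) = 2 *\<^sub>R L x - A x" by (subst (3) fix_eq) simp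
    finally show ?thesis by (simp add: A_def scaleR_2)
  qed
  have hA: "hermitian_op A" by (rule positive_op_hermitian[OF posA])
  have hZ: "cinner (Z n x) y = cinner x (Z n y)" for n x y
  proof (induction n arbitrary: x y)
    case (Suc n)
    then show ?case by (simp add: ZS cinner_simps hermitian_op_cinner[OF hA])
  qed (simp add: Z0)
  have hL: "cinner (L x) y = cinner x (L y)" for x y
    using LIMSEQ_unique[OF tendsto_cinner_left[OF L[of x], of y]] tendsto_cinner_right[OF L[of y], of x]
    by (simp add: hZ)
  have "Im (cinner x (L x)) = 0" for x
    using hL[of x x] by (metis cinner_commute complex_cnj_cancel_iff complex_is_Real_iff Reals_cnj_iff)
  moreover have "Re (cinner x (L x)) \<le> (norm x)\<^sup>2" for x
    using order_trans[OF complex_Re_le_cmod order_trans[OF cmod_cinner_le mult_left_mono[OF nL]]]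
    by (simp add: power2_eq_square)
  moreover have "bounded_clinear X" unfolding X_def by (intro bounded_clinear_intros bL)
  ultimately have "positive_op X" by (simp add: positive_op_iff X_def cinner_diff_right cinner_self)
  \<comment> \<open>Each iterate is a polynomial in \<open>P\<close>, so an operator commuting with
    \<open>P\<close> commutes with the limit.\<close>
  moreover have "T (X x) = X (T x)" if T: "bounded_clinear T" "\<And>x. T (P x) = P (T x)" for T x
  proof -
    have "T (Z n x) = Z n (T x)" for n x
      by (induction n arbitrary: x) (simp_all add: Z0 ZS bclin_zero T bclin_simps A_def)
    then have "T (L x) = L (T x)" using LIMSEQ_unique[OF bclin_tendsto[OF T(1) L[of x]]] L by simp
    then show ?thesis by (simp add: X_def bclin_diff T(1))
  qed
  ultimately show ?thesis using XX that by blast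
qed

text \<open>Dividing by a norm bound \<open>K\<close> makes \<open>P\<close> a contraction; the root
  is scaled back by \<open>sqrt K\<close>.\<close>

lemma positive_sqrt_exists:
  assumes P: "positive_op P"
  obtains X where "positive_op X" "\<And>x. X (X x) = P x"
    "\<And>T x. bounded_clinear T \<Longrightarrow> (\<And>x. T (P x) = P (T x)) \<Longrightarrow> T (X x) = X (T x)"
proof -
  obtain K where K: "K > 0" "\<And>x. norm (P x) \<le> K * norm x"
    using bounded_clinear_bound[OF positive_op_bclin[OF P]] by blast
  define Q where "Q x = inverse K *\<^sub>R P x" for x
  have "positive_op Q" unfolding Q_def using K by (intro positive_op_scaleR P) simp
  moreover have "norm (Q x) \<le> norm x" for x using K by (simp add: Q_def field_simps)
  ultimately obtain X where X: "positive_op X" "\<And>x. X (X x) = Q x"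
    "\<And>T x. bounded_clinear T \<Longrightarrow> (\<And>x. T (Q x) = Q (T x)) \<Longrightarrow> T (X x) = X (T x)"
    by (rule positive_sqrt_exists_contraction) blast
  have bX: "bounded_clinear X" by (rule positive_op_bclin[OF X(1)])
  show ?thesis
  proof
    show "positive_op (\<lambda>x. sqrt K *\<^sub>R X x)" using K X(1) by (intro positive_op_scaleR) auto
    have "sqrt K * (sqrt K * inverse K) = 1"
      using K by (simp flip: mult.assoc)
    then show "sqrt K *\<^sub>R X (sqrt K *\<^sub>R X x) = P x" for x
      by (simp add: bclin_scaleR[OF bX] Q_def X(2))
    show "T (sqrt K *\<^sub>R X x) = sqrt K *\<^sub>R X (T x)"
      if "bounded_clinear T" "\<And>x. T (P x) = P (T x)" for T x
      using X(3)[of T x] that by (simp add: bclin_scaleR Q_def)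
  qed
qed

text \<open>Both roots are compared with the constructed root \<open>X\<close> of their common
  square, which commutes with each of them. For \<open>y = (X - Q) x\<close>, commutation gives
  \<open>(X + Q) y = 0\<close>, so both forms vanish at \<open>y\<close>. Hence
  \<open>X y = Q y = 0\<close> and \<open>cinner y y = cinner x ((X - Q) y) = 0\<close>.\<close>

lemma positive_sqrt_unique:
  assumes Q: "positive_op Q" and R: "positive_op R" and eq: "\<And>x. Q (Q x) = R (R x)"
  shows "Q = R"
proof -
  have "Q = X" if Q: "positive_op Q" and X: "positive_op X" "\<And>x. X (X x) = Q (Q x)"
    and comm: "\<And>T x. bounded_clinear T \<Longrightarrow> (\<And>x. T (Q (Q x)) = Q (Q (T x))) \<Longrightarrow> T (X x) = X (T x)"
    for Q X :: "'a \<Rightarrow> 'a"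
  proof
    fix x
    have bQ: "bounded_clinear Q" and bX: "bounded_clinear X"
      using Q X positive_op_bclin by blast+
    have QX: "Q (X x) = X (Q x)" for x by (rule comm[OF bQ]) simp
    define y where "y = X x - Q x"
    have "X y + Q y = 0" by (simp add: y_def bclin_diff bX bQ X(2) QX)
    then have "cinner y (X y) + cinner y (Q y) = 0" by (metis cinner_add_right cinner_zero_right)
    then have "Re (cinner y (X y)) + Re (cinner y (Q y)) = 0" by (metis plus_complex.sel(1) zero_complex.sel(1))
    then have "Re (cinner y (X y)) = 0" "Re (cinner y (Q y)) = 0"
      using positive_op_Re[OF Q, of y] positive_op_Re[OF X(1), of y] by linarith+
    then have "X y = 0" "Q y = 0" using positive_op_eq_0 Q X(1) by blast+
    then have "cinner x (X y) - cinner x (Q y) = 0" by simp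
    then have "cinner y y = 0"
      using hermitian_op_cinner[OF positive_op_hermitian[OF Q], of x y]
        hermitian_op_cinner[OF positive_op_hermitian[OF X(1)], of x y]
      by (simp add: y_def cinner_diff_left)
    then show "Q x = X x" by (simp add: cinner_self y_def)
  qed
  moreover have "positive_op (\<lambda>x. Q (Q x))"
    by (intro hermitian_op_square_positive positive_op_hermitian Q)
  then obtain X where "positive_op X" "\<And>x. X (X x) = Q (Q x)"
    "\<And>T x. bounded_clinear T \<Longrightarrow> (\<And>x. T (Q (Q x)) = Q (Q (T x))) \<Longrightarrow> T (X x) = X (T x)"
    by (rule positive_sqrt_exists) blast
  ultimately show ?thesis using Q R by (metis eq)
qed

context
  fixes A :: "'a::complex_hilbert_space \<Rightarrow> 'a"
  assumes A: "bounded_clinear A"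
begin

text \<open>Uniqueness of roots identifies the description by \<open>THE\<close> with the
  constructed root and so transfers its commutation property.\<close>

lemma abs_op_properties:
  shows abs_op_positive: "positive_op (abs_op A)"
    and abs_op_abs_op: "abs_op A (abs_op A x) = adj A (A x)"
    and abs_op_commutes:
      "\<And>T x. bounded_clinear T \<Longrightarrow> (\<And>x. T (adj A (A x)) = adj A (A (T x))) \<Longrightarrow>
        T (abs_op A x) = abs_op A (T x)"
proof -
  obtain X where X: "positive_op X" "\<And>x. X (X x) = adj A (A x)"
    "\<And>T x. bounded_clinear T \<Longrightarrow> (\<And>x. T (adj A (A x)) = adj A (A (T x))) \<Longrightarrow> T (X x) = X (T x)"
    by (rule positive_sqrt_exists[OF positive_op_adj_comp[OF A]]) blast
  have "abs_op A = X"
    unfolding abs_op_def cadjoint_eq_adj[OF A]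
  proof (rule the_equality)
    show "Q = X" if "positive_op Q \<and> Q \<circ> Q = adj A \<circ> A" for Q
      using that X by (intro positive_sqrt_unique) (auto simp: fun_eq_iff)
  qed (use X in \<open>simp add: fun_eq_iff\<close>)
  with X show "positive_op (abs_op A)" "abs_op A (abs_op A x) = adj A (A x)"
    "\<And>T x. bounded_clinear T \<Longrightarrow> (\<And>x. T (adj A (A x)) = adj A (A (T x))) \<Longrightarrow>
        T (abs_op A x) = abs_op A (T x)"
    by auto
qed

lemma bounded_clinear_abs_op: "bounded_clinear (abs_op A)"
  by (rule positive_op_bclin[OF abs_op_positive])

lemma norm_abs_op: "norm (abs_op A x) = norm (A x)"
proof -
  have "cinner (abs_op A x) (abs_op A x) = cinner (A x) (A x)"
    using hermitian_op_cinner[OF positive_op_hermitian[OF abs_op_positive]]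
    by (simp add: abs_op_abs_op cinner_adj_right[OF A])
  then have "(norm (abs_op A x))\<^sup>2 = (norm (A x))\<^sup>2"
    unfolding cinner_self of_real_eq_iff .
  then show ?thesis by simp
qed

text \<open>Since \<open>abs_op A x\<close> and \<open>A x\<close> have equal norms, Douglas' lemma
  applies in both directions. This lemma and its primed companion give contractions that turn
  \<open>abs_op A\<close> into \<open>A\<close> and back.\<close>

lemma polar_decomposition:
  obtains W where "bounded_clinear W" "\<And>x. norm (W x) \<le> norm x" "\<And>y. W (abs_op A y) = A y"
  by (rule douglas_factorization[OF bounded_clinear_abs_op A]) (simp_all add: norm_abs_op)

lemma polar_decomposition':
  obtains W where "bounded_clinear W" "\<And>x. norm (W x) \<le> norm x" "\<And>y. W (A y) = abs_op A y"
  by (rule douglas_factorization[OF A bounded_clinear_abs_op]) (simp_all add: norm_abs_op)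

end

lemma abs_op_of_positive:
  assumes "positive_op A"
  shows "abs_op A = A"
proof (rule positive_sqrt_unique)
  have A: "bounded_clinear A" by (rule positive_op_bclin[OF assms])
  show "positive_op (abs_op A)" by (rule abs_op_positive[OF A])
  show "abs_op A (abs_op A x) = A (A x)" for x
    using abs_op_abs_op[OF A] hermitian_op_adj[OF positive_op_hermitian[OF assms]] by simp
qed fact

text \<open>Applied to \<open>abs_op A\<close> together with \<open>A\<close> or \<open>- A\<close>,
  this replaces the spectral theorem. The hypotheses give \<open>(P + C) (P - C) = 0\<close>, so the
  range of \<open>P - C\<close> lies in the kernel of \<open>B = P + C\<close>. On a vector
  \<open>p\<close> orthogonal to this kernel \<open>P p = C p\<close>, and there the form of
  \<open>B\<close> is twice that of \<open>P\<close>.\<close>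

lemma sqrt_add_hermitian_positive:
  fixes P C :: "'a::complex_hilbert_space \<Rightarrow> 'a"
  assumes P: "positive_op P" and C: "hermitian_op C"
    and sq: "\<And>x. P (P x) = C (C x)" and comm: "\<And>x. P (C x) = C (P x)"
  shows "positive_op (\<lambda>x. P x + C x)"
proof -
  define B where "B x = P x + C x" for x
  have bP: "bounded_clinear P" and bC: "bounded_clinear C"
    using P C positive_op_bclin hermitian_op_bclin by blast+
  have bB: "bounded_clinear B" unfolding B_def by (intro bounded_clinear_intros bP bC)
  have hP: "hermitian_op P" by (rule positive_op_hermitian[OF P])
  have hB: "cinner (B x) y = cinner x (B y)" for x y
    by (simp add: B_def cinner_simps hermitian_op_cinner hP C)
  have "0 \<le> Re (cinner x (B x)) \<and> Im (cinner x (B x)) = 0" for x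
  proof -
    have "bounded_linear B" using bB by (simp add: bounded_clinear_def)
    then have cl: "closed {x. B x = 0}"
      by (intro closed_Collect_eq continuous_intros) (simp add: linear_continuous_on)
    obtain q where q: "B q = 0" "\<And>s. B s = 0 \<Longrightarrow> cinner s (x - q) = 0"
      by (rule projection_exists[OF cl, where x = x]) (auto simp: bclin_simps[OF bB] bclin_zero[OF bB])
    define p where "p = x - q"
    have "P p - C p = 0"
    proof (rule cinner_eqI)
      fix w
      have "B (P w - C w) = 0" by (simp add: B_def bclin_diff bP bC sq comm)
      from q(2)[OF this] show "cinner w (P p - C p) = cinner w 0"
        by (simp add: p_def[symmetric] cinner_simps hermitian_op_cinner hP C)
    qed
    then have "B p = 2 *\<^sub>R P p" by (simp add: B_def scaleR_2)
    moreover have "B x = B p" by (simp add: p_def bclin_diff[OF bB] q(1))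
    ultimately have "cinner x (B x) = 2 * cinner p (P p)"
      by (metis cinner_scaleR_right hB of_real_numeral)
    then show ?thesis using P by (simp add: positive_op_iff)
  qed
  then show ?thesis using bB by (simp add: positive_op_iff B_def[abs_def])
qed

lemma hermitian_op_abs_ge:
  assumes H: "hermitian_op A"
  shows "positive_op (\<lambda>x. abs_op A x + A x)" "positive_op (\<lambda>x. abs_op A x - A x)"
proof -
  have A: "bounded_clinear A" by (rule hermitian_op_bclin[OF H])
  have sq: "abs_op A (abs_op A x) = A (A x)" for x
    using abs_op_abs_op[OF A] hermitian_op_adj[OF H] by simp
  have comm: "abs_op A (A x) = A (abs_op A x)" for x
    using abs_op_commutes[OF A A] by (simp add: hermitian_op_adj[OF H])
  show "positive_op (\<lambda>x. abs_op A x + A x)"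
    by (rule sqrt_add_hermitian_positive[OF abs_op_positive[OF A] H sq comm])
  have "hermitian_op (\<lambda>x. - A x)"
    using H bounded_clinear_scaleC[OF A, of "-1"]
    by (simp add: hermitian_op_iff cinner_simps scaleC_minus_left)
  from sqrt_add_hermitian_positive[OF abs_op_positive[OF A] this]
  show "positive_op (\<lambda>x. abs_op A x - A x)"
    using sq comm by (simp add: bclin_minus[OF A] bclin_minus[OF bounded_clinear_abs_op[OF A]])
qed

definition sqrt_op :: "('a::complex_hilbert_space \<Rightarrow> 'a) \<Rightarrow> 'a \<Rightarrow> 'a" where
  "sqrt_op P = (SOME X. positive_op X \<and> (\<forall>x. X (X x) = P x))"

lemma sqrt_op:
  assumes "positive_op P"
  shows sqrt_op_positive: "positive_op (sqrt_op P)" and sqrt_op_sqrt_op: "sqrt_op P (sqrt_op P x) = P x"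
proof -
  have "\<exists>X. positive_op X \<and> (\<forall>x. X (X x) = P x)"
    using positive_sqrt_exists[OF assms] by metis
  from someI_ex[OF this] show "positive_op (sqrt_op P)" "sqrt_op P (sqrt_op P x) = P x"
    unfolding sqrt_op_def by blast+
qed

lemma cinner_positive_op_sqrt:
  assumes "positive_op P"
  shows "cinner x (P x) = of_real ((norm (sqrt_op P x))\<^sup>2)"
  using hermitian_op_cinner[OF positive_op_hermitian[OF sqrt_op_positive[OF assms]], of x "sqrt_op P x"]
  by (simp add: sqrt_op_sqrt_op[OF assms] cinner_self)


section \<open>Hilbert--Schmidt operators\<close>

text \<open>Only Parseval's identity is retained from an orthonormal basis. The index set admits the
  product vectors \<open>e \<otimes>\<^sub>v f\<close>, which are unrelated to the set
  \<open>onb\<close> chosen for the tensor type.\<close>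

definition parseval_family :: "('i \<Rightarrow> 'a::complex_hilbert_space) \<Rightarrow> 'i set \<Rightarrow> bool" where
  "parseval_family b I \<longleftrightarrow> (\<forall>x. ((\<lambda>i. (cmod (cinner (b i) x))\<^sup>2) has_sum (norm x)\<^sup>2) I)"

lemma cmod_cinner_commute: "cmod (cinner x y) = cmod (cinner y x)"
  by (metis cinner_commute complex_mod_cnj)

lemma parseval_family_onb: "parseval_family (\<lambda>e. e) onb"
  unfolding parseval_family_def
proof
  fix x :: 'a
  have "Re (cnj (cinner e x) * cinner e x) = (cmod (cinner e x))\<^sup>2" for e
    by (simp add: cmod_power2) (simp add: power2_eq_square)
  then show "((\<lambda>e. (cmod (cinner e x))\<^sup>2) has_sum (norm x)\<^sup>2) onb"
    using has_sum_Re[OF parseval[of x x]] by (simp add: cinner_self)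
qed

text \<open>The double series of \<open>(cmod (cinner (c j) (T (b i))))\<^sup>2\<close> is summed
  over \<open>j\<close> first and over \<open>i\<close> first; its terms are nonnegative, which
  permits the exchange.\<close>

lemma parseval_exchange:
  assumes T: "bounded_clinear T" and b: "parseval_family b I" and c: "parseval_family c J"
    and s: "((\<lambda>i. (norm (T (b i)))\<^sup>2) has_sum s) I"
  shows "((\<lambda>j. (norm (adj T (c j)))\<^sup>2) has_sum s) J"
proof -
  define f where "f = (\<lambda>(i, j). (cmod (cinner (c j) (T (b i))))\<^sup>2)"
  have 1: "((\<lambda>j. f (i, j)) has_sum (norm (T (b i)))\<^sup>2) J" for i
    using c by (simp add: f_def parseval_family_def)
  have "f summable_on I \<times> J"
    by (rule summable_on_SigmaI[OF 1 has_sum_imp_summable[OF s]]) (simp add: f_def)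
  then have "(f has_sum s) (I \<times> J)" by (rule has_sum_SigmaI[OF 1 s])
  then have 2: "((\<lambda>(j, i). f (i, j)) has_sum s) (J \<times> I)" by (rule iffD1[OF has_sum_swap])
  have "cmod (cinner (c j) (T (b i))) = cmod (cinner (b i) (adj T (c j)))" for i j
    by (simp add: cinner_adj_right[OF T] cmod_cinner_commute)
  then have 3: "((\<lambda>i. case (j, i) of (j, i) \<Rightarrow> f (i, j)) has_sum (norm (adj T (c j)))\<^sup>2) I" for j
    using b by (simp add: f_def parseval_family_def)
  show ?thesis by (rule has_sum_SigmaD[OF 2 3])
qed

definition hilbert_schmidt ::
  "('a::complex_hilbert_space \<Rightarrow> 'b::complex_hilbert_space) \<Rightarrow> bool" where
  "hilbert_schmidt T \<longleftrightarrow> bounded_clinear T \<and> (\<lambda>e. (norm (T e))\<^sup>2) summable_on onb"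

definition hs_norm :: "('a::complex_hilbert_space \<Rightarrow> 'b::complex_hilbert_space) \<Rightarrow> real" where
  "hs_norm T = sqrt (\<Sum>\<^sub>\<infinity>e\<in>onb. (norm (T e))\<^sup>2)"

lemma hs_norm_nonneg: "0 \<le> hs_norm T"
  by (simp add: hs_norm_def infsum_nonneg)

lemma hs_bclin: "hilbert_schmidt T \<Longrightarrow> bounded_clinear T"
  by (simp add: hilbert_schmidt_def)

lemma hs_norm_sq: "(hs_norm T)\<^sup>2 = (\<Sum>\<^sub>\<infinity>e\<in>onb. (norm (T e))\<^sup>2)"
  by (simp add: hs_norm_def infsum_nonneg)

text \<open>One exchange moves the sum to \<open>adj T\<close>, a second one moves it back to
  \<open>T\<close>, now with the family \<open>b\<close>.\<close>

lemma hs_has_sum: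
  assumes T: "hilbert_schmidt T" and b: "parseval_family b I"
  shows "((\<lambda>i. (norm (T (b i)))\<^sup>2) has_sum (hs_norm T)\<^sup>2) I"
proof -
  have bT: "bounded_clinear T" by (rule hs_bclin[OF T])
  have "((\<lambda>e. (norm (T e))\<^sup>2) has_sum (hs_norm T)\<^sup>2) onb"
    using T unfolding hs_norm_sq by (simp add: hilbert_schmidt_def)
  from parseval_exchange[OF bounded_clinear_adj[OF bT] parseval_family_onb b
      parseval_exchange[OF bT parseval_family_onb parseval_family_onb this]]
  show ?thesis by (simp add: adj_adj[OF bT])
qed

lemma hsI:
  assumes T: "bounded_clinear T" and b: "parseval_family b I"
    and s: "(\<lambda>i. (norm (T (b i)))\<^sup>2) summable_on I"
  shows "hilbert_schmidt T"
  using parseval_exchange[OF bounded_clinear_adj[OF T] parseval_family_onb parseval_family_onb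
      parseval_exchange[OF T b parseval_family_onb has_sum_infsum[OF s]]] T
  by (auto simp: hilbert_schmidt_def adj_adj intro: has_sum_imp_summable)

lemma hs_adj:
  assumes T: "hilbert_schmidt T"
  shows "hilbert_schmidt (adj T)" "hs_norm (adj T) = hs_norm T"
proof -
  have bT: "bounded_clinear T" by (rule hs_bclin[OF T])
  note * = parseval_exchange[OF bT parseval_family_onb parseval_family_onb
      hs_has_sum[OF T parseval_family_onb]]
  show "hilbert_schmidt (adj T)"
    using * bT by (auto simp: hilbert_schmidt_def bounded_clinear_adj intro: has_sum_imp_summable)
  have "(hs_norm (adj T))\<^sup>2 = (hs_norm T)\<^sup>2"
    unfolding hs_norm_sq[of "adj T"] by (rule infsumI[OF *])
  then show "hs_norm (adj T) = hs_norm T" by (simp add: power2_eq_iff_nonneg hs_norm_nonneg)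
qed

lemma hs_comp_left:
  assumes T: "hilbert_schmidt T" and W: "bounded_clinear W"
    and K: "\<And>x. norm (W x) \<le> K * norm x" "0 \<le> K"
  shows "hilbert_schmidt (\<lambda>x. W (T x))" "hs_norm (\<lambda>x. W (T x)) \<le> K * hs_norm T"
proof -
  have le: "(norm (W (T x)))\<^sup>2 \<le> K\<^sup>2 * (norm (T x))\<^sup>2" for x
    using power_mono[OF K(1)[of "T x"], of 2] by (simp add: power_mult_distrib)
  have s: "((\<lambda>e. K\<^sup>2 * (norm (T e))\<^sup>2) has_sum K\<^sup>2 * (hs_norm T)\<^sup>2) onb"
    by (intro has_sum_cmult_right hs_has_sum[OF T parseval_family_onb])
  have s': "(\<lambda>e. (norm (W (T e)))\<^sup>2) summable_on onb"
    by (rule summable_on_comparison_test[OF has_sum_imp_summable[OF s]]) (use le in auto)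
  then show "hilbert_schmidt (\<lambda>x. W (T x))"
    using T W by (simp add: hilbert_schmidt_def bounded_clinear_comp)
  have "(hs_norm (\<lambda>x. W (T x)))\<^sup>2 \<le> (K * hs_norm T)\<^sup>2"
    unfolding hs_norm_sq power_mult_distrib
    by (rule has_sum_mono[OF has_sum_infsum[OF s'] s[unfolded hs_norm_sq]]) (rule le)
  then show "hs_norm (\<lambda>x. W (T x)) \<le> K * hs_norm T"
    by (rule power2_le_imp_le) (simp add: K(2) hs_norm_nonneg)
qed

text \<open>Adjoints turn the right factor \<open>V\<close> into a left factor.\<close>

lemma hs_comp_right:
  assumes T: "hilbert_schmidt T" and V: "bounded_clinear V"
    and K: "\<And>x. norm (V x) \<le> K * norm x" "0 \<le> K"
  shows "hilbert_schmidt (\<lambda>x. T (V x))" "hs_norm (\<lambda>x. T (V x)) \<le> K * hs_norm T"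
proof -
  have bT: "bounded_clinear T" by (rule hs_bclin[OF T])
  have eq: "adj (\<lambda>x. adj V (adj T x)) = (\<lambda>x. T (V x))"
    by (simp add: adj_comp bounded_clinear_adj V bT adj_adj)
  note * = hs_comp_left[OF hs_adj(1)[OF T] bounded_clinear_adj[OF V] adj_bound[OF V K]]
  show "hilbert_schmidt (\<lambda>x. T (V x))" using hs_adj(1)[OF *(1)[OF K(2)]] by (simp add: eq)
  show "hs_norm (\<lambda>x. T (V x)) \<le> K * hs_norm T"
    using hs_adj(2)[OF *(1)[OF K(2)]] *(2)[OF K(2)] hs_adj(2)[OF T] by (simp add: eq)
qed

lemma hs_rank_one: "hilbert_schmidt (\<lambda>x. cinner a x *\<^sub>C b)"
proof -
  have "(\<lambda>e. (norm b)\<^sup>2 * (cmod (cinner e a))\<^sup>2) summable_on onb"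
    by (intro summable_on_cmult_right onb_summable)
  then show ?thesis
    by (simp add: hilbert_schmidt_def bounded_clinear_cinner norm_scaleC power_mult_distrib
        cmod_cinner_commute[of a] mult.commute)
qed

context
  fixes B :: "'k::complex_hilbert_space \<Rightarrow> 'h::complex_hilbert_space" and C :: "'h \<Rightarrow> 'k"
  assumes B: "hilbert_schmidt B" and C: "hilbert_schmidt C"
begin

text \<open>Moving \<open>B\<close> to the left entry makes each term at most
  \<open>norm (adj B (b i)) * norm (C (b i))\<close>; then the Cauchy-Schwarz inequality for finite
  sums applies.\<close>

lemma hs_comp_sum_le:
  assumes b: "parseval_family b I" and F: "finite F" "F \<subseteq> I"
  shows "(\<Sum>i\<in>F. cmod (cinner (b i) (B (C (b i))))) \<le> hs_norm B * hs_norm C"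
proof -
  have "(\<Sum>i\<in>F. cmod (cinner (b i) (B (C (b i))))) \<le>
      (\<Sum>i\<in>F. \<bar>norm (adj B (b i))\<bar> * \<bar>norm (C (b i))\<bar>)"
    using cmod_cinner_le by (intro sum_mono) (simp flip: cinner_adj[OF hs_bclin[OF B]])
  also have "\<dots> \<le> L2_set (\<lambda>i. norm (adj B (b i))) F * L2_set (\<lambda>i. norm (C (b i))) F"
    by (rule L2_set_mult_ineq)
  also have "\<dots> \<le> hs_norm B * hs_norm C"
  proof (rule mult_mono)
    have "L2_set (\<lambda>i. norm (T (b i))) F \<le> hs_norm T"
      if "hilbert_schmidt T" for T :: "'h \<Rightarrow> 'k"
      unfolding L2_set_def using hs_norm_nonneg
      by (intro real_le_lsqrt finite_sum_le_has_sum[OF hs_has_sum[OF that b] F] sum_nonneg) auto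
    from this[OF hs_adj(1)[OF B]] this[OF C]
    show "L2_set (\<lambda>i. norm (adj B (b i))) F \<le> hs_norm B" "L2_set (\<lambda>i. norm (C (b i))) F \<le> hs_norm C"
      by (simp_all add: hs_adj(2)[OF B])
  qed (simp_all add: hs_norm_nonneg)
  finally show ?thesis .
qed

lemma hs_comp_summable:
  assumes b: "parseval_family b I"
  shows "(\<lambda>i. cinner (b i) (B (C (b i)))) summable_on I"
    and "cmod (\<Sum>\<^sub>\<infinity>i\<in>I. cinner (b i) (B (C (b i)))) \<le> hs_norm B * hs_norm C"
proof -
  have a: "(\<lambda>i. norm (cinner (b i) (B (C (b i))))) summable_on I"
    by (rule nonneg_bounded_partial_sums_imp_summable_on[where C = "hs_norm B * hs_norm C"])
      (auto intro!: eventually_finite_subsets_at_top_weakI hs_comp_sum_le[OF b])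
  then show "(\<lambda>i. cinner (b i) (B (C (b i)))) summable_on I" by (rule abs_summable_summable)
  show "cmod (\<Sum>\<^sub>\<infinity>i\<in>I. cinner (b i) (B (C (b i)))) \<le> hs_norm B * hs_norm C"
    by (rule order_trans[OF norm_infsum_bound[OF a] infsum_le_finite_sums[OF a]])
      (rule hs_comp_sum_le[OF b])
qed

end

section \<open>Trace class operators\<close>

lemma trace_class_bclin: "A \<in> trace_class \<Longrightarrow> bounded_clinear A"
  by (simp add: trace_class_def)

text \<open>With \<open>S\<close> the root of \<open>abs_op A\<close> and \<open>W\<close> from the
  polar decomposition, \<open>A = (W S) S\<close>. The square of \<open>hs_norm S\<close> is the
  trace norm, which controls the product of the two norms.\<close>

lemma trace_class_factor:
  assumes "A \<in> trace_class"
  obtains B C :: "'a::complex_hilbert_space \<Rightarrow> 'a" where "hilbert_schmidt B" "hilbert_schmidt C"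
    "A = (\<lambda>x. B (C x))" "hs_norm B * hs_norm C \<le> trace_norm A"
proof -
  have A: "bounded_clinear A" by (rule trace_class_bclin[OF assms])
  define S where "S = sqrt_op (abs_op A)"
  have S: "positive_op S" "\<And>x. S (S x) = abs_op A x"
    using sqrt_op[OF abs_op_positive[OF A]] by (simp_all add: S_def)
  have diag: "cinner e (abs_op A e) = of_real ((norm (S e))\<^sup>2)" for e
    by (simp add: cinner_positive_op_sqrt[OF abs_op_positive[OF A]] S_def)
  have sum: "(\<lambda>e. cinner e (abs_op A e)) summable_on onb"
    using assms by (simp add: trace_class_def)
  from summable_on_Re[OF this] have hs: "hilbert_schmidt S"
    using positive_op_bclin[OF S(1)] by (simp add: diag hilbert_schmidt_def flip: of_real_power)
  have "(hs_norm S)\<^sup>2 = trace_norm A"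
    unfolding hs_norm_sq trace_norm_def op_trace_def
    by (subst infsum_Re[symmetric, OF sum]) (simp add: diag flip: of_real_power)
  note n = this
  obtain W where W: "bounded_clinear W" "\<And>x. norm (W x) \<le> norm x"
    "\<And>y. W (abs_op A y) = A y" by (rule polar_decomposition[OF A]) blast
  have WS: "hilbert_schmidt (\<lambda>x. W (S x))" "hs_norm (\<lambda>x. W (S x)) \<le> 1 * hs_norm S"
    using hs_comp_left[OF hs W(1), of 1] W(2) by simp_all
  have "hs_norm (\<lambda>x. W (S x)) * hs_norm S \<le> trace_norm A"
    using mult_right_mono[OF WS(2) hs_norm_nonneg[of S]] n by (simp add: power2_eq_square)
  moreover have "A = (\<lambda>x. W (S (S x)))" by (simp add: S(2) W(3))
  ultimately show ?thesis using that WS(1) hs by blast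
qed

text \<open>If the contraction \<open>V\<close> carries \<open>B C\<close> to its absolute value,
  this absolute value is \<open>(V B) C\<close>, whose diagonal is summable by Cauchy-Schwarz. With
  \<open>trace_class_factor\<close> this characterizes the trace class without
  \<open>abs_op\<close>.\<close>

lemma hs_comp_trace_class:
  fixes B :: "'k::complex_hilbert_space \<Rightarrow> 'h::complex_hilbert_space" and C :: "'h \<Rightarrow> 'k"
  assumes B: "hilbert_schmidt B" and C: "hilbert_schmidt C"
  shows "(\<lambda>x. B (C x)) \<in> trace_class" "trace_norm (\<lambda>x. B (C x)) \<le> hs_norm B * hs_norm C"
proof -
  define A where "A x = B (C x)" for x
  have A: "bounded_clinear A"
    unfolding A_def by (rule bounded_clinear_comp[OF hs_bclin[OF B] hs_bclin[OF C]])
  obtain V where V: "bounded_clinear V" "\<And>x. norm (V x) \<le> norm x" "\<And>y. V (A y) = abs_op A y"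
    by (rule polar_decomposition'[OF A]) blast
  have VB: "hilbert_schmidt (\<lambda>x. V (B x))" "hs_norm (\<lambda>x. V (B x)) \<le> 1 * hs_norm B"
    using hs_comp_left[OF B V(1), of 1] V(2) by simp_all
  note * = hs_comp_summable[OF VB(1) C parseval_family_onb, folded A_def, unfolded V(3)]
  then show "(\<lambda>x. B (C x)) \<in> trace_class" using A by (simp add: trace_class_def A_def[abs_def])
  have "trace_norm A \<le> hs_norm (\<lambda>x. V (B x)) * hs_norm C"
    unfolding trace_norm_def op_trace_def
    by (rule order_trans[OF complex_Re_le_cmod *(2)])
  also have "\<dots> \<le> hs_norm B * hs_norm C" using VB(2) by (intro mult_right_mono hs_norm_nonneg) simp
  finally show "trace_norm (\<lambda>x. B (C x)) \<le> hs_norm B * hs_norm C" by (simp add: A_def[abs_def])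
qed

text \<open>A contraction on the left is absorbed by the first Hilbert-Schmidt factor. This stands
  in for the duality between trace class and bounded operators.\<close>

lemma trace_class_contraction_summable:
  assumes A: "A \<in> trace_class" and V: "bounded_clinear V" "\<And>x. norm (V x) \<le> norm x"
  shows "(\<lambda>e. cinner e (V (A e))) summable_on onb"
    and "cmod (\<Sum>\<^sub>\<infinity>e\<in>onb. cinner e (V (A e))) \<le> trace_norm A"
proof -
  obtain B C :: "'a \<Rightarrow> 'a" where BC: "hilbert_schmidt B" "hilbert_schmidt C"
    "A = (\<lambda>x. B (C x))" "hs_norm B * hs_norm C \<le> trace_norm A" by (rule trace_class_factor[OF A])
  have VB: "hilbert_schmidt (\<lambda>x. V (B x))" "hs_norm (\<lambda>x. V (B x)) \<le> 1 * hs_norm B"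
    using hs_comp_left[OF BC(1) V(1), of 1] V(2) by simp_all
  note * = hs_comp_summable[OF VB(1) BC(2) parseval_family_onb]
  show "(\<lambda>e. cinner e (V (A e))) summable_on onb" using *(1) by (simp add: BC(3))
  have "hs_norm (\<lambda>x. V (B x)) * hs_norm C \<le> hs_norm B * hs_norm C"
    using VB(2) by (intro mult_right_mono hs_norm_nonneg) simp
  then show "cmod (\<Sum>\<^sub>\<infinity>e\<in>onb. cinner e (V (A e))) \<le> trace_norm A"
    using *(2) BC(4) unfolding BC(3) by linarith
qed

lemma trace_class_has_sum:
  assumes "A \<in> trace_class"
  shows "((\<lambda>e. cinner e (A e)) has_sum op_trace A) onb"
  using trace_class_contraction_summable(1)[OF assms bounded_clinear_id]
  by (simp add: op_trace_def)

lemma trace_norm_nonneg: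
  assumes "bounded_clinear A"
  shows "0 \<le> trace_norm A"
proof -
  have "0 \<le> Re (op_trace (abs_op A))"
  proof (cases "(\<lambda>e. cinner e (abs_op A e)) summable_on onb")
    case True
    show ?thesis
      unfolding op_trace_def infsum_Re[OF True, symmetric]
      by (intro infsum_nonneg positive_op_Re abs_op_positive assms)
  qed (simp add: op_trace_def infsum_not_exists)
  then show ?thesis by (simp add: trace_norm_def)
qed

text \<open>The absolute value of the sum is \<open>V (A + B) = V A + V B\<close> for one
  contraction \<open>V\<close>, and the trace of each term is bounded by the respective trace
  norm.\<close>

lemma trace_class_add:
  assumes A: "A \<in> trace_class" and B: "B \<in> trace_class"
  shows "(\<lambda>x. A x + B x) \<in> trace_class"
    and trace_norm_triangle: "trace_norm (\<lambda>x. A x + B x) \<le> trace_norm A + trace_norm B"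
proof -
  have AB: "bounded_clinear (\<lambda>x. A x + B x)"
    by (intro bounded_clinear_add trace_class_bclin A B)
  obtain V where V: "bounded_clinear V" "\<And>x. norm (V x) \<le> norm x"
    "\<And>y. V (A y + B y) = abs_op (\<lambda>x. A x + B x) y"
    by (rule polar_decomposition'[OF AB]) blast
  note sA = trace_class_contraction_summable[OF A V(1,2)]
  note sB = trace_class_contraction_summable[OF B V(1,2)]
  have eq: "cinner e (abs_op (\<lambda>x. A x + B x) e) = cinner e (V (A e)) + cinner e (V (B e))" for e
    by (simp add: bclin_add[OF V(1)] cinner_add_right flip: V(3))
  show "(\<lambda>x. A x + B x) \<in> trace_class"
    using AB summable_on_add[OF sA(1) sB(1)] by (simp add: trace_class_def eq)
  have "trace_norm (\<lambda>x. A x + B x) =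
      Re ((\<Sum>\<^sub>\<infinity>e\<in>onb. cinner e (V (A e))) + (\<Sum>\<^sub>\<infinity>e\<in>onb. cinner e (V (B e))))"
    unfolding trace_norm_def op_trace_def eq by (simp add: infsum_add[OF sA(1) sB(1)])
  also have "\<dots> \<le> trace_norm A + trace_norm B"
    by (rule order_trans[OF complex_Re_le_cmod norm_triangle_le]) (rule add_mono[OF sA(2) sB(2)])
  finally show "trace_norm (\<lambda>x. A x + B x) \<le> trace_norm A + trace_norm B" .
qed

text \<open>\<open>V\<close> and \<open>W\<close> may pass between different spaces, which later
  makes blocks and block sums trace class.\<close>

lemma trace_class_ideal:
  fixes A :: "'h::complex_hilbert_space \<Rightarrow> 'h" and V :: "'h \<Rightarrow> 'k::complex_hilbert_space"
  assumes A: "A \<in> trace_class" and V: "bounded_clinear V" and W: "bounded_clinear W"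
  shows "(\<lambda>x. V (A (W x))) \<in> trace_class"
proof -
  obtain B C :: "'h \<Rightarrow> 'h" where BC: "hilbert_schmidt B" "hilbert_schmidt C"
    "A = (\<lambda>x. B (C x))" "hs_norm B * hs_norm C \<le> trace_norm A" by (rule trace_class_factor[OF A])
  obtain K where K: "K > 0" "\<And>x. norm (V x) \<le> K * norm x" using bounded_clinear_bound[OF V] by blast
  obtain L where L: "L > 0" "\<And>x. norm (W x) \<le> L * norm x" using bounded_clinear_bound[OF W] by blast
  show ?thesis unfolding BC(3)
    using hs_comp_trace_class(1)[OF hs_comp_left(1)[OF BC(1) V K(2)] hs_comp_right(1)[OF BC(2) W L(2)]]
      K(1) L(1) by simp
qed

lemma trace_class_scaleC:
  assumes A: "A \<in> trace_class"
  shows "(\<lambda>x. c *\<^sub>C A x) \<in> trace_class"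
    and trace_norm_scaleC_le: "trace_norm (\<lambda>x. c *\<^sub>C A x) \<le> cmod c * trace_norm A"
proof -
  obtain B C :: "'a \<Rightarrow> 'a" where BC: "hilbert_schmidt B" "hilbert_schmidt C"
    "A = (\<lambda>x. B (C x))" "hs_norm B * hs_norm C \<le> trace_norm A" by (rule trace_class_factor[OF A])
  have cB: "hilbert_schmidt (\<lambda>x. c *\<^sub>C B x)" "hs_norm (\<lambda>x. c *\<^sub>C B x) \<le> cmod c * hs_norm B"
    using hs_comp_left[OF BC(1) bounded_clinear_scaleC_fun[of c], of "cmod c"]
    by (simp_all add: norm_scaleC)
  note * = hs_comp_trace_class[OF cB(1) BC(2)]
  show "(\<lambda>x. c *\<^sub>C A x) \<in> trace_class" using *(1) by (simp add: BC(3))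
  have "trace_norm (\<lambda>x. c *\<^sub>C A x) \<le> hs_norm (\<lambda>x. c *\<^sub>C B x) * hs_norm C" using *(2) by (simp add: BC(3))
  also have "\<dots> \<le> (cmod c * hs_norm B) * hs_norm C" by (intro mult_right_mono cB(2) hs_norm_nonneg)
  also have "\<dots> \<le> cmod c * trace_norm A" using mult_left_mono[OF BC(4), of "cmod c"] by (simp add: mult.assoc)
  finally show "trace_norm (\<lambda>x. c *\<^sub>C A x) \<le> cmod c * trace_norm A" .
qed

lemma trace_class_adj:
  assumes A: "A \<in> trace_class"
  shows "adj A \<in> trace_class" and trace_norm_adj_le: "trace_norm (adj A) \<le> trace_norm A"
proof -
  obtain B C :: "'a \<Rightarrow> 'a" where BC: "hilbert_schmidt B" "hilbert_schmidt C"
    "A = (\<lambda>x. B (C x))" "hs_norm B * hs_norm C \<le> trace_norm A" by (rule trace_class_factor[OF A])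
  have eq: "adj A = (\<lambda>x. adj C (adj B x))"
    unfolding BC(3) by (rule adj_comp[OF hs_bclin[OF BC(1)] hs_bclin[OF BC(2)]])
  note * = hs_comp_trace_class[OF hs_adj(1)[OF BC(2)] hs_adj(1)[OF BC(1)]]
  show "adj A \<in> trace_class" using *(1) by (simp add: eq)
  show "trace_norm (adj A) \<le> trace_norm A"
    using *(2) BC(4) by (simp add: eq hs_adj(2) BC(1,2) mult.commute)
qed

lemma trace_class_zero: "(\<lambda>x. 0) \<in> trace_class"
  using hs_comp_trace_class(1)[OF hs_rank_one[of 0 0] hs_rank_one[of 0 0]] by simp

lemma trace_class_rank_one: "(\<lambda>x. cinner a x *\<^sub>C b) \<in> trace_class"
proof -
  \<comment> \<open>The outer factor projects onto the line of \<open>b\<close>. For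
    \<open>b = 0\<close> the division by zero yields \<open>0\<close>, and both sides
    vanish.\<close>
  have "(\<lambda>x. cinner ((1 / (norm b)\<^sup>2) *\<^sub>R b) (cinner a x *\<^sub>C b) *\<^sub>C b) = (\<lambda>x. cinner a x *\<^sub>C b)"
    by (cases "b = 0") (simp_all add: cinner_simps cinner_self)
  then show ?thesis
    using hs_comp_trace_class(1)[OF hs_rank_one[of "(1 / (norm b)\<^sup>2) *\<^sub>R b" b] hs_rank_one[of a b]]
    by simp
qed

lemma trace_class_sum:
  "(\<And>i. i \<in> I \<Longrightarrow> A i \<in> trace_class) \<Longrightarrow> (\<lambda>x. \<Sum>i\<in>I. A i x) \<in> trace_class"
  by (induction I rule: infinite_finite_induct) (simp_all add: trace_class_zero trace_class_add)

lemma trace_class_diff: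
  assumes "A \<in> trace_class" "B \<in> trace_class"
  shows "(\<lambda>x. A x - B x) \<in> trace_class"
  using trace_class_add(1)[OF assms(1) trace_class_scaleC(1)[OF assms(2), of "-1"]]
  by (simp add: scaleC_minus_left)

lemma trace_norm_diff_le:
  assumes "A \<in> trace_class" "B \<in> trace_class"
  shows "trace_norm (\<lambda>x. A x - B x) \<le> trace_norm A + trace_norm B"
  using trace_norm_triangle[OF assms(1) trace_class_scaleC(1)[OF assms(2), of "-1"]]
    trace_norm_scaleC_le[OF assms(2), of "-1"]
  by (simp add: scaleC_minus_left)

lemma op_trace_add:
  assumes "A \<in> trace_class" "B \<in> trace_class"
  shows "op_trace (\<lambda>x. A x + B x) = op_trace A + op_trace B"
  unfolding op_trace_def[of "\<lambda>x. A x + B x"]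
  using has_sum_add[OF assms[THEN trace_class_has_sum]] by (simp add: cinner_add_right infsumI)

lemma op_trace_diff:
  assumes "A \<in> trace_class" "B \<in> trace_class"
  shows "op_trace (\<lambda>x. A x - B x) = op_trace A - op_trace B"
  using op_trace_add[OF trace_class_diff[OF assms] assms(2)] by simp

lemma op_trace_scaleC:
  assumes "A \<in> trace_class"
  shows "op_trace (\<lambda>x. c *\<^sub>C A x) = c * op_trace A"
  unfolding op_trace_def[of "\<lambda>x. c *\<^sub>C A x"]
  using has_sum_cmult_right[OF trace_class_has_sum[OF assms], of c]
  by (simp add: cinner_scaleC_right infsumI)

text \<open>The nonnegative diagonal of \<open>abs_op A\<close> sums to zero, so by Cauchy-Schwarz
  \<open>abs_op A\<close> kills every basis vector.\<close>

lemma trace_norm_eq_0: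
  assumes A: "A \<in> trace_class" and "trace_norm A = 0"
  shows "A = (\<lambda>x. 0)"
proof
  fix x
  have bA: "bounded_clinear A" by (rule trace_class_bclin[OF A])
  have pos: "positive_op (abs_op A)" by (rule abs_op_positive[OF bA])
  have sum: "(\<lambda>e. cinner e (abs_op A e)) summable_on onb" using A by (simp add: trace_class_def)
  have "Re (cinner e (abs_op A e)) = 0" if "e \<in> onb" for e
    by (rule nonneg_infsum_le_0D[OF _ summable_on_Re[OF sum] positive_op_Re[OF pos] that])
      (use assms(2) in \<open>simp add: infsum_Re[OF sum] trace_norm_def op_trace_def\<close>)
  then have 0: "abs_op A e = 0" if "e \<in> onb" for e using that positive_op_eq_0[OF pos] by blast
  have "abs_op A x = 0"
  proof (rule onb_total)
    fix e :: 'a assume "e \<in> onb"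
    then show "cinner e (abs_op A x) = 0"
      using hermitian_op_cinner[OF positive_op_hermitian[OF pos], of e x] 0 by simp
  qed
  then show "A x = 0" using norm_abs_op[OF bA, of x] by simp
qed

context
  fixes A :: "'a::complex_hilbert_space \<Rightarrow> 'a" and b :: "'i \<Rightarrow> 'a" and I
  assumes P: "positive_op A" and b: "parseval_family b I"
begin

text \<open>The diagonal of a positive operator consists of the squared norms of its root at
  \<open>b i\<close>. Its summability is the Hilbert-Schmidt property of the root, which can be
  tested on any Parseval family.\<close>

lemma positive_trace_class_iff:
  "A \<in> trace_class \<longleftrightarrow> (\<lambda>i. Re (cinner (b i) (A (b i)))) summable_on I"
proof
  have diag: "Re (cinner x (A x)) = (norm (sqrt_op A x))\<^sup>2" for x
    by (simp add: cinner_positive_op_sqrt[OF P] flip: of_real_power)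
  have hs: "hilbert_schmidt (sqrt_op A)" if "(\<lambda>i. (norm (sqrt_op A (c i)))\<^sup>2) summable_on J"
    "parseval_family c J" for c J
    using that by (intro hsI positive_op_bclin sqrt_op_positive[OF P])
  {
    assume "(\<lambda>i. Re (cinner (b i) (A (b i)))) summable_on I"
    then have "hilbert_schmidt (sqrt_op A)" unfolding diag by (rule hs) (rule b)
    from hs_comp_trace_class(1)[OF this this] show "A \<in> trace_class"
      by (simp add: sqrt_op_sqrt_op[OF P])
  next
    assume "A \<in> trace_class"
    then have "(\<lambda>e. Re (cinner e (A e))) summable_on onb"
      using trace_class_has_sum has_sum_Re has_sum_imp_summable by blast
    then have "hilbert_schmidt (sqrt_op A)"
      unfolding diag by (rule hs[where c = "\<lambda>e. e"]) (rule parseval_family_onb)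
    from hs_has_sum[OF this b] show "(\<lambda>i. Re (cinner (b i) (A (b i)))) summable_on I"
      unfolding diag by (rule has_sum_imp_summable)
  }
qed

lemma positive_op_trace_has_sum:
  assumes "A \<in> trace_class"
  shows "((\<lambda>i. Re (cinner (b i) (A (b i)))) has_sum trace_norm A) I"
proof -
  have diag: "Re (cinner x (A x)) = (norm (sqrt_op A x))\<^sup>2" for x
    by (simp add: cinner_positive_op_sqrt[OF P] flip: of_real_power)
  have *: "((\<lambda>e. Re (cinner e (A e))) has_sum trace_norm A) onb"
    using has_sum_Re[OF trace_class_has_sum[OF assms]]
    by (simp add: trace_norm_def abs_op_of_positive[OF P])
  then have hs: "hilbert_schmidt (sqrt_op A)"
    unfolding diag hilbert_schmidt_def
    using positive_op_bclin[OF sqrt_op_positive[OF P]] has_sum_imp_summable by blast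
  have "trace_norm A = (hs_norm (sqrt_op A))\<^sup>2"
    using has_sum_unique[OF *[unfolded diag] hs_has_sum[OF hs parseval_family_onb]] .
  then show ?thesis using hs_has_sum[OF hs b] by (simp add: diag)
qed

end

lemma op_trace_positive:
  assumes "positive_op A"
  shows "op_trace A = of_real (trace_norm A)"
proof -
  have "Im (op_trace A) = 0"
  proof (cases "(\<lambda>e. cinner e (A e)) summable_on onb")
    case True
    show ?thesis
      unfolding op_trace_def infsum_Im[OF True, symmetric]
      using assms by (simp add: positive_op_iff)
  qed (simp add: op_trace_def infsum_not_exists)
  then show ?thesis by (simp add: trace_norm_def abs_op_of_positive[OF assms] complex_eq_iff)
qed

text \<open>The parts are half of \<open>abs_op A + A\<close> and half of
  \<open>abs_op A - A\<close>. They add up to \<open>abs_op A\<close>, and the trace of this sum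
  gives equality of the norms where the triangle inequality gives only one direction.\<close>

lemma jordan_decomposition:
  assumes A: "A \<in> trace_class" and H: "hermitian_op A"
  obtains P Q where "positive_op P" "positive_op Q" "P \<in> trace_class" "Q \<in> trace_class"
    "A = (\<lambda>x. P x - Q x)" "trace_norm P + trace_norm Q = trace_norm A"
proof -
  have bA: "bounded_clinear A" by (rule trace_class_bclin[OF A])
  have abs_abs: "abs_op (abs_op A) = abs_op A" by (rule abs_op_of_positive[OF abs_op_positive[OF bA]])
  have T: "abs_op A \<in> trace_class"
    using A by (simp add: trace_class_def bounded_clinear_abs_op abs_abs)
  define P where "P x = (1/2) *\<^sub>R (abs_op A x + A x)" for x
  define Q where "Q x = (1/2) *\<^sub>R (abs_op A x - A x)" for x
  have pos: "positive_op P" "positive_op Q"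
    unfolding P_def Q_def by (intro positive_op_scaleR hermitian_op_abs_ge[OF H]; simp)+
  have tc: "P \<in> trace_class" "Q \<in> trace_class"
    unfolding P_def Q_def scaleR_scaleC
    by (intro trace_class_scaleC(1) trace_class_add(1) trace_class_diff T A)+
  have "(\<lambda>x. P x + Q x) = abs_op A" by (simp add: fun_eq_iff P_def Q_def flip: scaleR_add_right)
  then have "op_trace P + op_trace Q = op_trace (abs_op A)"
    using op_trace_add[OF tc] by simp
  then have "complex_of_real (trace_norm P + trace_norm Q) = of_real (trace_norm A)"
    unfolding op_trace_positive[OF pos(1)] op_trace_positive[OF pos(2)]
      op_trace_positive[OF abs_op_positive[OF bA]]
    by (simp add: trace_norm_def abs_abs)
  then have "trace_norm P + trace_norm Q = trace_norm A" using of_real_eq_iff by blast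
  moreover have "A = (\<lambda>x. P x - Q x)"
    by (simp add: fun_eq_iff P_def Q_def flip: scaleR_diff_right)
  ultimately show ?thesis using that pos tc by blast
qed

text \<open>The bounds hold because the trace norm of \<open>adj A\<close> is at most that of
  \<open>A\<close>; they are the origin of the factor in \<open>ampliation_bound\<close>.\<close>

lemma hermitian_decomposition:
  assumes A: "A \<in> trace_class"
  obtains G H where "hermitian_op G" "hermitian_op H" "G \<in> trace_class" "H \<in> trace_class"
    "A = (\<lambda>x. G x + \<i> *\<^sub>C H x)" "trace_norm G \<le> trace_norm A" "trace_norm H \<le> trace_norm A"
proof -
  have bA: "bounded_clinear A" by (rule trace_class_bclin[OF A])
  define G where "G x = (1/2) *\<^sub>C (A x + adj A x)" for x
  define H where "H x = (- \<i>/2) *\<^sub>C (A x - adj A x)" for x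
  have tA: "adj A \<in> trace_class" by (rule trace_class_adj(1)[OF A])
  have tc: "G \<in> trace_class" "H \<in> trace_class"
    unfolding G_def H_def by (intro trace_class_scaleC(1) trace_class_add(1) trace_class_diff A tA)+
  have "hermitian_op G" "hermitian_op H"
    using trace_class_bclin[OF tc(1)] trace_class_bclin[OF tc(2)]
    by (simp_all add: hermitian_op_iff G_def H_def cinner_simps cinner_adj[OF bA]
        cinner_adj_right[OF bA] algebra_simps)
  moreover have "A = (\<lambda>x. G x + \<i> *\<^sub>C H x)"
  proof
    fix x
    have "G x + \<i> *\<^sub>C H x = (1/2 + 1/2) *\<^sub>C A x"
      unfolding scaleC_add_left
      by (simp add: G_def H_def scaleC_add_right scaleC_diff_right scaleC_scaleC)
    then show "A x = G x + \<i> *\<^sub>C H x" by simp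
  qed
  moreover have "trace_norm G \<le> trace_norm A"
    unfolding G_def using trace_norm_scaleC_le[OF trace_class_add(1)[OF A tA], of "1/2"]
      trace_norm_triangle[OF A tA] trace_norm_adj_le[OF A] by simp
  moreover have "trace_norm H \<le> trace_norm A"
    unfolding H_def using trace_norm_scaleC_le[OF trace_class_diff[OF A tA], of "-\<i>/2"]
      trace_norm_diff_le[OF A tA] trace_norm_adj_le[OF A] by (simp add: norm_divide)
  ultimately show ?thesis using that tc by blast
qed


section \<open>Positive trace preserving maps\<close>

lemma linear_superopD:
  assumes "linear_superop \<Phi>"
  shows linear_superop_trace_class: "A \<in> trace_class \<Longrightarrow> \<Phi> A \<in> trace_class"
    and linear_superop_add:
      "A \<in> trace_class \<Longrightarrow> B \<in> trace_class \<Longrightarrow> \<Phi> (\<lambda>x. A x + B x) = (\<lambda>x. \<Phi> A x + \<Phi> B x)"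
    and linear_superop_scaleC: "A \<in> trace_class \<Longrightarrow> \<Phi> (\<lambda>x. c *\<^sub>C A x) = (\<lambda>x. c *\<^sub>C \<Phi> A x)"
  using assms unfolding linear_superop_def by blast+

lemma linear_superop_zero:
  assumes "linear_superop \<Phi>"
  shows "\<Phi> (\<lambda>x. 0) = (\<lambda>x. 0)"
  using linear_superop_scaleC[OF assms trace_class_zero, of 0] by simp

lemma linear_superop_diff:
  assumes "linear_superop \<Phi>" "A \<in> trace_class" "B \<in> trace_class"
  shows "\<Phi> (\<lambda>x. A x - B x) = (\<lambda>x. \<Phi> A x - \<Phi> B x)"
  using linear_superop_add[OF assms(1,2) trace_class_scaleC(1)[OF assms(3), of "-1"]]
    linear_superop_scaleC[OF assms(1,3), of "-1"]
  by (simp add: scaleC_minus_left)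

lemma linear_superop_sum:
  assumes "linear_superop \<Phi>" "\<And>i. i \<in> I \<Longrightarrow> A i \<in> trace_class"
  shows "\<Phi> (\<lambda>x. \<Sum>i\<in>I. A i x) = (\<lambda>x. \<Sum>i\<in>I. \<Phi> (A i) x)"
  using assms(2)
proof (induction I rule: infinite_finite_induct)
  case (insert i I)
  then have "\<Phi> (\<lambda>x. A i x + (\<Sum>i\<in>I. A i x)) = (\<lambda>x. \<Phi> (A i) x + \<Phi> (\<lambda>x. \<Sum>i\<in>I. A i x) x)"
    by (intro linear_superop_add assms(1) trace_class_sum) auto
  then show ?case using insert by simp
qed (simp_all add: linear_superop_zero[OF assms(1)])

lemma linear_superop_combination:
  assumes "linear_superop \<Phi>" "G \<in> trace_class" "H \<in> trace_class"
  shows "\<Phi> (\<lambda>x. G x + c *\<^sub>C H x) = (\<lambda>x. \<Phi> G x + c *\<^sub>C \<Phi> H x)"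
  using linear_superop_add[OF assms(1,2) trace_class_scaleC(1)[OF assms(3)]]
    linear_superop_scaleC[OF assms(1,3)] by simp

lemma hermitian_op_diff:
  "hermitian_op A \<Longrightarrow> hermitian_op B \<Longrightarrow> hermitian_op (\<lambda>x. A x - B x)"
  by (simp add: hermitian_op_iff bounded_clinear_diff cinner_simps)

text \<open>Real and imaginary part are unique: moving the operators across \<open>cinner\<close>
  keeps \<open>K\<close> and \<open>G\<close> but reverses the sign of
  \<open>\<i> *\<^sub>C H\<close>.\<close>

lemma hermitian_op_imaginary_part_zero:
  assumes G: "hermitian_op G" and H: "hermitian_op H" and K: "hermitian_op K"
    and eq: "K = (\<lambda>x. G x + \<i> *\<^sub>C H x)"
  shows "H = (\<lambda>x. 0)" "K = G"
proof -
  have "H x = 0" for x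
  proof (rule cinner_eqI)
    fix y
    have "cinner (K y) x = cinner y (K x)" using K by (rule hermitian_op_cinner)
    then show "cinner y (H x) = cinner y 0"
      using hermitian_op_cinner[OF G, of y x] hermitian_op_cinner[OF H, of y x]
      by (simp add: eq cinner_simps)
  qed
  then show "H = (\<lambda>x. 0)" by (rule ext)
  then show "K = G" by (simp add: eq)
qed

context
  fixes \<Phi> :: "'a::complex_hilbert_space superop"
  assumes lin: "linear_superop \<Phi>" and pos: "positive_map \<Phi>"
begin

lemma positive_map_hermitian:
  assumes A: "A \<in> trace_class" "hermitian_op A"
  shows "hermitian_op (\<Phi> A)"
proof -
  obtain P Q where PQ: "positive_op P" "positive_op Q" "P \<in> trace_class" "Q \<in> trace_class"
    "A = (\<lambda>x. P x - Q x)" by (rule jordan_decomposition[OF A])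
  then have "positive_op (\<Phi> P)" "positive_op (\<Phi> Q)"
    using pos by (simp_all add: positive_map_def)
  then show ?thesis
    unfolding PQ(5) linear_superop_diff[OF lin PQ(3,4)]
    by (intro hermitian_op_diff positive_op_hermitian)
qed

lemma trace_norm_positive_map:
  assumes "trace_preserving \<Phi>" "A \<in> trace_class" "positive_op A"
  shows "trace_norm (\<Phi> A) = trace_norm A"
proof -
  have "positive_op (\<Phi> A)" using pos assms by (simp add: positive_map_def)
  moreover have "op_trace (\<Phi> A) = op_trace A" using assms by (simp add: trace_preserving_def)
  ultimately show ?thesis using assms by (metis op_trace_positive of_real_eq_iff)
qed

lemma positive_trace_preserving_contraction:
  assumes tp: "trace_preserving \<Phi>" and A: "A \<in> trace_class" "hermitian_op A"
  shows "trace_norm (\<Phi> A) \<le> trace_norm A"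
proof -
  obtain P Q where PQ: "positive_op P" "positive_op Q" "P \<in> trace_class" "Q \<in> trace_class"
    "A = (\<lambda>x. P x - Q x)" "trace_norm P + trace_norm Q = trace_norm A"
    by (rule jordan_decomposition[OF A])
  have "trace_norm (\<Phi> A) \<le> trace_norm (\<Phi> P) + trace_norm (\<Phi> Q)"
    unfolding PQ(5) linear_superop_diff[OF lin PQ(3,4)]
    by (intro trace_norm_diff_le linear_superop_trace_class[OF lin] PQ)
  then show ?thesis using PQ trace_norm_positive_map[OF tp] by simp
qed

end

lemma trace_norm_zero: "trace_norm (\<lambda>x::'a::complex_hilbert_space. 0 :: 'a) = 0"
  using trace_norm_scaleC_le[OF trace_class_zero[where 'a = 'a], of 0]
    trace_norm_nonneg[OF trace_class_bclin[OF trace_class_zero[where 'a = 'a]]] by simp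

text \<open>For the Jordan parts the hypothesis says that the sum of the trace norms of
  \<open>P\<close> and \<open>Q\<close> is at most their difference, so
  \<open>Q = 0\<close>.\<close>

lemma positive_op_if_trace_norm_le:
  assumes C: "C \<in> trace_class" "hermitian_op C" and le: "trace_norm C \<le> Re (op_trace C)"
  shows "positive_op C"
proof -
  obtain P Q where PQ: "positive_op P" "positive_op Q" "P \<in> trace_class" "Q \<in> trace_class"
    "C = (\<lambda>x. P x - Q x)" "trace_norm P + trace_norm Q = trace_norm C"
    by (rule jordan_decomposition[OF C])
  have "op_trace C = of_real (trace_norm P - trace_norm Q)"
    unfolding PQ(5) op_trace_diff[OF PQ(3,4)] by (simp add: op_trace_positive PQ)
  then have "trace_norm P + trace_norm Q \<le> trace_norm P - trace_norm Q" using le PQ(6) by simp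
  moreover have "0 \<le> trace_norm Q" by (intro trace_norm_nonneg trace_class_bclin PQ)
  ultimately have "Q = (\<lambda>x. 0)" by (intro trace_norm_eq_0 PQ) simp
  then show ?thesis using PQ by simp
qed

lemma positive_block_1: "positive_block (Suc 0) X \<longleftrightarrow> (\<forall>x. cinner x (X 0 0 x) \<in> \<real>\<^sub>\<ge>\<^sub>0)"
proof -
  have "(\<forall>v::nat \<Rightarrow> 'a. cinner (v 0) (X 0 0 (v 0)) \<in> \<real>\<^sub>\<ge>\<^sub>0) \<longleftrightarrow> (\<forall>x. cinner x (X 0 0 x) \<in> \<real>\<^sub>\<ge>\<^sub>0)"
  proof (intro iffI allI)
    fix x assume "\<forall>v::nat \<Rightarrow> 'a. cinner (v 0) (X 0 0 (v 0)) \<in> \<real>\<^sub>\<ge>\<^sub>0"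
    from this[rule_format, of "\<lambda>_. x"] show "cinner x (X 0 0 x) \<in> \<real>\<^sub>\<ge>\<^sub>0" .
  qed blast
  then show ?thesis by (simp add: positive_block_def)
qed

lemma completely_positive_imp_positive_map:
  assumes lin: "linear_superop \<Phi>" and cp: "completely_positive \<Phi>"
  shows "positive_map \<Phi>"
  unfolding positive_map_def
proof (intro ballI impI)
  fix A :: "'a \<Rightarrow> 'a" assume A: "A \<in> trace_class" "positive_op A"
  have "positive_block (Suc 0) (\<lambda>i j. A)"
    using A(2) by (simp add: positive_block_1 positive_op_def)
  then have "positive_block (Suc 0) (\<lambda>i j. \<Phi> A)"
    using cp[unfolded completely_positive_def, rule_format, of "Suc 0" "\<lambda>i j. A"] A(1) by simp
  then show "positive_op (\<Phi> A)"
    using trace_class_bclin[OF linear_superop_trace_class[OF lin A(1)]]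
    by (simp add: positive_block_1 positive_op_def)
qed

section \<open>Monotonicity from P-divisibility, and the sign of the derivative\<close>

lemma dynamical_mapD:
  assumes "dynamical_map \<Lambda>" "0 \<le> t"
  shows "linear_superop (\<Lambda> t)" "completely_positive (\<Lambda> t)" "trace_preserving (\<Lambda> t)"
    "positive_map (\<Lambda> t)"
  using assms completely_positive_imp_positive_map unfolding dynamical_map_def by blast+

lemma P_divisible_antimono:
  assumes dyn: "dynamical_map \<Lambda>" and div: "P_divisible \<Lambda>"
    and X: "X \<in> trace_class" "hermitian_op X"
  shows "antimono_on {0..} (\<lambda>t. trace_norm (\<Lambda> t X))"
proof (rule monotone_onI)
  fix s t :: real assume st: "s \<in> {0..}" "t \<in> {0..}" "s \<le> t"
  then obtain \<Phi> where \<Phi>: "propagator \<Lambda> t s \<Phi>" "positive_map \<Phi>" "trace_preserving \<Phi>"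
    using div unfolding P_divisible_def by auto
  have s: "linear_superop (\<Lambda> s)" "positive_map (\<Lambda> s)" using st dyn dynamical_mapD by auto
  have "trace_norm (\<Phi> (\<Lambda> s X)) \<le> trace_norm (\<Lambda> s X)"
    using \<Phi> by (intro positive_trace_preserving_contraction positive_map_hermitian[OF s]
        linear_superop_trace_class[OF s(1)] X) (auto simp: propagator_def)
  then show "trace_norm (\<Lambda> t X) \<le> trace_norm (\<Lambda> s X)"
    using \<Phi>(1) X(1) by (simp add: propagator_def)
qed

text \<open>At \<open>t = 0\<close> the given derivative is one-sided. Restriction to
  \<open>{t..}\<close> treats every \<open>t\<close> in this way, and the right difference quotients
  of a nonincreasing function are nonpositive.\<close>

lemma antimono_on_derivative_nonpos:
  fixes f :: "real \<Rightarrow> real"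
  assumes f: "antimono_on {0..} f" and t: "0 \<le> t"
    and D: "(f has_real_derivative D) (at t within {0..})"
  shows "D \<le> 0"
proof -
  have "(f has_real_derivative D) (at t within {t..})"
    by (rule has_field_derivative_subset[OF D]) (use t in auto)
  then have lim: "((\<lambda>y. (f y - f t) / (y - t)) \<longlongrightarrow> D) (at_right t)"
    by (simp add: has_field_derivative_iff at_within_Ici_at_right)
  have "eventually (\<lambda>y. (f y - f t) / (y - t) \<le> 0) (at_right t)"
    using eventually_at_right_less[of t]
  proof eventually_elim
    case (elim y)
    then have "f y \<le> f t" using f t by (auto simp: monotone_on_def)
    then show ?case using elim by (simp add: divide_nonpos_pos)
  qed
  then show ?thesis by (rule tendsto_upperbound[OF lim]) simp
qed

section \<open>Propagators from surjectivity\<close>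

text \<open>The kernel condition is what monotonicity supplies: norm zero at time \<open>s\<close>
  forces norm zero at time \<open>t\<close>. It speaks of Hermitian operators, so a general kernel
  element is first split into real and imaginary part; each lies in the kernel because positive maps
  preserve Hermiticity.\<close>

lemma propagator_exists:
  fixes \<Lambda>s \<Lambda>t :: "'a::complex_hilbert_space superop"
  assumes s: "linear_superop \<Lambda>s" "positive_map \<Lambda>s" "trace_preserving \<Lambda>s"
    and t: "linear_superop \<Lambda>t" "positive_map \<Lambda>t" "trace_preserving \<Lambda>t"
    and surj: "\<Lambda>s ` trace_class = trace_class"
    and ker: "\<And>X. X \<in> trace_class \<Longrightarrow> hermitian_op X \<Longrightarrow> \<Lambda>s X = (\<lambda>x. 0) \<Longrightarrow> \<Lambda>t X = (\<lambda>x. 0)"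
  obtains \<Phi> where "linear_superop \<Phi>" "trace_preserving \<Phi>"
    "\<And>A. A \<in> trace_class \<Longrightarrow> \<Lambda>t A = \<Phi> (\<Lambda>s A)"
proof -
  have ker': "\<Lambda>t X = (\<lambda>x. 0)" if X: "X \<in> trace_class" "\<Lambda>s X = (\<lambda>x. 0)" for X
  proof -
    obtain G H where GH: "hermitian_op G" "hermitian_op H" "G \<in> trace_class" "H \<in> trace_class"
      "X = (\<lambda>x. G x + \<i> *\<^sub>C H x)" by (rule hermitian_decomposition[OF X(1)])
    have "hermitian_op (\<lambda>x::'a. 0)" by (simp add: hermitian_op_iff bounded_clinear_zero)
    moreover have "(\<lambda>x. 0) = (\<lambda>x. \<Lambda>s G x + \<i> *\<^sub>C \<Lambda>s H x)"
      using X(2) by (simp add: GH linear_superop_combination[OF s(1)])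
    ultimately have "\<Lambda>s H = (\<lambda>x. 0)" "(\<lambda>x. 0) = \<Lambda>s G"
      using hermitian_op_imaginary_part_zero[OF positive_map_hermitian[OF s(1,2) GH(3,1)]
          positive_map_hermitian[OF s(1,2) GH(4,2)]] by blast+
    then have "\<Lambda>t G = (\<lambda>x. 0)" "\<Lambda>t H = (\<lambda>x. 0)" using ker GH by metis+
    then show ?thesis by (simp add: GH linear_superop_combination[OF t(1)])
  qed
  have eq: "\<Lambda>t X = \<Lambda>t Y" if X: "X \<in> trace_class" and Y: "Y \<in> trace_class" and XY: "\<Lambda>s X = \<Lambda>s Y" for X Y
  proof -
    have "\<Lambda>t (\<lambda>x. X x - Y x) = (\<lambda>x. 0)"
      using X Y XY by (intro ker' trace_class_diff) (simp_all add: linear_superop_diff[OF s(1)])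
    then show ?thesis
      unfolding linear_superop_diff[OF t(1) X Y] by (simp add: fun_eq_iff)
  qed
  \<comment> \<open>A merely set-theoretic right inverse of \<open>\<Lambda>s\<close>. Linearity of
    \<open>\<Phi>\<close> comes from \<open>eq\<close>, which makes the value independent of the
    chosen preimage.\<close>
  define R where "R A = (SOME X. X \<in> trace_class \<and> \<Lambda>s X = A)" for A
  have R: "R A \<in> trace_class" "\<Lambda>s (R A) = A" if "A \<in> trace_class" for A
  proof -
    have "\<exists>X. X \<in> trace_class \<and> \<Lambda>s X = A" using that surj by (metis (no_types) image_iff)
    from someI_ex[OF this] show "R A \<in> trace_class" "\<Lambda>s (R A) = A" unfolding R_def by blast+
  qed
  define \<Phi> where "\<Phi> A = \<Lambda>t (R A)" for A
  have propag: "\<Lambda>t A = \<Phi> (\<Lambda>s A)" if A: "A \<in> trace_class" for A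
    unfolding \<Phi>_def using R[OF linear_superop_trace_class[OF s(1) A]] by (intro eq A) auto
  have \<Phi>I: "\<Phi> A = \<Lambda>t X" if "X \<in> trace_class" "\<Lambda>s X = A" for A X
    using propag that by metis
  have "linear_superop \<Phi>"
    unfolding linear_superop_def
  proof (intro conjI ballI allI)
    fix A :: "'a \<Rightarrow> 'a" assume A: "A \<in> trace_class"
    show "\<Phi> A \<in> trace_class" unfolding \<Phi>_def by (intro linear_superop_trace_class[OF t(1)] R A)
    show "\<Phi> (\<lambda>x. c *\<^sub>C A x) = (\<lambda>x. c *\<^sub>C \<Phi> A x)" for c
      by (subst \<Phi>I[where X = "\<lambda>x. c *\<^sub>C R A x"])
        (simp_all add: trace_class_scaleC R A linear_superop_scaleC s(1) t(1) \<Phi>_def)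
    fix B :: "'a \<Rightarrow> 'a" assume B: "B \<in> trace_class"
    show "\<Phi> (\<lambda>x. A x + B x) = (\<lambda>x. \<Phi> A x + \<Phi> B x)"
      by (subst \<Phi>I[where X = "\<lambda>x. R A x + R B x"])
        (simp_all add: trace_class_add R A B linear_superop_add s(1) t(1) \<Phi>_def)
  qed
  moreover have "trace_preserving \<Phi>"
    unfolding trace_preserving_def
  proof
    fix A :: "'a \<Rightarrow> 'a" assume A: "A \<in> trace_class"
    have "op_trace (\<Phi> A) = op_trace (R A)"
      using t(3) R(1)[OF A] by (simp add: \<Phi>_def trace_preserving_def)
    also have "\<dots> = op_trace (\<Lambda>s (R A))" using s(3) R(1)[OF A] by (simp add: trace_preserving_def)
    finally show "op_trace (\<Phi> A) = op_trace A" using R(2)[OF A] by simp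
  qed
  ultimately show ?thesis using that propag by blast
qed

text \<open>The real part of any preimage works: the image of the imaginary part must vanish when
  \<open>\<Phi> X\<close> is Hermitian.\<close>

lemma hermitian_preimage:
  assumes s: "linear_superop \<Phi>" "positive_map \<Phi>"
    and X: "X \<in> trace_class" "hermitian_op (\<Phi> X)"
  obtains G where "G \<in> trace_class" "hermitian_op G" "\<Phi> G = \<Phi> X"
proof -
  obtain G H where GH: "hermitian_op G" "hermitian_op H" "G \<in> trace_class" "H \<in> trace_class"
    "X = (\<lambda>x. G x + \<i> *\<^sub>C H x)" by (rule hermitian_decomposition[OF X(1)])
  have "\<Phi> X = (\<lambda>x. \<Phi> G x + \<i> *\<^sub>C \<Phi> H x)"
    by (simp add: GH linear_superop_combination[OF s(1)])
  from hermitian_op_imaginary_part_zero(2)[OF positive_map_hermitian[OF s GH(3,1)]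
      positive_map_hermitian[OF s GH(4,2)] X(2) this]
  show ?thesis using that GH by simp
qed

lemma antimono_imp_P_divisible:
  assumes dyn: "dynamical_map \<Lambda>" and surj: "\<forall>t\<ge>0. \<Lambda> t ` trace_class = trace_class"
    and anti: "\<And>X. X \<in> trace_class \<Longrightarrow> hermitian_op X \<Longrightarrow>
      antimono_on {0..} (\<lambda>t. trace_norm (\<Lambda> t X))"
  shows "P_divisible \<Lambda>"
  unfolding P_divisible_def
proof (intro allI impI)
  fix s t :: real assume st: "0 \<le> s \<and> s \<le> t"
  then have s: "0 \<le> s" and t: "0 \<le> t" by auto
  note Ls = dynamical_mapD[OF dyn s] and Lt = dynamical_mapD[OF dyn t]
  have le: "trace_norm (\<Lambda> t X) \<le> trace_norm (\<Lambda> s X)" if "X \<in> trace_class" "hermitian_op X" for X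
    using anti[OF that] st by (auto simp: monotone_on_def)
  have surj_s: "\<Lambda> s ` trace_class = trace_class" using surj s by blast
  obtain \<Phi> where \<Phi>: "linear_superop \<Phi>" "trace_preserving \<Phi>"
    "\<And>A. A \<in> trace_class \<Longrightarrow> \<Lambda> t A = \<Phi> (\<Lambda> s A)"
  proof (rule propagator_exists[OF Ls(1,4,3) Lt(1,4,3) surj_s])
    fix X assume X: "X \<in> trace_class" "hermitian_op X" "\<Lambda> s X = (\<lambda>x. 0)"
    have XT: "\<Lambda> t X \<in> trace_class" by (rule linear_superop_trace_class[OF Lt(1) X(1)])
    show "\<Lambda> t X = (\<lambda>x. 0)"
      using le[OF X(1,2)] trace_norm_nonneg[OF trace_class_bclin[OF XT]] X(3) trace_norm_zero[where 'a = 'a]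
      by (intro trace_norm_eq_0 XT) simp
  qed blast
  have "positive_map \<Phi>"
    unfolding positive_map_def
  proof (intro ballI impI)
    fix A :: "'a \<Rightarrow> 'a" assume A: "A \<in> trace_class" "positive_op A"
    obtain X where X: "X \<in> trace_class" "\<Lambda> s X = A"
      using A(1) surj_s by (metis (no_types) image_iff)
    \<comment> \<open>The inequality \<open>le\<close> concerns Hermitian operators only, hence a
      Hermitian preimage.\<close>
    obtain G where G: "G \<in> trace_class" "hermitian_op G" "\<Lambda> s G = A"
      using hermitian_preimage[OF Ls(1,4) X(1)] positive_op_hermitian[OF A(2)] X(2) by metis
    have \<Phi>A: "\<Phi> A = \<Lambda> t G" using \<Phi>(3)[OF G(1)] G(3) by simp
    show "positive_op (\<Phi> A)"
    proof (rule positive_op_if_trace_norm_le)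
      show "\<Phi> A \<in> trace_class" by (rule linear_superop_trace_class[OF \<Phi>(1) A(1)])
      show "hermitian_op (\<Phi> A)" unfolding \<Phi>A by (rule positive_map_hermitian[OF Lt(1,4) G(1,2)])
      have "Re (op_trace (\<Phi> A)) = trace_norm A"
        using \<Phi>(2) A by (simp add: trace_preserving_def op_trace_positive)
      then show "trace_norm (\<Phi> A) \<le> Re (op_trace (\<Phi> A))"
        using le[OF G(1,2)] by (simp add: \<Phi>A G(3))
    qed
  qed
  then show "\<exists>\<Phi>. propagator \<Lambda> t s \<Phi> \<and> positive_map \<Phi> \<and> trace_preserving \<Phi>"
    using \<Phi> unfolding propagator_def by blast
qed


section \<open>Slices and blocks\<close>

text \<open>Passing to adjoints avoids expanding a vector: \<open>adj A y\<close> and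
  \<open>adj B y\<close> have the same coefficients in \<open>onb\<close>.\<close>

lemma bounded_clinear_eq_onb:
  assumes A: "bounded_clinear A" and B: "bounded_clinear B" and eq: "\<And>e. e \<in> onb \<Longrightarrow> A e = B e"
  shows "A = B"
proof -
  have "adj A y - adj B y = 0" for y
    by (rule onb_total) (simp add: cinner_diff_right cinner_adj_right A B eq)
  then have "adj A = adj B" by (simp add: fun_eq_iff)
  then show ?thesis by (metis A B adj_adj)
qed

lemma tcoeffs_tensor_vec:
  "e \<in> onb \<Longrightarrow> f \<in> onb \<Longrightarrow> tcoeffs (x \<otimes>\<^sub>v y) (e, f) = cinner e x * cinner f y"
  by (simp add: tensor_vec.rep_eq)

lemma tensor_eqI:
  fixes s t :: "('a::complex_hilbert_space, 'b::complex_hilbert_space) tensor"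
  assumes "\<And>e f. e \<in> onb \<Longrightarrow> f \<in> onb \<Longrightarrow> tcoeffs s (e, f) = tcoeffs t (e, f)"
  shows "s = t"
proof -
  have "tcoeffs s p = tcoeffs t p" for p
    by (cases "p \<in> onb \<times> onb") (auto simp: assms tcoeffs_outside)
  then show ?thesis by (simp add: tcoeffs_inject[symmetric] fun_eq_iff)
qed

lemma tensor_vec_add_left: "(x + x') \<otimes>\<^sub>v y = x \<otimes>\<^sub>v y + x' \<otimes>\<^sub>v y"
  by (rule tensor_eqI) (simp add: tcoeffs_tensor_vec plus_tensor.rep_eq cinner_simps algebra_simps)

lemma tensor_vec_add_right: "x \<otimes>\<^sub>v (y + y') = x \<otimes>\<^sub>v y + x \<otimes>\<^sub>v y'"
  by (rule tensor_eqI) (simp add: tcoeffs_tensor_vec plus_tensor.rep_eq cinner_simps algebra_simps)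

lemma tensor_vec_scaleC_left: "(c *\<^sub>C x) \<otimes>\<^sub>v y = c *\<^sub>C (x \<otimes>\<^sub>v y)"
  by (rule tensor_eqI) (simp add: tcoeffs_tensor_vec scaleC_tensor.rep_eq cinner_simps)

lemma tensor_vec_scaleC_right: "x \<otimes>\<^sub>v (c *\<^sub>C y) = c *\<^sub>C (x \<otimes>\<^sub>v y)"
  by (rule tensor_eqI) (simp add: tcoeffs_tensor_vec scaleC_tensor.rep_eq cinner_simps)

lemma norm_tensor_vec: "norm (x \<otimes>\<^sub>v y) = norm x * norm y"
proof -
  have "complex_of_real ((norm (x \<otimes>\<^sub>v y))\<^sup>2) = of_real ((norm x * norm y)\<^sup>2)"
    unfolding cinner_self[symmetric] cinner_tensor_vec
    by (simp add: cinner_self power_mult_distrib)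
  then have "(norm (x \<otimes>\<^sub>v y))\<^sup>2 = (norm x * norm y)\<^sup>2" using of_real_eq_iff by blast
  then show ?thesis by (simp add: power2_eq_iff_nonneg)
qed

lemma bounded_clinear_tensor_vec_right: "bounded_clinear (\<lambda>y. x \<otimes>\<^sub>v y)"
  by (rule bounded_clinearI[where K = "norm x"])
    (simp_all add: tensor_vec_add_right tensor_vec_scaleC_right norm_tensor_vec)

lemma bounded_clinear_tensor_vec_left: "bounded_clinear (\<lambda>x. x \<otimes>\<^sub>v y)"
  by (rule bounded_clinearI[where K = "norm y"])
    (simp_all add: tensor_vec_add_left tensor_vec_scaleC_left norm_tensor_vec)

lemma cinner_tensor_onb:
  fixes t :: "('a::complex_hilbert_space, 'b::complex_hilbert_space) tensor"
  assumes "e \<in> onb" "f \<in> onb"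
  shows "cinner (e \<otimes>\<^sub>v f) t = tcoeffs t (e, f)"
proof -
  have "((\<lambda>p. cnj (tcoeffs (e \<otimes>\<^sub>v f) p) * tcoeffs t p) has_sum tcoeffs t (e, f)) (onb \<times> onb)"
  proof (rule has_sum_finite_neutralI[where B = "{(e, f)}"])
    fix p :: "'a \<times> 'b" assume "p \<in> onb \<times> onb - {(e, f)}"
    then show "cnj (tcoeffs (e \<otimes>\<^sub>v f) p) * tcoeffs t p = 0"
      using assms by (cases p) (auto simp: tcoeffs_tensor_vec cinner_onb)
  qed (use assms in \<open>auto simp: tcoeffs_tensor_vec cinner_onb\<close>)
  then show ?thesis unfolding cinner_tensor_def by (rule infsumI)
qed

text \<open>The partial inner product with \<open>x\<close> in the first factor,
  \<open><x| \<otimes> id\<close>. Taking it as an adjoint gives boundedness at once.\<close>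

definition slice ::
  "'a::complex_hilbert_space \<Rightarrow> ('a, 'b::complex_hilbert_space) tensor \<Rightarrow> 'b" where
  "slice x = adj (\<lambda>y. x \<otimes>\<^sub>v y)"

lemma cinner_slice: "cinner y (slice x t) = cinner (x \<otimes>\<^sub>v y) t"
  and cinner_slice_left: "cinner (slice x t) y = cinner t (x \<otimes>\<^sub>v y)"
  unfolding slice_def
  by (simp_all add: cinner_adj_right cinner_adj bounded_clinear_tensor_vec_right)

lemma bounded_clinear_slice: "bounded_clinear (slice x)"
  unfolding slice_def by (rule bounded_clinear_adj[OF bounded_clinear_tensor_vec_right])

lemma slice_tensor_vec: "slice x (x' \<otimes>\<^sub>v y) = cinner x x' *\<^sub>C y"
  by (rule cinner_eqI) (simp add: cinner_slice cinner_tensor_vec cinner_simps)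

lemma parseval_family_tensor:
  "parseval_family (\<lambda>(e, f). e \<otimes>\<^sub>v f) (onb \<times> onb)"
  unfolding parseval_family_def
proof
  fix t :: "('a, 'b) tensor"
  have "((\<lambda>p. (cmod (tcoeffs t p))\<^sup>2) has_sum (norm t)\<^sup>2) (onb \<times> onb)"
    by (rule norm_tensor_sq_has_sum)
  also have "?this \<longleftrightarrow>
      ((\<lambda>p. (cmod (cinner (case p of (e, f) \<Rightarrow> e \<otimes>\<^sub>v f) t))\<^sup>2) has_sum (norm t)\<^sup>2) (onb \<times> onb)"
    by (intro has_sum_cong) (auto simp: cinner_tensor_onb)
  finally show "((\<lambda>p. (cmod (cinner (case p of (e, f) \<Rightarrow> e \<otimes>\<^sub>v f) t))\<^sup>2) has_sum (norm t)\<^sup>2)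
    (onb \<times> onb)" .
qed

lemma norm_slice_has_sum: "((\<lambda>e. (norm (slice e t))\<^sup>2) has_sum (norm t)\<^sup>2) onb"
proof (rule has_sum_SigmaD)
  show "((\<lambda>p. (cmod (tcoeffs t p))\<^sup>2) has_sum (norm t)\<^sup>2) (onb \<times> onb)"
    by (rule norm_tensor_sq_has_sum)
  fix e :: 'a assume e: "e \<in> onb"
  have "((\<lambda>f. (cmod (cinner f (slice e t)))\<^sup>2) has_sum (norm (slice e t))\<^sup>2) onb"
    using parseval_family_onb unfolding parseval_family_def by blast
  also have "?this \<longleftrightarrow> ((\<lambda>f. (cmod (tcoeffs t (e, f)))\<^sup>2) has_sum (norm (slice e t))\<^sup>2) onb"
    by (intro has_sum_cong) (simp add: cinner_slice cinner_tensor_onb e)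
  finally show "((\<lambda>f. (cmod (tcoeffs t (e, f)))\<^sup>2) has_sum (norm (slice e t))\<^sup>2) onb" .
qed

lemma slice_eqI:
  fixes s t :: "('a::complex_hilbert_space, 'b::complex_hilbert_space) tensor"
  assumes "\<And>e. e \<in> onb \<Longrightarrow> slice e s = slice e t"
  shows "s = t"
proof (rule tensor_eqI)
  fix e :: 'a and f :: 'b
  assume "e \<in> onb" "f \<in> onb"
  then show "tcoeffs s (e, f) = tcoeffs t (e, f)"
    using assms[of e] by (metis cinner_slice cinner_tensor_onb)
qed

text \<open>The tensor product is the square summable direct sum of copies of its second factor, one
  for each \<open>e \<in> onb\<close>; the family \<open>g\<close> lists the components.\<close>

lemma tensor_of_slices:
  fixes g :: "'a::complex_hilbert_space \<Rightarrow> 'b::complex_hilbert_space"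
  assumes le: "\<And>F. finite F \<Longrightarrow> F \<subseteq> onb \<Longrightarrow> (\<Sum>e\<in>F. (norm (g e))\<^sup>2) \<le> M\<^sup>2" and "0 \<le> M"
  obtains w :: "('a, 'b) tensor" where "\<And>e. e \<in> onb \<Longrightarrow> slice e w = g e" "norm w \<le> M"
proof -
  define c where "c = (\<lambda>(e, f). if e \<in> onb \<and> f \<in> onb then cinner f (g e) else 0)"
  have "(\<lambda>e. (norm (g e))\<^sup>2) summable_on onb"
    by (rule nonneg_bounded_partial_sums_imp_summable_on[where C = "M\<^sup>2"])
      (auto intro!: eventually_finite_subsets_at_top_weakI le)
  then have "(\<lambda>p. (cmod (cinner (snd p) (g (fst p))))\<^sup>2) summable_on onb \<times> onb"
    by (intro summable_on_SigmaI[where g = "\<lambda>e. (norm (g e))\<^sup>2"])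
      (use parseval_family_onb in \<open>auto simp: parseval_family_def\<close>)
  also have "?this \<longleftrightarrow> (\<lambda>p. (cmod (c p))\<^sup>2) summable_on onb \<times> onb"
    by (intro summable_on_cong) (auto simp: c_def)
  finally have "c \<in> l2_coeffs" by (auto simp: l2_coeffs_def c_def)
  then have w: "tcoeffs (Abs_tensor c) = c" by (rule Abs_tensor_inverse)
  have sl: "slice e (Abs_tensor c) = g e" if e: "e \<in> onb" for e
  proof -
    have "slice e (Abs_tensor c) - g e = 0"
    proof (rule onb_total)
      fix f :: 'b assume "f \<in> onb"
      then show "cinner f (slice e (Abs_tensor c) - g e) = 0"
        using e by (simp add: cinner_diff_right cinner_slice cinner_tensor_onb w) (simp add: c_def)
    qed
    then show ?thesis by simp
  qed
  have "(norm (Abs_tensor c))\<^sup>2 \<le> M\<^sup>2"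
  proof (rule has_sum_le_finite_sums[OF norm_slice_has_sum])
    fix F :: "'a set" assume F: "finite F" "F \<subseteq> onb"
    then have "(\<Sum>e\<in>F. (norm (slice e (Abs_tensor c)))\<^sup>2) = (\<Sum>e\<in>F. (norm (g e))\<^sup>2)"
      by (intro sum.cong) (auto simp: sl)
    then show "(\<Sum>e\<in>F. (norm (slice e (Abs_tensor c)))\<^sup>2) \<le> M\<^sup>2" using le[OF F] by simp
  qed
  then have "norm (Abs_tensor c) \<le> M" by (rule power2_le_imp_le) fact
  with sl show ?thesis using that by blast
qed

text \<open>The matrix entry \<open>(<e| \<otimes> id) Y (|f> \<otimes> id)\<close> when the tensor
  product is read as a direct sum over a basis of the first factor.\<close>

definition block ::
  "(('a::complex_hilbert_space, 'b::complex_hilbert_space) tensor \<Rightarrow> ('a, 'b) tensor) \<Rightarrow>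
     'a \<Rightarrow> 'a \<Rightarrow> 'b \<Rightarrow> 'b" where
  "block Y e f = (\<lambda>b. slice e (Y (f \<otimes>\<^sub>v b)))"

lemma cinner_block: "cinner a (block Y e f b) = cinner (e \<otimes>\<^sub>v a) (Y (f \<otimes>\<^sub>v b))"
  by (simp add: block_def cinner_slice)

lemma block_trace_class: "Y \<in> trace_class \<Longrightarrow> block Y e f \<in> trace_class"
  unfolding block_def
  by (rule trace_class_ideal[OF _ bounded_clinear_slice bounded_clinear_tensor_vec_right])

lemma block_add: "block (\<lambda>t. Y t + Z t) e f = (\<lambda>b. block Y e f b + block Z e f b)"
  and block_scaleC: "block (\<lambda>t. c *\<^sub>C Y t) e f = (\<lambda>b. c *\<^sub>C block Y e f b)"
  by (simp_all add: block_def bclin_simps[OF bounded_clinear_slice])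

lemma positive_op_block:
  assumes "positive_op Y"
  shows "positive_op (block Y e e)"
proof -
  have "bounded_clinear (block Y e e)"
    unfolding block_def
    by (rule bounded_clinear_comp[OF bounded_clinear_slice
          bounded_clinear_comp[OF positive_op_bclin[OF assms] bounded_clinear_tensor_vec_right]])
  then show ?thesis using assms by (simp add: positive_op_def cinner_block)
qed

text \<open>Equal blocks give equal values on \<open>f \<otimes>\<^sub>v b\<close>. The adjoints
  then have equal slices, and the slices at basis vectors determine a vector.\<close>

lemma block_eqI:
  assumes Y: "bounded_clinear Y" and Z: "bounded_clinear Z"
    and eq: "\<And>e f. e \<in> onb \<Longrightarrow> f \<in> onb \<Longrightarrow> block Y e f = block Z e f"
  shows "Y = Z"
proof -
  have YZ: "Y (f \<otimes>\<^sub>v b) = Z (f \<otimes>\<^sub>v b)" if f: "f \<in> onb" for f b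
    using fun_cong[OF eq[OF _ f], of _ b] by (intro slice_eqI) (simp add: block_def)
  have "slice f (adj Y t) = slice f (adj Z t)" if "f \<in> onb" for f t
    by (rule cinner_eqI_left) (simp add: cinner_slice_left cinner_adj Y Z YZ that)
  then have "adj Y t = adj Z t" for t by (rule slice_eqI)
  then show ?thesis by (metis adj_adj Y Z ext)
qed

text \<open>Summing the diagonal in the product basis over the second index first yields the traces
  of the diagonal blocks.\<close>

lemma trace_norm_block_has_sum:
  assumes Y: "positive_op Y" "Y \<in> trace_class"
  shows "((\<lambda>e. trace_norm (block Y e e)) has_sum trace_norm Y) onb"
proof (rule has_sum_SigmaD)
  show "((\<lambda>p. Re (cinner (case p of (e, f) \<Rightarrow> e \<otimes>\<^sub>v f) (Y (case p of (e, f) \<Rightarrow> e \<otimes>\<^sub>v f))))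
      has_sum trace_norm Y) (onb \<times> onb)"
    by (rule positive_op_trace_has_sum[OF Y(1) parseval_family_tensor Y(2)])
  fix e :: 'a assume "e \<in> onb"
  show "((\<lambda>f. Re (cinner (case (e, f) of (e, f) \<Rightarrow> e \<otimes>\<^sub>v f) (Y (case (e, f) of (e, f) \<Rightarrow> e \<otimes>\<^sub>v f))))
      has_sum trace_norm (block Y e e)) onb"
    using positive_op_trace_has_sum[OF positive_op_block[OF Y(1)] parseval_family_onb
        block_trace_class[OF Y(2)]]
    by (simp add: cinner_block)
qed

lemma trace_class_if_blocks_summable:
  assumes Y: "positive_op Y" and tc: "\<And>e. e \<in> onb \<Longrightarrow> block Y e e \<in> trace_class"
    and s: "(\<lambda>e. trace_norm (block Y e e)) summable_on onb"
  shows "Y \<in> trace_class"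
proof (rule positive_trace_class_iff[OF Y parseval_family_tensor, THEN iffD2],
    rule summable_on_SigmaI[OF _ s])
  fix e :: 'a assume "e \<in> onb"
  show "((\<lambda>f. Re (cinner (case (e, f) of (e, f) \<Rightarrow> e \<otimes>\<^sub>v f) (Y (case (e, f) of (e, f) \<Rightarrow> e \<otimes>\<^sub>v f))))
      has_sum trace_norm (block Y e e)) onb"
    using positive_op_trace_has_sum[OF positive_op_block[OF Y] parseval_family_onb
        tc[OF \<open>e \<in> onb\<close>]]
    by (simp add: cinner_block)
qed (rule positive_op_Re[OF Y])

text \<open>A matrix of operators whose finite sections are uniformly bounded defines an operator.
  The columns \<open>W f\<close> are assembled from their slices. An infinite sum of columns is
  avoided: their adjoints are assembled into \<open>Z\<close>, and the operator is
  \<open>adj Z\<close>.\<close>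

lemma block_operator_exists:
  fixes L :: "'a::complex_hilbert_space \<Rightarrow> 'a \<Rightarrow> 'b::complex_hilbert_space \<Rightarrow> 'b"
  assumes L: "\<And>e f. e \<in> onb \<Longrightarrow> f \<in> onb \<Longrightarrow> bounded_clinear (L e f)" and K: "0 \<le> K"
    and bound: "\<And>F u v. finite F \<Longrightarrow> F \<subseteq> onb \<Longrightarrow>
      cmod (\<Sum>e\<in>F. \<Sum>f\<in>F. cinner (u e) (L e f (v f))) \<le>
        K * L2_set (\<lambda>e. norm (u e)) F * L2_set (\<lambda>f. norm (v f)) F"
  obtains C :: "('a, 'b) tensor \<Rightarrow> ('a, 'b) tensor" where "bounded_clinear C"
    "\<And>e f. e \<in> onb \<Longrightarrow> f \<in> onb \<Longrightarrow> block C e f = L e f"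
proof -
  have col: "\<exists>w::('a, 'b) tensor. (\<forall>e\<in>onb. slice e w = (\<Sum>f\<in>F. L e f (v f))) \<and>
      norm w \<le> K * L2_set (\<lambda>f. norm (v f)) F" if F: "finite F" "F \<subseteq> onb" for F v
  proof -
    define g where "g e = (\<Sum>f\<in>F. L e f (v f))" for e
    have "(\<Sum>e\<in>G. (norm (g e))\<^sup>2) \<le> (K * L2_set (\<lambda>f. norm (v f)) F)\<^sup>2"
      if G: "finite G" "G \<subseteq> onb" for G
    proof -
      \<comment> \<open>\<open>bound\<close> takes one index set for rows and columns, so both
        families are extended by zero to the union. Testing it against the truncated column itself
        bounds \<open>S\<^sup>2\<close> by a multiple of \<open>S\<close>, from which
        \<open>S\<close> cancels.\<close>
      define H where "H = F \<union> G"
      define u where "u e = (if e \<in> G then g e else 0)" for e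
      define v' where "v' f = (if f \<in> F then v f else 0)" for f
      define S where "S = L2_set (\<lambda>e. norm (g e)) G"
      have H: "finite H" "H \<subseteq> onb" using F G by (auto simp: H_def)
      have "(\<Sum>e\<in>H. \<Sum>f\<in>H. cinner (u e) (L e f (v' f))) = (\<Sum>e\<in>G. \<Sum>f\<in>H. cinner (u e) (L e f (v' f)))"
        using H by (intro sum.mono_neutral_right) (auto simp: H_def u_def)
      also have "\<dots> = (\<Sum>e\<in>G. \<Sum>f\<in>F. cinner (u e) (L e f (v' f)))"
        using H G by (intro sum.cong sum.mono_neutral_right)
          (auto simp: H_def v'_def bclin_zero[OF L] subset_iff)
      also have "\<dots> = (\<Sum>e\<in>G. of_real ((norm (g e))\<^sup>2))"
        by (intro sum.cong) (simp_all add: u_def v'_def g_def cinner_self flip: cinner_sum_right)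
      also have "\<dots> = of_real (S\<^sup>2)"
        by (simp add: S_def L2_set_def sum_nonneg)
      finally have "S\<^sup>2 = cmod (\<Sum>e\<in>H. \<Sum>f\<in>H. cinner (u e) (L e f (v' f)))"
        by (simp add: norm_power)
      also have "\<dots> \<le> K * L2_set (\<lambda>e. norm (u e)) H * L2_set (\<lambda>f. norm (v' f)) H"
        by (rule bound[OF H])
      also have "L2_set (\<lambda>e. norm (u e)) H = S"
        unfolding L2_set_def S_def using H
        by (intro arg_cong[of _ _ sqrt] sum.mono_neutral_cong_right) (auto simp: H_def u_def)
      also have "L2_set (\<lambda>f. norm (v' f)) H = L2_set (\<lambda>f. norm (v f)) F"
        unfolding L2_set_def using H
        by (intro arg_cong[of _ _ sqrt] sum.mono_neutral_cong_right) (auto simp: H_def v'_def)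
      finally have "S * S \<le> S * (K * L2_set (\<lambda>f. norm (v f)) F)"
        by (simp add: power2_eq_square mult_ac)
      moreover have "0 \<le> S" "0 \<le> K * L2_set (\<lambda>f. norm (v f)) F" using K by (simp_all add: S_def)
      ultimately have "S \<le> K * L2_set (\<lambda>f. norm (v f)) F"
        by (cases "S = 0") auto
      then have "S\<^sup>2 \<le> (K * L2_set (\<lambda>f. norm (v f)) F)\<^sup>2" using \<open>0 \<le> S\<close> by (rule power_mono)
      moreover have "S\<^sup>2 = (\<Sum>e\<in>G. (norm (g e))\<^sup>2)" by (simp add: S_def L2_set_def sum_nonneg)
      ultimately show ?thesis by simp
    qed
    moreover have "0 \<le> K * L2_set (\<lambda>f. norm (v f)) F" using K by simp
    ultimately obtain w :: "('a, 'b) tensor" where "\<And>e. e \<in> onb \<Longrightarrow> slice e w = g e"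
      "norm w \<le> K * L2_set (\<lambda>f. norm (v f)) F"
      by (rule tensor_of_slices) blast+
    then show ?thesis unfolding g_def by blast
  qed
  have "\<exists>w::('a, 'b) tensor. (\<forall>e\<in>onb. slice e w = L e f b) \<and> norm w \<le> K * norm b"
    if "f \<in> onb" for f b
    using col[of "{f}" "\<lambda>_. b"] that by simp
  then obtain W :: "'a \<Rightarrow> 'b \<Rightarrow> ('a, 'b) tensor" where
    W: "\<And>e f b. f \<in> onb \<Longrightarrow> e \<in> onb \<Longrightarrow> slice e (W f b) = L e f b"
      "\<And>f b. f \<in> onb \<Longrightarrow> norm (W f b) \<le> K * norm b" by metis
  have bW: "bounded_clinear (W f)" if f: "f \<in> onb" for f
    using W(2)[OF f]
    by (intro bounded_clinearI[where K = K] slice_eqI)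
      (simp_all add: W f bclin_simps[OF bounded_clinear_slice] bclin_simps[OF L])
  have sumW: "norm (\<Sum>f\<in>F. W f (v f)) \<le> K * L2_set (\<lambda>f. norm (v f)) F"
    if F: "finite F" "F \<subseteq> onb" for F v
  proof -
    obtain w :: "('a, 'b) tensor" where w: "\<forall>e\<in>onb. slice e w = (\<Sum>f\<in>F. L e f (v f))"
      "norm w \<le> K * L2_set (\<lambda>f. norm (v f)) F" using col[OF F] by blast
    have "slice e (\<Sum>f\<in>F. W f (v f)) = slice e w" if "e \<in> onb" for e
      using w(1) that F(2) by (simp add: bclin_sum[OF bounded_clinear_slice])
        (intro sum.cong, auto simp: W)
    then have "(\<Sum>f\<in>F. W f (v f)) = w" by (rule slice_eqI)
    with w(2) show ?thesis by simp
  qed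
  \<comment> \<open>The vector with slices \<open>adj (W f) s\<close> exists by the same
    self-testing argument, now with \<open>v f = adj (W f) s\<close> in \<open>sumW\<close>.\<close>
  have "\<exists>z::('a, 'b) tensor. (\<forall>f\<in>onb. slice f z = adj (W f) s) \<and> norm z \<le> K * norm s" for s
  proof -
    have "(\<Sum>f\<in>F. (norm (adj (W f) s))\<^sup>2) \<le> (K * norm s)\<^sup>2" if F: "finite F" "F \<subseteq> onb" for F
    proof -
      define S where "S = L2_set (\<lambda>f. norm (adj (W f) s)) F"
      have S2: "S\<^sup>2 = (\<Sum>f\<in>F. (norm (adj (W f) s))\<^sup>2)" by (simp add: S_def L2_set_def sum_nonneg)
      have "of_real (S\<^sup>2) = (\<Sum>f\<in>F. cinner (adj (W f) s) (adj (W f) s))"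
        by (simp add: S2 cinner_self)
      also have "\<dots> = (\<Sum>f\<in>F. cinner s (W f (adj (W f) s)))"
        using F(2) by (intro sum.cong) (auto simp: cinner_adj[OF bW])
      also have "\<dots> = cinner s (\<Sum>f\<in>F. W f (adj (W f) s))" by (simp add: cinner_sum_right)
      finally have "S\<^sup>2 = cmod (cinner s (\<Sum>f\<in>F. W f (adj (W f) s)))"
        by (metis norm_of_real abs_of_nonneg zero_le_power2)
      also have "\<dots> \<le> norm s * (K * S)"
        using order_trans[OF cmod_cinner_le mult_left_mono[OF sumW[OF F]]] by (simp add: S_def)
      finally have "S * S \<le> S * (K * norm s)" by (simp add: power2_eq_square mult_ac)
      moreover have "0 \<le> S" "0 \<le> K * norm s" using K by (simp_all add: S_def)
      ultimately have "S \<le> K * norm s" by (cases "S = 0") auto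
      then have "S\<^sup>2 \<le> (K * norm s)\<^sup>2" using \<open>0 \<le> S\<close> by (rule power_mono)
      then show ?thesis by (simp add: S2)
    qed
    moreover have "0 \<le> K * norm s" using K by simp
    ultimately show ?thesis by (rule tensor_of_slices) blast+
  qed
  then obtain Z :: "('a, 'b) tensor \<Rightarrow> ('a, 'b) tensor" where
    Z: "\<And>f s. f \<in> onb \<Longrightarrow> slice f (Z s) = adj (W f) s" "\<And>s. norm (Z s) \<le> K * norm s"
    by metis
  have bZ: "bounded_clinear Z"
    using Z(2)
    by (intro bounded_clinearI[where K = K] slice_eqI)
      (simp_all add: Z bclin_simps[OF bounded_clinear_slice]
        bclin_simps[OF bounded_clinear_adj[OF bW]])
  show ?thesis
  proof
    show "bounded_clinear (adj Z)" by (rule bounded_clinear_adj[OF bZ])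
    fix e f :: 'a assume ef: "e \<in> onb" "f \<in> onb"
    show "block (adj Z) e f = L e f"
    proof (intro ext cinner_eqI)
      fix a b
      have "cinner a (block (adj Z) e f b) = cinner (slice f (Z (e \<otimes>\<^sub>v a))) b"
        by (simp add: cinner_block cinner_adj_right[OF bZ] cinner_slice_left)
      also have "\<dots> = cinner (e \<otimes>\<^sub>v a) (W f b)" by (simp add: Z ef cinner_adj[OF bW])
      also have "\<dots> = cinner a (L e f b)" by (simp add: W ef flip: cinner_slice)
      finally show "cinner a (block (adj Z) e f b) = cinner a (L e f b)" .
    qed
  qed
qed

section \<open>Tensor products of operators\<close>

lemma tensor_op_eqI:
  assumes C: "bounded_clinear C" "\<And>x y. C (x \<otimes>\<^sub>v y) = A x \<otimes>\<^sub>v B y"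
  shows "tensor_op A B = C"
  unfolding tensor_op_def
proof (rule the_equality)
  fix D assume D: "bounded_clinear D \<and> (\<forall>x y. D (x \<otimes>\<^sub>v y) = A x \<otimes>\<^sub>v B y)"
  show "D = C" by (rule block_eqI) (use C D in \<open>simp_all add: block_def\<close>)
qed (use C in simp)

lemma tensor_op_rank_one_left:
  assumes "bounded_clinear B"
  shows "tensor_op (\<lambda>x. cinner f x *\<^sub>C e) B = (\<lambda>t. e \<otimes>\<^sub>v B (slice f t))"
proof (rule tensor_op_eqI)
  show "bounded_clinear (\<lambda>t. e \<otimes>\<^sub>v B (slice f t))"
    by (rule bounded_clinear_comp[OF bounded_clinear_tensor_vec_right
          bounded_clinear_comp[OF assms bounded_clinear_slice]])
qed (simp add: slice_tensor_vec bclin_scaleC[OF assms] tensor_vec_scaleC_left tensor_vec_scaleC_right)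

text \<open>The blocks of the product are the multiples of \<open>B\<close> by
  \<open>cinner e (A f)\<close>. Cauchy-Schwarz over both indices bounds the finite sections by
  \<open>hs_norm A * K\<close>.\<close>

lemma tensor_op_exists_hs:
  assumes A: "hilbert_schmidt A" and B: "bounded_clinear B"
  shows "bounded_clinear (tensor_op A B)" "tensor_op A B (x \<otimes>\<^sub>v y) = A x \<otimes>\<^sub>v B y"
proof -
  have bA: "bounded_clinear A" by (rule hs_bclin[OF A])
  obtain K where K: "K > 0" "\<And>x. norm (B x) \<le> K * norm x" using bounded_clinear_bound[OF B] by blast
  obtain C :: "('a, 'b) tensor \<Rightarrow> ('a, 'b) tensor" where C: "bounded_clinear C"
    "\<And>e f. e \<in> onb \<Longrightarrow> f \<in> onb \<Longrightarrow> block C e f = (\<lambda>b. cinner e (A f) *\<^sub>C B b)"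
  proof (rule block_operator_exists[where K = "hs_norm A * K" and
        L = "\<lambda>e f b. cinner e (A f) *\<^sub>C B b"])
    fix F u v assume F: "finite F" "F \<subseteq> (onb :: 'a set)"
    define U V where "U = L2_set (\<lambda>e. norm (u e :: 'b)) F" and "V = L2_set (\<lambda>f. norm (v f :: 'b)) F"
    have row: "L2_set (\<lambda>e. cmod (cinner e (A f))) F \<le> norm (A f)" for f
      unfolding L2_set_def using bessel_finite[OF F, of "A f"] by (simp add: real_le_lsqrt)
    have hsF: "L2_set (\<lambda>f. norm (A f)) F \<le> hs_norm A"
      unfolding L2_set_def using hs_norm_nonneg
      by (intro real_le_lsqrt finite_sum_le_has_sum[OF hs_has_sum[OF A parseval_family_onb] F] sum_nonneg) auto
    have "cmod (\<Sum>e\<in>F. \<Sum>f\<in>F. cinner (u e) (cinner e (A f) *\<^sub>C B (v f))) \<le>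
        (\<Sum>e\<in>F. \<Sum>f\<in>F. cmod (cinner e (A f)) * (norm (u e) * (K * norm (v f))))"
      by (intro sum_norm_le)
        (auto simp: cinner_simps norm_mult
          intro!: mult_left_mono order_trans[OF cmod_cinner_le] K(2))
    also have "\<dots> = (\<Sum>f\<in>F. (\<Sum>e\<in>F. \<bar>cmod (cinner e (A f))\<bar> * \<bar>norm (u e)\<bar>) * (K * norm (v f)))"
      by (subst sum.swap) (simp add: sum_distrib_right mult.assoc)
    also have "\<dots> \<le> (\<Sum>f\<in>F. (norm (A f) * U) * (K * norm (v f)))"
    proof (intro sum_mono mult_right_mono)
      fix f
      show "(\<Sum>e\<in>F. \<bar>cmod (cinner e (A f))\<bar> * \<bar>norm (u e)\<bar>) \<le> norm (A f) * U"
        unfolding U_def by (rule order_trans[OF L2_set_mult_ineq mult_right_mono[OF row]]) simp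
    qed (use K(1) in simp)
    also have "\<dots> = (U * K) * (\<Sum>f\<in>F. \<bar>norm (A f)\<bar> * \<bar>norm (v f)\<bar>)"
      by (simp add: sum_distrib_left mult_ac)
    also have "\<dots> \<le> (U * K) * (hs_norm A * V)"
      unfolding V_def
      by (rule mult_left_mono[OF order_trans[OF L2_set_mult_ineq mult_right_mono[OF hsF]]])
        (use K(1) in \<open>simp_all add: U_def\<close>)
    finally show "cmod (\<Sum>e\<in>F. \<Sum>f\<in>F. cinner (u e) (cinner e (A f) *\<^sub>C B (v f))) \<le>
        hs_norm A * K * L2_set (\<lambda>e. norm (u e)) F * L2_set (\<lambda>f. norm (v f)) F"
      by (simp add: U_def V_def mult_ac)
  qed (use K(1) B in \<open>auto intro: bounded_clinear_scaleC simp: hs_norm_nonneg\<close>)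
  have onb: "C (f \<otimes>\<^sub>v y) = A f \<otimes>\<^sub>v B y" if f: "f \<in> onb" for f y
    using fun_cong[OF C(2)[OF _ f], of _ y]
    by (intro slice_eqI) (simp add: block_def slice_tensor_vec)
  have "(\<lambda>x. C (x \<otimes>\<^sub>v y)) = (\<lambda>x. A x \<otimes>\<^sub>v B y)" for y
    by (rule bounded_clinear_eq_onb[OF bounded_clinear_comp[OF C(1) bounded_clinear_tensor_vec_left]
          bounded_clinear_comp[OF bounded_clinear_tensor_vec_left bA]]) (rule onb)
  then have *: "C (x \<otimes>\<^sub>v y) = A x \<otimes>\<^sub>v B y" for x y by (rule fun_cong)
  then show "bounded_clinear (tensor_op A B)" "tensor_op A B (x \<otimes>\<^sub>v y) = A x \<otimes>\<^sub>v B y"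
    using tensor_op_eqI[OF C(1) *] C(1) by simp_all
qed

lemma hs_tensor_op:
  assumes A: "hilbert_schmidt A" and B: "hilbert_schmidt B"
  shows "hilbert_schmidt (tensor_op A B)"
proof (rule hsI[OF tensor_op_exists_hs(1)[OF A hs_bclin[OF B]] parseval_family_tensor],
    rule summable_on_SigmaI)
  fix e :: 'a
  show "((\<lambda>f. (norm (tensor_op A B (case (e, f) of (e, f) \<Rightarrow> e \<otimes>\<^sub>v f)))\<^sup>2) has_sum
      (norm (A e))\<^sup>2 * (hs_norm B)\<^sup>2) onb"
    using has_sum_cmult_right[OF hs_has_sum[OF B parseval_family_onb], of "(norm (A e))\<^sup>2"]
    by (simp add: tensor_op_exists_hs(2)[OF A hs_bclin[OF B]] norm_tensor_vec power_mult_distrib)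
  show "(\<lambda>e. (norm (A e))\<^sup>2 * (hs_norm B)\<^sup>2) summable_on onb"
    using A by (intro summable_on_cmult_left) (simp add: hilbert_schmidt_def)
qed simp

text \<open>After factoring both operators, \<open>(A1 A2) \<otimes> (B1 B2) = (A1 \<otimes> B1) (A2
  \<otimes> B2)\<close> is a product of two Hilbert-Schmidt operators.\<close>

lemma tensor_op_trace_class:
  fixes A :: "'a::complex_hilbert_space \<Rightarrow> 'a" and B :: "'b::complex_hilbert_space \<Rightarrow> 'b"
  assumes A: "A \<in> trace_class" and B: "B \<in> trace_class"
  shows "tensor_op A B \<in> trace_class" "tensor_op A B (x \<otimes>\<^sub>v y) = A x \<otimes>\<^sub>v B y"
proof -
  obtain A1 A2 :: "'a \<Rightarrow> 'a" where A12: "hilbert_schmidt A1" "hilbert_schmidt A2"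
    "A = (\<lambda>x. A1 (A2 x))" by (rule trace_class_factor[OF A])
  obtain B1 B2 :: "'b \<Rightarrow> 'b" where B12: "hilbert_schmidt B1" "hilbert_schmidt B2"
    "B = (\<lambda>x. B1 (B2 x))" by (rule trace_class_factor[OF B])
  note h1 = tensor_op_exists_hs[OF A12(1) hs_bclin[OF B12(1)]]
  note h2 = tensor_op_exists_hs[OF A12(2) hs_bclin[OF B12(2)]]
  have eq: "tensor_op A B = (\<lambda>t. tensor_op A1 B1 (tensor_op A2 B2 t))"
    by (rule tensor_op_eqI[OF bounded_clinear_comp[OF h1(1) h2(1)]]) (simp add: h1 h2 A12 B12)
  show "tensor_op A B \<in> trace_class"
    unfolding eq by (rule hs_comp_trace_class(1)[OF hs_tensor_op hs_tensor_op]) fact+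
  show "tensor_op A B (x \<otimes>\<^sub>v y) = A x \<otimes>\<^sub>v B y" by (simp only: eq h1 h2) (simp add: A12(3) B12(3))
qed

lemma block_tensor_op:
  assumes "A \<in> trace_class" "B \<in> trace_class"
  shows "block (tensor_op A B) e f = (\<lambda>b. cinner e (A f) *\<^sub>C B b)"
  by (simp add: block_def tensor_op_trace_class(2)[OF assms] slice_tensor_vec)


section \<open>Finite block operators\<close>

text \<open>The coefficients of \<open>T x\<close> are \<open>cinner (adj T e) x\<close>, each at
  most \<open>norm (adj T e) * norm x\<close>.\<close>

lemma norm_le_hs_norm:
  assumes T: "hilbert_schmidt T"
  shows "norm (T x) \<le> hs_norm T * norm x"
proof (rule power2_le_imp_le)
  have bT: "bounded_clinear T" by (rule hs_bclin[OF T])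
  have s: "((\<lambda>e. (norm (adj T e))\<^sup>2) has_sum (hs_norm T)\<^sup>2) onb"
    using hs_has_sum[OF hs_adj(1)[OF T] parseval_family_onb] by (simp add: hs_adj(2)[OF T])
  have "((\<lambda>e. (cmod (cinner e (T x)))\<^sup>2) has_sum (norm (T x))\<^sup>2) onb"
    using parseval_family_onb unfolding parseval_family_def by blast
  then have "(norm (T x))\<^sup>2 \<le> (hs_norm T)\<^sup>2 * (norm x)\<^sup>2"
  proof (rule has_sum_mono[OF _ has_sum_cmult_left[OF s]])
    fix e
    show "(cmod (cinner e (T x)))\<^sup>2 \<le> (norm (adj T e))\<^sup>2 * (norm x)\<^sup>2"
      using power_mono[OF cmod_cinner_le[of "adj T e" x], of 2]
      by (simp add: cinner_adj[OF bT] power_mult_distrib)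
  qed
  then show "(norm (T x))\<^sup>2 \<le> (hs_norm T * norm x)\<^sup>2" by (simp add: power_mult_distrib)
qed (simp add: hs_norm_nonneg)

text \<open>Turns control of traces into control of operator norms, as the construction of the
  ampliation requires.\<close>

lemma norm_le_trace_norm:
  assumes "A \<in> trace_class"
  shows "norm (A x) \<le> trace_norm A * norm x"
proof -
  obtain B C :: "'a \<Rightarrow> 'a" where BC: "hilbert_schmidt B" "hilbert_schmidt C"
    "A = (\<lambda>x. B (C x))" "hs_norm B * hs_norm C \<le> trace_norm A"
    by (rule trace_class_factor[OF assms])
  have "norm (A x) \<le> hs_norm B * (hs_norm C * norm x)"
    unfolding BC(3)
    by (rule order_trans[OF norm_le_hs_norm[OF BC(1)] mult_left_mono[OF norm_le_hs_norm[OF BC(2)]]])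
      (rule hs_norm_nonneg)
  also have "\<dots> \<le> trace_norm A * norm x"
    using mult_right_mono[OF BC(4), of "norm x"] by (simp add: mult.assoc)
  finally show ?thesis .
qed

text \<open>Inverse to \<open>block\<close> on finite matrices: for \<open>F \<subseteq> onb\<close>
  and bounded entries its blocks are the \<open>L e f\<close>, and zero outside
  \<open>F\<close>.\<close>

definition block_sum ::
  "'a::complex_hilbert_space set \<Rightarrow> ('a \<Rightarrow> 'a \<Rightarrow> 'b::complex_hilbert_space \<Rightarrow> 'b) \<Rightarrow>
     ('a, 'b) tensor \<Rightarrow> ('a, 'b) tensor" where
  "block_sum F L t = (\<Sum>e\<in>F. \<Sum>f\<in>F. e \<otimes>\<^sub>v L e f (slice f t))"

lemma block_sum_trace_class:
  assumes "\<And>e f. e \<in> F \<Longrightarrow> f \<in> F \<Longrightarrow> L e f \<in> trace_class"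
  shows "block_sum F L \<in> trace_class"
  unfolding block_sum_def[abs_def]
  by (intro trace_class_sum trace_class_ideal[OF _ bounded_clinear_tensor_vec_right
        bounded_clinear_slice] assms)

lemma cinner_block_sum:
  "cinner s (block_sum F L t) = (\<Sum>e\<in>F. \<Sum>f\<in>F. cinner (slice e s) (L e f (slice f t)))"
  by (simp add: block_sum_def cinner_sum_right cinner_slice_left)

lemma slice_sum_tensor_vec:
  assumes "finite F" "F \<subseteq> onb" "e \<in> onb"
  shows "slice e (\<Sum>f\<in>F. f \<otimes>\<^sub>v v f) = (if e \<in> F then v e else 0)"
proof -
  have "slice e (\<Sum>f\<in>F. f \<otimes>\<^sub>v v f) = (\<Sum>f\<in>F. if e = f then v f else 0)"
    unfolding bclin_sum[OF bounded_clinear_slice]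
    using assms by (intro sum.cong) (auto simp: slice_tensor_vec cinner_onb subset_iff)
  then show ?thesis using assms(1) by simp
qed

lemma norm_sum_tensor_vec:
  assumes F: "finite F" "F \<subseteq> onb"
  shows "norm (\<Sum>f\<in>F. f \<otimes>\<^sub>v v f) = L2_set (\<lambda>f. norm (v f)) F"
proof -
  define U where "U = (\<Sum>f\<in>F. f \<otimes>\<^sub>v v f)"
  have "cinner U U = (\<Sum>f\<in>F. cinner (v f) (slice f U))"
    by (subst U_def) (simp add: cinner_sum_left cinner_slice)
  also have "\<dots> = (\<Sum>f\<in>F. of_real ((norm (v f))\<^sup>2))"
    using F by (intro sum.cong) (auto simp: U_def slice_sum_tensor_vec cinner_self subset_iff)
  finally have "complex_of_real ((norm U)\<^sup>2) = of_real (\<Sum>f\<in>F. (norm (v f))\<^sup>2)"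
    by (simp add: cinner_self)
  then have "(norm U)\<^sup>2 = (\<Sum>f\<in>F. (norm (v f))\<^sup>2)" using of_real_eq_iff by blast
  then show ?thesis by (simp add: L2_set_def U_def real_sqrt_unique)
qed

lemma block_block_sum:
  assumes F: "finite F" "F \<subseteq> onb" and ef: "e \<in> onb" "f \<in> onb"
    and L: "\<And>e f. e \<in> F \<Longrightarrow> f \<in> F \<Longrightarrow> bounded_clinear (L e f)"
  shows "block (block_sum F L) e f = (if e \<in> F \<and> f \<in> F then L e f else (\<lambda>b. 0))"
proof
  fix b
  have "slice e (block_sum F L (f \<otimes>\<^sub>v b)) = slice e (\<Sum>e\<in>F. e \<otimes>\<^sub>v (\<Sum>g\<in>F. L e g (slice g (f \<otimes>\<^sub>v b))))"
    by (simp add: block_sum_def bclin_sum[OF bounded_clinear_tensor_vec_right])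
  also have "\<dots> = (if e \<in> F then \<Sum>g\<in>F. L e g (slice g (f \<otimes>\<^sub>v b)) else 0)"
    by (rule slice_sum_tensor_vec[OF F ef(1)])
  also have "\<dots> = (if e \<in> F then \<Sum>g\<in>F. if g = f then L e f b else 0 else 0)"
    using F ef by (intro if_cong sum.cong refl)
      (auto simp: slice_tensor_vec cinner_onb subset_iff bclin_zero[OF L])
  finally show "block (block_sum F L) e f b = (if e \<in> F \<and> f \<in> F then L e f else (\<lambda>b. 0)) b"
    using F(1) by (simp add: block_def)
qed

text \<open>By Pythagoras the squared distance to \<open>t\<close> is
  \<open>(norm t)\<^sup>2\<close> minus the partial sum of the squared norms of the slices.\<close>

lemma tensor_slices_tendsto:
  fixes t :: "('a::complex_hilbert_space, 'b::complex_hilbert_space) tensor"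
  shows "((\<lambda>F. \<Sum>e\<in>F. e \<otimes>\<^sub>v slice e t) \<longlongrightarrow> t) (finite_subsets_at_top onb)"
proof -
  let ?P = "\<lambda>F. \<Sum>e\<in>F. e \<otimes>\<^sub>v slice e t" and ?s = "\<lambda>F. \<Sum>e\<in>F. (norm (slice e t))\<^sup>2"
  have "(?s \<longlongrightarrow> (norm t)\<^sup>2) (finite_subsets_at_top onb)"
    using norm_slice_has_sum[of t] unfolding has_sum_def .
  then have lim: "((\<lambda>F. sqrt ((norm t)\<^sup>2 - ?s F)) \<longlongrightarrow> sqrt ((norm t)\<^sup>2 - (norm t)\<^sup>2))
      (finite_subsets_at_top onb)"
    by (intro tendsto_intros)
  have eq: "norm (?P F - t) = sqrt ((norm t)\<^sup>2 - ?s F)" if F: "finite F" "F \<subseteq> onb" for F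
  proof -
    have "(norm (?P F))\<^sup>2 = ?s F"
      by (simp add: norm_sum_tensor_vec[OF F] L2_set_def sum_nonneg)
    moreover have "cinner (?P F) t = of_real (?s F)"
      by (simp add: cinner_sum_left cinner_self flip: cinner_slice)
    then have "inner (?P F) t = ?s F" by (metis Re_cinner Re_complex_of_real)
    ultimately have "(norm (?P F - t))\<^sup>2 = (norm t)\<^sup>2 - ?s F"
      unfolding power2_norm_eq_inner by (simp add: inner_diff_left inner_diff_right inner_commute)
    then show ?thesis by (metis norm_ge_zero real_sqrt_unique)
  qed
  have "((\<lambda>F. ?P F - t) \<longlongrightarrow> 0) (finite_subsets_at_top onb)"
    by (rule Lim_null_comparison[OF eventually_finite_subsets_at_top_weakI lim[simplified]])
      (simp add: eq)
  then show ?thesis by (rule LIM_zero_cancel)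
qed

text \<open>A bijection of \<open>F\<close> with \<open>{..<n}\<close> carries complete positivity
  from numbered blocks to blocks indexed by basis vectors.\<close>

lemma completely_positive_finite_index:
  fixes \<Phi> :: "'b::complex_hilbert_space superop" and F :: "'i set"
  assumes cp: "completely_positive \<Phi>" and F: "finite F"
    and X: "\<And>e f. e \<in> F \<Longrightarrow> f \<in> F \<Longrightarrow> X e f \<in> trace_class"
    and pos: "\<And>v. (\<Sum>e\<in>F. \<Sum>f\<in>F. cinner (v e) (X e f (v f))) \<in> \<real>\<^sub>\<ge>\<^sub>0"
  shows "(\<Sum>e\<in>F. \<Sum>f\<in>F. cinner (v e) (\<Phi> (X e f) (v f))) \<in> \<real>\<^sub>\<ge>\<^sub>0"
proof -
  define n where "n = card F"
  obtain h where h: "bij_betw h {..<n} F"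
    using ex_bij_betw_nat_finite[OF F] by (auto simp: n_def lessThan_atLeast0)
  have re: "(\<Sum>e\<in>F. \<Sum>f\<in>F. G e f) = (\<Sum>i<n. \<Sum>j<n. G (h i) (h j))" for G :: "'i \<Rightarrow> 'i \<Rightarrow> complex"
    by (simp add: sum.reindex_bij_betw[OF h, symmetric])
  have hF: "h i \<in> F" if "i < n" for i using h that bij_betwE by blast
  have "positive_block n (\<lambda>i j. X (h i) (h j))"
    unfolding positive_block_def
  proof
    fix v
    have "(\<Sum>e\<in>F. \<Sum>f\<in>F. cinner (v (the_inv_into {..<n} h e)) (X e f (v (the_inv_into {..<n} h f)))) \<in> \<real>\<^sub>\<ge>\<^sub>0"
      by (rule pos)
    also have "?this \<longleftrightarrow> (\<Sum>i<n. \<Sum>j<n. cinner (v i) (X (h i) (h j) (v j))) \<in> \<real>\<^sub>\<ge>\<^sub>0"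
      unfolding re using h by (simp add: the_inv_into_f_f bij_betw_def)
    finally show "(\<Sum>i<n. \<Sum>j<n. cinner (v i) (X (h i) (h j) (v j))) \<in> \<real>\<^sub>\<ge>\<^sub>0" .
  qed
  then have pb: "positive_block n (\<lambda>i j. \<Phi> (X (h i) (h j)))"
    using cp[unfolded completely_positive_def, rule_format, of n "\<lambda>i j. X (h i) (h j)"] X hF
    by simp
  show ?thesis
    unfolding re using pb[unfolded positive_block_def, rule_format, of "\<lambda>i. v (h i)"] .
qed

lemma positive_op_block_form:
  assumes "positive_op Y"
  shows "(\<Sum>e\<in>F. \<Sum>f\<in>F. cinner (v e) (block Y e f (v f))) \<in> \<real>\<^sub>\<ge>\<^sub>0"
proof -
  define t where "t = (\<Sum>e\<in>F. e \<otimes>\<^sub>v v e)"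
  have "cinner t (Y t) = (\<Sum>e\<in>F. \<Sum>f\<in>F. cinner (v e) (block Y e f (v f)))"
    unfolding t_def bclin_sum[OF positive_op_bclin[OF assms]] cinner_sum_left
    by (simp add: cinner_sum_right cinner_block)
  then show ?thesis using assms unfolding positive_op_def by metis
qed

text \<open>Vectors with finitely many nonzero slices are dense, and the set of nonnegative reals is
  closed.\<close>

lemma positive_op_if_block_forms:
  fixes Y :: "('a::complex_hilbert_space, 'b::complex_hilbert_space) tensor \<Rightarrow> ('a, 'b) tensor"
  assumes Y: "bounded_clinear Y"
    and pos: "\<And>F v. finite F \<Longrightarrow> F \<subseteq> onb \<Longrightarrow>
      (\<Sum>e\<in>F. \<Sum>f\<in>F. cinner (v e) (block Y e f (v f))) \<in> \<real>\<^sub>\<ge>\<^sub>0"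
  shows "positive_op Y"
  unfolding positive_op_def
proof (intro conjI allI Y)
  fix t :: "('a, 'b) tensor"
  let ?P = "\<lambda>F. \<Sum>e\<in>F. e \<otimes>\<^sub>v slice e t"
  have lim: "((\<lambda>F. cinner (?P F) (Y (?P F))) \<longlongrightarrow> cinner t (Y t)) (finite_subsets_at_top onb)"
    by (intro tendsto_cinner bclin_tendsto[OF Y] tensor_slices_tendsto)
  have "cinner (?P F) (Y (?P F)) \<in> \<real>\<^sub>\<ge>\<^sub>0" if "finite F" "F \<subseteq> onb" for F
    using pos[OF that, of "\<lambda>e. slice e t"]
    unfolding bclin_sum[OF Y] cinner_sum_left by (simp add: cinner_sum_right cinner_block)
  then show "cinner t (Y t) \<in> \<real>\<^sub>\<ge>\<^sub>0"
    by (intro Lim_in_closed_set[OF closed_nonneg_Reals_complex _ _ lim]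
        eventually_finite_subsets_at_top_weakI) auto
qed

section \<open>Ampliation of a completely positive trace preserving map\<close>

lemma trace_preservingI:
  assumes lin: "linear_superop \<Phi>"
    and pos: "\<And>P. P \<in> trace_class \<Longrightarrow> positive_op P \<Longrightarrow> op_trace (\<Phi> P) = op_trace P"
  shows "trace_preserving \<Phi>"
  unfolding trace_preserving_def
proof
  fix A :: "'a \<Rightarrow> 'a" assume A: "A \<in> trace_class"
  have herm: "op_trace (\<Phi> H) = op_trace H" if H: "H \<in> trace_class" "hermitian_op H" for H
  proof -
    obtain P Q where PQ: "positive_op P" "positive_op Q" "P \<in> trace_class" "Q \<in> trace_class"
      "H = (\<lambda>x. P x - Q x)" by (rule jordan_decomposition[OF H])
    then show ?thesis
      by (simp add: linear_superop_diff[OF lin] op_trace_diff linear_superop_trace_class[OF lin] pos)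
  qed
  obtain G H where GH: "hermitian_op G" "hermitian_op H" "G \<in> trace_class" "H \<in> trace_class"
    "A = (\<lambda>x. G x + \<i> *\<^sub>C H x)" by (rule hermitian_decomposition[OF A])
  then show "op_trace (\<Phi> A) = op_trace A"
    by (simp add: linear_superop_combination[OF lin] op_trace_add op_trace_scaleC
        trace_class_scaleC linear_superop_trace_class[OF lin] herm)
qed

text \<open>The candidate for \<open>id \<otimes> \<Phi>\<close>, fixed by its blocks so that
  linearity and composition can be checked blockwise; \<open>block_eqI\<close> leaves at most one
  choice.\<close>

definition ampliation ::
  "'b::complex_hilbert_space superop \<Rightarrow> ('a::complex_hilbert_space, 'b) tensor superop" where
  "ampliation \<Phi> Y =
     (SOME Z. Z \<in> trace_class \<and> (\<forall>e\<in>onb. \<forall>f\<in>onb. block Z e f = \<Phi> (block Y e f)))"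

context
  fixes \<Phi> :: "'b::complex_hilbert_space superop"
  assumes lin: "linear_superop \<Phi>" and cp: "completely_positive \<Phi>" and tp: "trace_preserving \<Phi>"
begin

text \<open>A finite section \<open>S\<close> is positive by complete positivity, so its trace norm
  is the sum of the traces of its diagonal blocks. Trace preservation turns these into the traces of
  \<open>block Y e e\<close>, which add up to at most \<open>trace_norm Y\<close>. The resulting
  bound on the operator norm is uniform in \<open>F\<close>.\<close>

lemma ampliation_exists_positive:
  fixes Y :: "('a::complex_hilbert_space, 'b) tensor \<Rightarrow> ('a, 'b) tensor"
  assumes Y: "positive_op Y" "Y \<in> trace_class"
  obtains Z where "positive_op Z" "Z \<in> trace_class" "trace_norm Z = trace_norm Y"
    "\<And>e f. e \<in> onb \<Longrightarrow> f \<in> onb \<Longrightarrow> block Z e f = \<Phi> (block Y e f)"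
proof -
  define L where "L e f = \<Phi> (block Y e f)" for e f :: 'a
  have LT: "L e f \<in> trace_class" for e f
    unfolding L_def by (intro linear_superop_trace_class[OF lin] block_trace_class Y)
  have bL: "bounded_clinear (L e f)" for e f by (rule trace_class_bclin[OF LT])
  have tn: "trace_norm (L e e) = trace_norm (block Y e e)" for e
    unfolding L_def by (intro trace_norm_positive_map[OF lin
        completely_positive_imp_positive_map[OF lin cp] tp] block_trace_class positive_op_block Y)
  have form: "(\<Sum>e\<in>F. \<Sum>f\<in>F. cinner (v e) (L e f (v f))) \<in> \<real>\<^sub>\<ge>\<^sub>0" if "finite F" for F v
    unfolding L_def
    by (rule completely_positive_finite_index[OF cp that block_trace_class[OF Y(2)]
          positive_op_block_form[OF Y(1)]])
  have tsum: "((\<lambda>e. trace_norm (block Y e e)) has_sum trace_norm Y) onb"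
    by (rule trace_norm_block_has_sum[OF Y])
  have nn: "0 \<le> trace_norm (block Y e e)" for e
    by (intro trace_norm_nonneg trace_class_bclin block_trace_class Y)
  have bound: "cmod (\<Sum>e\<in>F. \<Sum>f\<in>F. cinner (u e) (L e f (v f))) \<le>
      trace_norm Y * L2_set (\<lambda>e. norm (u e)) F * L2_set (\<lambda>f. norm (v f)) F"
    if F: "finite F" "F \<subseteq> onb" for F u v
  proof -
    define U V where "U = (\<Sum>e\<in>F. e \<otimes>\<^sub>v u e)" and "V = (\<Sum>e\<in>F. e \<otimes>\<^sub>v v e)"
    define S where "S = block_sum F L"
    have ST: "S \<in> trace_class" unfolding S_def by (rule block_sum_trace_class[OF LT])
    have S: "positive_op S"
      using trace_class_bclin[OF ST] form[OF F(1)]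
      by (simp add: positive_op_def S_def cinner_block_sum)
    have "((\<lambda>e. trace_norm (block S e e)) has_sum (\<Sum>e\<in>F. trace_norm (block S e e))) onb"
      using F by (intro has_sum_finite_neutralI)
        (auto simp: S_def block_block_sum bL trace_norm_zero)
    then have "trace_norm S = (\<Sum>e\<in>F. trace_norm (block S e e))"
      using trace_norm_block_has_sum[OF S ST] has_sum_unique by blast
    also have "\<dots> = (\<Sum>e\<in>F. trace_norm (block Y e e))"
      using F by (intro sum.cong) (auto simp: S_def block_block_sum bL tn subset_iff)
    also have "\<dots> \<le> trace_norm Y"
      by (rule finite_sum_le_has_sum[OF tsum F nn])
    finally have SY: "trace_norm S \<le> trace_norm Y" .
    have "(\<Sum>e\<in>F. \<Sum>f\<in>F. cinner (u e) (L e f (v f))) = cinner U (S V)"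
      unfolding S_def cinner_block_sum U_def V_def
      using F by (intro sum.cong) (auto simp: slice_sum_tensor_vec subset_iff)
    also have "cmod \<dots> \<le> norm U * (trace_norm S * norm V)"
      by (rule order_trans[OF cmod_cinner_le mult_left_mono[OF norm_le_trace_norm[OF ST]]]) simp
    also have "\<dots> \<le> norm U * (trace_norm Y * norm V)"
      by (intro mult_left_mono mult_right_mono SY) simp_all
    finally show ?thesis
      by (simp add: U_def V_def norm_sum_tensor_vec[OF F] mult_ac)
  qed
  obtain Z :: "('a, 'b) tensor \<Rightarrow> ('a, 'b) tensor" where Z: "bounded_clinear Z"
    "\<And>e f. e \<in> onb \<Longrightarrow> f \<in> onb \<Longrightarrow> block Z e f = L e f"
    by (rule block_operator_exists[OF bL trace_norm_nonneg[OF trace_class_bclin[OF Y(2)]] bound]) blast+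
  have Zpos: "positive_op Z"
  proof (rule positive_op_if_block_forms[OF Z(1)])
    fix F :: "'a set" and v assume F: "finite F" "F \<subseteq> onb"
    have "(\<Sum>e\<in>F. \<Sum>f\<in>F. cinner (v e) (block Z e f (v f))) = (\<Sum>e\<in>F. \<Sum>f\<in>F. cinner (v e) (L e f (v f)))"
      using F by (intro sum.cong) (auto simp: Z subset_iff)
    then show "(\<Sum>e\<in>F. \<Sum>f\<in>F. cinner (v e) (block Z e f (v f))) \<in> \<real>\<^sub>\<ge>\<^sub>0"
      using form[OF F(1)] by simp
  qed
  have Zsum: "((\<lambda>e. trace_norm (block Z e e)) has_sum trace_norm Y) onb"
    using tsum by (rule has_sum_cong[THEN iffD1, rotated]) (simp add: Z tn)
  have ZT: "Z \<in> trace_class"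
    by (rule trace_class_if_blocks_summable[OF Zpos _ has_sum_imp_summable[OF Zsum]])
      (simp add: Z LT)
  have "trace_norm Z = trace_norm Y"
    by (rule has_sum_unique[OF trace_norm_block_has_sum[OF Zpos ZT] Zsum])
  then show ?thesis using that Zpos ZT Z unfolding L_def by blast
qed

text \<open>The relation \<open>ok\<close> is preserved by complex combinations, so Jordan parts
  (with \<open>c = -1\<close>) and then real and imaginary parts (with \<open>c = \<i>\<close>)
  reduce everything to positive \<open>Y\<close>.\<close>

lemma ampliation_exists:
  fixes Y :: "('a::complex_hilbert_space, 'b) tensor \<Rightarrow> ('a, 'b) tensor"
  assumes Y: "Y \<in> trace_class"
  obtains Z where "Z \<in> trace_class"
    "\<And>e f. e \<in> onb \<Longrightarrow> f \<in> onb \<Longrightarrow> block Z e f = \<Phi> (block Y e f)"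
proof -
  define ok where "ok Y Z \<longleftrightarrow> Y \<in> trace_class \<and> Z \<in> trace_class \<and>
      (\<forall>e\<in>onb. \<forall>f\<in>onb. block Z e f = \<Phi> (block Y e f))"
    for Y Z :: "('a, 'b) tensor \<Rightarrow> ('a, 'b) tensor"
  have comb: "ok (\<lambda>x. Y1 x + c *\<^sub>C Y2 x) (\<lambda>x. Z1 x + c *\<^sub>C Z2 x)"
    if "ok Y1 Z1" "ok Y2 Z2" for Y1 Y2 Z1 Z2 c
    using that
    by (auto simp: ok_def block_add block_scaleC linear_superop_combination[OF lin] block_trace_class
        intro!: trace_class_add trace_class_scaleC)
  have herm: "\<exists>Z. ok H Z" if H: "H \<in> trace_class" "hermitian_op H" for H
  proof -
    obtain P Q where PQ: "positive_op P" "positive_op Q" "P \<in> trace_class" "Q \<in> trace_class"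
      "H = (\<lambda>x. P x - Q x)" by (rule jordan_decomposition[OF H])
    obtain Z1 where "ok P Z1"
      by (rule ampliation_exists_positive[OF PQ(1,3)]) (auto simp: ok_def PQ)
    moreover obtain Z2 where "ok Q Z2"
      by (rule ampliation_exists_positive[OF PQ(2,4)]) (auto simp: ok_def PQ)
    ultimately show ?thesis using comb[of P Z1 Q Z2 "-1"] by (auto simp: PQ(5) scaleC_minus_left)
  qed
  obtain G H where GH: "hermitian_op G" "hermitian_op H" "G \<in> trace_class" "H \<in> trace_class"
    "Y = (\<lambda>x. G x + \<i> *\<^sub>C H x)" by (rule hermitian_decomposition[OF Y])
  then obtain Z1 Z2 where "ok G Z1" "ok H Z2" using herm by metis
  from comb[OF this, of \<i>] show ?thesis using that unfolding GH(5) ok_def by blast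
qed

lemma ampliation:
  assumes "Y \<in> trace_class"
  shows ampliation_trace_class: "ampliation \<Phi> Y \<in> trace_class"
    and block_ampliation: "e \<in> onb \<Longrightarrow> f \<in> onb \<Longrightarrow> block (ampliation \<Phi> Y) e f = \<Phi> (block Y e f)"
proof -
  have "\<exists>Z. Z \<in> trace_class \<and> (\<forall>e\<in>onb. \<forall>f\<in>onb. block Z e f = \<Phi> (block Y e f))"
    by (rule ampliation_exists[OF assms]) blast
  from someI_ex[OF this] show "ampliation \<Phi> Y \<in> trace_class"
    "e \<in> onb \<Longrightarrow> f \<in> onb \<Longrightarrow> block (ampliation \<Phi> Y) e f = \<Phi> (block Y e f)"
    unfolding ampliation_def by blast+
qed

lemma ampliation_eqI:
  assumes Y: "Y \<in> trace_class" and Z: "bounded_clinear Z"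
    "\<And>e f. e \<in> onb \<Longrightarrow> f \<in> onb \<Longrightarrow> block Z e f = \<Phi> (block Y e f)"
  shows "ampliation \<Phi> Y = Z"
  by (rule block_eqI[OF trace_class_bclin[OF ampliation_trace_class[OF Y]] Z(1)])
    (simp add: block_ampliation[OF Y] Z(2))

lemma linear_superop_ampliation:
  "linear_superop (ampliation \<Phi> :: ('a::complex_hilbert_space, 'b) tensor superop)"
  unfolding linear_superop_def
proof (intro conjI ballI allI)
  fix A :: "('a, 'b) tensor \<Rightarrow> ('a, 'b) tensor" assume A: "A \<in> trace_class"
  show "ampliation \<Phi> A \<in> trace_class" by (rule ampliation_trace_class[OF A])
  show "ampliation \<Phi> (\<lambda>x. c *\<^sub>C A x) = (\<lambda>x. c *\<^sub>C ampliation \<Phi> A x)" for c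
    by (rule ampliation_eqI)
      (simp_all add: A trace_class_scaleC trace_class_bclin ampliation_trace_class block_scaleC
        block_ampliation linear_superop_scaleC[OF lin] block_trace_class)
  fix B :: "('a, 'b) tensor \<Rightarrow> ('a, 'b) tensor" assume B: "B \<in> trace_class"
  show "ampliation \<Phi> (\<lambda>x. A x + B x) = (\<lambda>x. ampliation \<Phi> A x + ampliation \<Phi> B x)"
    by (rule ampliation_eqI)
      (simp_all add: A B trace_class_add trace_class_bclin ampliation_trace_class block_add
        block_ampliation linear_superop_add[OF lin] block_trace_class)
qed

lemma ampliation_positive:
  fixes Y :: "('a::complex_hilbert_space, 'b) tensor \<Rightarrow> ('a, 'b) tensor"
  assumes Y: "positive_op Y" "Y \<in> trace_class"
  shows "positive_op (ampliation \<Phi> Y)" and trace_norm_ampliation: "trace_norm (ampliation \<Phi> Y) = trace_norm Y"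
proof -
  obtain Z where Z: "positive_op Z" "Z \<in> trace_class" "trace_norm Z = trace_norm Y"
    "\<And>e f. e \<in> onb \<Longrightarrow> f \<in> onb \<Longrightarrow> block Z e f = \<Phi> (block Y e f)"
    by (rule ampliation_exists_positive[OF Y]) blast
  have "ampliation \<Phi> Y = Z" by (intro ampliation_eqI Y trace_class_bclin Z)
  then show "positive_op (ampliation \<Phi> Y)" "trace_norm (ampliation \<Phi> Y) = trace_norm Y"
    using Z by simp_all
qed

lemma positive_map_ampliation:
  "positive_map (ampliation \<Phi> :: ('a::complex_hilbert_space, 'b) tensor superop)"
  unfolding positive_map_def by (intro ballI impI ampliation_positive(1))

lemma trace_preserving_ampliation:
  "trace_preserving (ampliation \<Phi> :: ('a::complex_hilbert_space, 'b) tensor superop)"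
  by (rule trace_preservingI[OF linear_superop_ampliation])
    (simp add: op_trace_positive ampliation_positive)

lemmas ampliation_hermitian_contraction = positive_trace_preserving_contraction
  [OF linear_superop_ampliation positive_map_ampliation trace_preserving_ampliation]

text \<open>The factor \<open>2\<close> counts real and imaginary part, since contraction is known
  for Hermitian operators; \<open>id_tensor\<close> asks only for some finite constant.\<close>

lemma ampliation_bound:
  assumes Y: "Y \<in> trace_class"
  shows "trace_norm (ampliation \<Phi> Y) \<le> 2 * trace_norm Y"
proof -
  obtain G H where GH: "hermitian_op G" "hermitian_op H" "G \<in> trace_class" "H \<in> trace_class"
    "Y = (\<lambda>x. G x + \<i> *\<^sub>C H x)" "trace_norm G \<le> trace_norm Y" "trace_norm H \<le> trace_norm Y"
    by (rule hermitian_decomposition[OF Y])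
  have "trace_norm (ampliation \<Phi> Y) =
      trace_norm (\<lambda>x. ampliation \<Phi> G x + \<i> *\<^sub>C ampliation \<Phi> H x)"
    unfolding GH(5) linear_superop_combination[OF linear_superop_ampliation GH(3,4)] ..
  also have "\<dots> \<le> trace_norm (ampliation \<Phi> G) + trace_norm (\<lambda>x. \<i> *\<^sub>C ampliation \<Phi> H x)"
    by (intro trace_norm_triangle trace_class_scaleC ampliation_trace_class GH)
  also have "\<dots> \<le> trace_norm G + trace_norm H"
    using trace_norm_scaleC_le[OF ampliation_trace_class[OF GH(4)], of \<i>]
      ampliation_hermitian_contraction[OF GH(3,1)] ampliation_hermitian_contraction[OF GH(4,2)]
    by simp
  finally show ?thesis using GH(6,7) by simp
qed

lemma ampliation_tensor_op:
  assumes "A \<in> trace_class" "B \<in> trace_class"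
  shows "ampliation \<Phi> (tensor_op A B) = tensor_op A (\<Phi> B)"
  by (rule ampliation_eqI)
    (simp_all add: assms tensor_op_trace_class trace_class_bclin linear_superop_trace_class[OF lin]
      block_tensor_op linear_superop_scaleC[OF lin])

end


section \<open>Finite rank approximation in trace norm\<close>

definition finite_projection ::
  "('i \<Rightarrow> 'a::complex_hilbert_space) \<Rightarrow> 'i set \<Rightarrow> 'a \<Rightarrow> 'a" where
  "finite_projection g M x = (\<Sum>p\<in>M. cinner (g p) x *\<^sub>C g p)"

lemma bounded_clinear_finite_projection: "bounded_clinear (finite_projection g M)"
  unfolding finite_projection_def[abs_def] by (intro bounded_clinear_sum bounded_clinear_cinner)

lemma cinner_finite_projection:
  "cinner (finite_projection g M x) y = cinner x (finite_projection g M y)"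
  by (simp add: finite_projection_def cinner_sum_left cinner_sum_right cinner_simps
      cinner_commute[of x] mult.commute)

text \<open>Exhibits the compression of \<open>Y\<close> as a finite combination of rank one
  operators, which in the product basis are elementary tensors.\<close>

lemma finite_projection_sandwich:
  assumes "bounded_clinear Y"
  shows "finite_projection g M (Y (finite_projection g M x)) =
    (\<Sum>p\<in>M. \<Sum>q\<in>M. cinner (g p) (Y (g q)) *\<^sub>C (cinner (g q) x *\<^sub>C g p))"
proof -
  have "Y (finite_projection g M x) = (\<Sum>q\<in>M. cinner (g q) x *\<^sub>C Y (g q))"
    by (simp add: finite_projection_def bclin_sum[OF assms] bclin_scaleC[OF assms])
  then show ?thesis
    by (subst finite_projection_def[of g M "Y (finite_projection g M x)"])
      (simp add: cinner_sum_right cinner_scaleC_right scaleC_scaleC mult.commute scaleC_sum_left)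
qed

context
  fixes g :: "'i \<Rightarrow> 'a::complex_hilbert_space" and I :: "'i set"
  assumes g: "parseval_family g I"
    and orth: "\<And>p q. p \<in> I \<Longrightarrow> q \<in> I \<Longrightarrow> cinner (g p) (g q) = (if p = q then 1 else 0)"
begin

lemma finite_projection_basis:
  assumes "finite M" "M \<subseteq> I" "q \<in> I"
  shows "finite_projection g M (g q) = (if q \<in> M then g q else 0)"
proof -
  have "finite_projection g M (g q) = (\<Sum>p\<in>M. if p = q then g q else 0)"
    unfolding finite_projection_def using assms by (intro sum.cong) (auto simp: orth subset_iff)
  then show ?thesis using assms(1) by simp
qed

lemma norm_finite_projection_le:
  assumes M: "finite M" "M \<subseteq> I"
  shows "norm (finite_projection g M x) \<le> norm x"
proof -
  let ?P = "finite_projection g M"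
  have "?P (?P x) = (\<Sum>p\<in>M. cinner (g p) x *\<^sub>C ?P (g p))"
    by (subst (2) finite_projection_def)
      (simp add: bclin_sum bclin_scaleC bounded_clinear_finite_projection)
  also have "\<dots> = ?P x"
    using M by (subst (2) finite_projection_def) (auto intro!: sum.cong simp: finite_projection_basis subset_iff)
  finally have "complex_of_real ((norm (?P x))\<^sup>2) = cinner x (?P x)"
    by (metis cinner_finite_projection cinner_self)
  then have "(norm (?P x))\<^sup>2 = cmod (cinner x (?P x))"
    by (metis abs_of_nonneg norm_of_real zero_le_power2)
  also have "\<dots> \<le> norm x * norm (?P x)" by (rule cmod_cinner_le)
  finally show ?thesis by (cases "?P x = 0") (simp_all add: power2_eq_square)
qed

lemma hs_truncation:
  fixes T :: "'a \<Rightarrow> 'k::complex_hilbert_space"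
  assumes T: "hilbert_schmidt T" and "0 < \<delta>"
  obtains N where "finite N" "N \<subseteq> I" "\<And>M. finite M \<Longrightarrow> N \<subseteq> M \<Longrightarrow> M \<subseteq> I \<Longrightarrow>
    hs_norm (\<lambda>x. T (x - finite_projection g M x)) \<le> \<delta>"
proof -
  define s where "s p = (norm (T (g p)))\<^sup>2" for p
  have bT: "bounded_clinear T" by (rule hs_bclin[OF T])
  have sum: "(s has_sum (hs_norm T)\<^sup>2) I" unfolding s_def by (rule hs_has_sum[OF T g])
  obtain N where N: "finite N" "N \<subseteq> I" "dist (sum s N) ((hs_norm T)\<^sup>2) \<le> \<delta>\<^sup>2"
    using has_sum_finite_approximation[OF sum, of "\<delta>\<^sup>2"] \<open>0 < \<delta>\<close> by auto
  have "hs_norm (\<lambda>x. T (x - finite_projection g M x)) \<le> \<delta>" if M: "finite M" "N \<subseteq> M" "M \<subseteq> I" for M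
  proof -
    let ?T = "\<lambda>x. T (x - finite_projection g M x)"
    have V: "bounded_clinear (\<lambda>x. x - finite_projection g M x)"
      by (intro bounded_clinear_diff bounded_clinear_id bounded_clinear_finite_projection)
    then obtain L where L: "L > 0" "\<And>x. norm (x - finite_projection g M x) \<le> L * norm x"
      using bounded_clinear_bound by blast
    have hsT: "hilbert_schmidt ?T"
      using hs_comp_right(1)[OF T V L(2)] L(1) by simp
    have "((\<lambda>p. (norm (?T (g p)))\<^sup>2) has_sum (hs_norm ?T)\<^sup>2) I" by (rule hs_has_sum[OF hsT g])
    \<comment> \<open>These are the terms removed by the projection; added to the series of
      \<open>?T\<close> they restore the full series of \<open>T\<close>.\<close>
    moreover have "((\<lambda>p. if p \<in> M then s p else 0) has_sum (\<Sum>p\<in>M. if p \<in> M then s p else 0)) I"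
      using M by (intro has_sum_finite_neutralI) auto
    ultimately have "((\<lambda>p. (norm (?T (g p)))\<^sup>2 + (if p \<in> M then s p else 0)) has_sum
        (hs_norm ?T)\<^sup>2 + (\<Sum>p\<in>M. if p \<in> M then s p else 0)) I"
      by (rule has_sum_add)
    also have "?this \<longleftrightarrow> (s has_sum (hs_norm ?T)\<^sup>2 + (\<Sum>p\<in>M. if p \<in> M then s p else 0)) I"
      using M by (intro has_sum_cong) (simp add: finite_projection_basis s_def bclin_zero[OF bT])
    finally have "(hs_norm ?T)\<^sup>2 + sum s M = (hs_norm T)\<^sup>2"
      using has_sum_unique[OF sum] by simp
    moreover have "sum s N \<le> sum s M"
      using M by (intro sum_mono2) (auto simp: s_def)
    moreover have "(hs_norm T)\<^sup>2 - sum s N \<le> \<delta>\<^sup>2" using N(3) unfolding dist_real_def by linarith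
    ultimately have "(hs_norm ?T)\<^sup>2 \<le> \<delta>\<^sup>2" by linarith
    then show ?thesis by (rule power2_le_imp_le) (use \<open>0 < \<delta>\<close> in simp)
  qed
  then show ?thesis using that N by blast
qed

text \<open>With \<open>Y = B C\<close> and the projection \<open>P\<close>, the error is
  \<open>Y - P Y P = (1 - P) B C + P B C (1 - P)\<close>. Each summand contains one Hilbert-Schmidt
  factor that is small for large \<open>M\<close>; for \<open>(1 - P) B\<close> this is seen on its
  adjoint.\<close>

lemma trace_norm_finite_approximation:
  assumes Y: "Y \<in> trace_class" and "0 < \<epsilon>"
  obtains M where "finite M" "M \<subseteq> I"
    "trace_norm (\<lambda>x. Y x - finite_projection g M (Y (finite_projection g M x))) < \<epsilon>"
proof -
  obtain B C :: "'a \<Rightarrow> 'a" where BC: "hilbert_schmidt B" "hilbert_schmidt C"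
    "Y = (\<lambda>x. B (C x))" by (rule trace_class_factor[OF Y])
  have bB: "bounded_clinear B" and bC: "bounded_clinear C" using BC hs_bclin by blast+
  \<comment> \<open>The error is at most \<open>\<delta>\<close> times the sum of the two norms. The
    \<open>1\<close> keeps the divisor positive and makes the final inequality strict.\<close>
  define \<delta> where "\<delta> = \<epsilon> / (hs_norm B + hs_norm C + 1)"
  have pos: "0 < hs_norm B + hs_norm C + 1" using hs_norm_nonneg[of B] hs_norm_nonneg[of C] by linarith
  then have \<delta>: "0 < \<delta>" using \<open>0 < \<epsilon>\<close> by (simp add: \<delta>_def)
  obtain N1 where N1: "finite N1" "N1 \<subseteq> I" "\<And>M. finite M \<Longrightarrow> N1 \<subseteq> M \<Longrightarrow> M \<subseteq> I \<Longrightarrow>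
      hs_norm (\<lambda>x. adj B (x - finite_projection g M x)) \<le> \<delta>"
    by (rule hs_truncation[OF hs_adj(1)[OF BC(1)] \<delta>]) blast
  obtain N2 where N2: "finite N2" "N2 \<subseteq> I" "\<And>M. finite M \<Longrightarrow> N2 \<subseteq> M \<Longrightarrow> M \<subseteq> I \<Longrightarrow>
      hs_norm (\<lambda>x. C (x - finite_projection g M x)) \<le> \<delta>"
    by (rule hs_truncation[OF BC(2) \<delta>]) blast
  define M where "M = N1 \<union> N2"
  have M: "finite M" "M \<subseteq> I" using N1 N2 by (auto simp: M_def)
  define P where "P = finite_projection g M"
  have bP: "bounded_clinear P" unfolding P_def by (rule bounded_clinear_finite_projection)
  have nP: "norm (P x) \<le> 1 * norm x" for x using norm_finite_projection_le[OF M] by (simp add: P_def)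
  have bQ: "bounded_clinear (\<lambda>x. x - P x)" by (intro bounded_clinear_diff bounded_clinear_id bP)
  obtain L where L: "L > 0" "\<And>x. norm (x - P x) \<le> L * norm x" using bounded_clinear_bound[OF bQ] by blast
  have adj: "adj (\<lambda>x. B x - P (B x)) = (\<lambda>x. adj B (x - P x))"
  proof (rule adj_unique)
    show "bounded_clinear (\<lambda>x. B x - P (B x))"
      by (rule bounded_clinear_comp[OF bQ bB])
    show "cinner (adj B (x - P x)) y = cinner x (B y - P (B y))" for x y
      by (simp add: cinner_adj[OF bB] cinner_simps P_def cinner_finite_projection)
  qed
  have h1: "hilbert_schmidt (\<lambda>x. B x - P (B x))"
    using hs_comp_left(1)[OF BC(1) bQ L(2)] L(1) by simp
  have n1: "hs_norm (\<lambda>x. B x - P (B x)) \<le> \<delta>"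
    unfolding hs_adj(2)[OF h1, symmetric] adj
    using N1(3)[OF M(1) _ M(2)] by (simp add: P_def M_def)
  have h2: "hilbert_schmidt (\<lambda>x. C (x - P x))"
    using hs_comp_right(1)[OF BC(2) bQ L(2)] L(1) by simp
  have n2: "hs_norm (\<lambda>x. C (x - P x)) \<le> \<delta>" using N2(3)[OF M(1) _ M(2)] by (simp add: P_def M_def)
  have h3: "hilbert_schmidt (\<lambda>x. P (B x))" and n3: "hs_norm (\<lambda>x. P (B x)) \<le> hs_norm B"
    using hs_comp_left[OF BC(1) bP nP] by simp_all
  have "(\<lambda>x. Y x - P (Y (P x))) = (\<lambda>x. (B (C x) - P (B (C x))) + P (B (C (x - P x))))"
    by (simp add: BC(3) bclin_diff[OF bP] bclin_diff[OF bB] bclin_diff[OF bC])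
  then have "trace_norm (\<lambda>x. Y x - P (Y (P x))) \<le>
      trace_norm (\<lambda>x. B (C x) - P (B (C x))) + trace_norm (\<lambda>x. P (B (C (x - P x))))"
    using trace_norm_triangle[OF hs_comp_trace_class(1)[OF h1 BC(2)] hs_comp_trace_class(1)[OF h3 h2]]
    by simp
  also have "\<dots> \<le> hs_norm (\<lambda>x. B x - P (B x)) * hs_norm C + hs_norm (\<lambda>x. P (B x)) * hs_norm (\<lambda>x. C (x - P x))"
    by (intro add_mono hs_comp_trace_class(2)[OF h1 BC(2)] hs_comp_trace_class(2)[OF h3 h2])
  also have "\<dots> \<le> \<delta> * hs_norm C + hs_norm B * \<delta>"
    by (intro add_mono mult_mono n1 n2 n3 hs_norm_nonneg order_refl) (use \<delta> in simp)
  also have "\<dots> < \<delta> * (hs_norm B + hs_norm C + 1)" using \<delta> by (simp add: algebra_simps)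
  also have "\<dots> = \<epsilon>" using pos by (simp add: \<delta>_def)
  finally show ?thesis using that M unfolding P_def by blast
qed

end

section \<open>The map \<open>id \<otimes> \<Phi>\<close>\<close>

text \<open>The matrix units of the product basis are elementary tensors, so linear maps that agree
  on these agree on finite truncations.\<close>

lemma tensor_rank_one:
  "(\<lambda>t. cinner (e' \<otimes>\<^sub>v f') t *\<^sub>C (e \<otimes>\<^sub>v f)) =
    tensor_op (\<lambda>x. cinner e' x *\<^sub>C e) (\<lambda>y. cinner f' y *\<^sub>C f)"
  by (rule sym, rule tensor_op_eqI)
    (simp_all add: bounded_clinear_cinner cinner_tensor_vec tensor_vec_scaleC_left
      tensor_vec_scaleC_right scaleC_scaleC mult.commute)

text \<open>The difference of the two maps vanishes on finite truncations of \<open>Y\<close>, and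
  the bounds \<open>K\<close> and \<open>L\<close> carry this over to the limit in trace
  norm.\<close>

lemma superop_eq_if_tensor_op_eq:
  fixes F G :: "('a::complex_hilbert_space, 'b::complex_hilbert_space) tensor superop"
  assumes F: "linear_superop F" "\<And>Y. Y \<in> trace_class \<Longrightarrow> trace_norm (F Y) \<le> K * trace_norm Y"
    and G: "linear_superop G" "\<And>Y. Y \<in> trace_class \<Longrightarrow> trace_norm (G Y) \<le> L * trace_norm Y"
    and eq: "\<And>A B. A \<in> trace_class \<Longrightarrow> B \<in> trace_class \<Longrightarrow> F (tensor_op A B) = G (tensor_op A B)"
    and Y: "Y \<in> trace_class"
  shows "F Y = G Y"
proof -
  define g :: "'a \<times> 'b \<Rightarrow> ('a, 'b) tensor" where "g = (\<lambda>(e, f). e \<otimes>\<^sub>v f)"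
  have g: "parseval_family g (onb \<times> onb)" unfolding g_def by (rule parseval_family_tensor)
  have orth: "cinner (g p) (g q) = (if p = q then 1 else 0)"
    if "p \<in> onb \<times> onb" "q \<in> onb \<times> onb" for p q
    using that by (auto simp: g_def cinner_tensor_vec cinner_onb split: if_splits)
  have bY: "bounded_clinear Y" by (rule trace_class_bclin[OF Y])
  have D: "(\<lambda>x. F Y x - G Y x) \<in> trace_class"
    by (intro trace_class_diff linear_superop_trace_class[OF F(1)] linear_superop_trace_class[OF G(1)] Y)
  have "trace_norm (\<lambda>x. F Y x - G Y x) \<le> 0 + \<epsilon>" if \<epsilon>: "0 < \<epsilon>" for \<epsilon>
  proof -
    \<comment> \<open>The absolute values account for the unknown signs of \<open>K\<close> and
      \<open>L\<close>, and the \<open>1\<close> keeps the divisor positive.\<close>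
    define \<delta> where "\<delta> = \<epsilon> / (\<bar>K\<bar> + \<bar>L\<bar> + 1)"
    have \<delta>: "0 < \<delta>" using \<epsilon> by (simp add: \<delta>_def add_nonneg_pos)
    obtain M where M: "finite M" "M \<subseteq> onb \<times> onb"
      "trace_norm (\<lambda>x. Y x - finite_projection g M (Y (finite_projection g M x))) < \<delta>"
      by (rule trace_norm_finite_approximation[OF g orth Y \<delta>])
    define R where "R p q t = cinner (g p) (Y (g q)) *\<^sub>C (cinner (g q) t *\<^sub>C g p)" for p q t
    define Z where "Z t = (\<Sum>p\<in>M. \<Sum>q\<in>M. R p q t)" for t
    have R: "R p q \<in> trace_class" for p q
      unfolding R_def[abs_def] by (intro trace_class_scaleC trace_class_rank_one)
    have Z: "Z \<in> trace_class" unfolding Z_def[abs_def] by (intro trace_class_sum R)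
    have ZM: "Z t = finite_projection g M (Y (finite_projection g M t))" for t
      unfolding Z_def R_def by (rule finite_projection_sandwich[OF bY, symmetric])
    have FR: "F (R p q) = G (R p q)" for p q
    proof -
      obtain e f e' f' where pq: "p = (e, f)" "q = (e', f')" by (cases p, cases q)
      have "R p q = (\<lambda>t. cinner (g p) (Y (g q)) *\<^sub>C
          tensor_op (\<lambda>x. cinner e' x *\<^sub>C e) (\<lambda>y. cinner f' y *\<^sub>C f) t)"
        unfolding tensor_rank_one[symmetric] by (simp add: fun_eq_iff R_def pq g_def)
      then show ?thesis
        by (simp add: linear_superop_scaleC[OF F(1)] linear_superop_scaleC[OF G(1)]
            tensor_op_trace_class(1) trace_class_rank_one eq)
    qed
    have "F Z = (\<lambda>t. \<Sum>p\<in>M. \<Sum>q\<in>M. F (R p q) t)" and "G Z = (\<lambda>t. \<Sum>p\<in>M. \<Sum>q\<in>M. G (R p q) t)"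
      unfolding Z_def[abs_def]
      by (simp_all add: linear_superop_sum[OF F(1)] linear_superop_sum[OF G(1)] trace_class_sum R)
    then have FZ: "F Z = G Z" by (simp add: FR)
    have YZ: "(\<lambda>x. Y x - Z x) \<in> trace_class" by (intro trace_class_diff Y Z)
    have "(\<lambda>x. F Y x - G Y x) = (\<lambda>x. F (\<lambda>x. Y x - Z x) x - G (\<lambda>x. Y x - Z x) x)"
      by (simp add: linear_superop_diff[OF F(1) Y Z] linear_superop_diff[OF G(1) Y Z] FZ)
    then have "trace_norm (\<lambda>x. F Y x - G Y x) \<le>
        trace_norm (F (\<lambda>x. Y x - Z x)) + trace_norm (G (\<lambda>x. Y x - Z x))"
      using trace_norm_diff_le[OF linear_superop_trace_class[OF F(1) YZ]
          linear_superop_trace_class[OF G(1) YZ]] by simp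
    also have "\<dots> \<le> (K + L) * trace_norm (\<lambda>x. Y x - Z x)"
      using F(2)[OF YZ] G(2)[OF YZ] by (simp add: distrib_right)
    also have "\<dots> \<le> (\<bar>K\<bar> + \<bar>L\<bar> + 1) * trace_norm (\<lambda>x. Y x - Z x)"
      by (intro mult_right_mono trace_norm_nonneg trace_class_bclin YZ) linarith
    also have "\<dots> \<le> (\<bar>K\<bar> + \<bar>L\<bar> + 1) * \<delta>"
      using M(3) by (intro mult_left_mono) (simp_all add: ZM)
    also have "\<dots> = \<epsilon>" by (simp add: \<delta>_def add_nonneg_pos less_imp_neq[symmetric])
    finally show ?thesis by simp
  qed
  then have "trace_norm (\<lambda>x. F Y x - G Y x) \<le> 0" by (rule field_le_epsilon)
  then have "trace_norm (\<lambda>x. F Y x - G Y x) = 0"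
    using trace_norm_nonneg[OF trace_class_bclin[OF D]] by simp
  from trace_norm_eq_0[OF D this] show ?thesis by (simp add: fun_eq_iff)
qed

text \<open>The ampliation is a witness for the property chosen by \<open>SOME\<close>, and every
  map with this property agrees with it on the trace class by density of elementary tensors.\<close>

lemma id_tensor_eq_ampliation:
  fixes Y :: "('a::complex_hilbert_space, 'b::complex_hilbert_space) tensor \<Rightarrow> ('a, 'b) tensor"
  assumes \<Phi>: "linear_superop \<Phi>" "completely_positive \<Phi>" "trace_preserving \<Phi>"
    and Y: "Y \<in> trace_class"
  shows "id_tensor \<Phi> Y = ampliation \<Phi> Y"
proof -
  let ?P = "\<lambda>F::('a, 'b) tensor superop. linear_superop F \<and>
     (\<exists>K. \<forall>Y\<in>trace_class. trace_norm (F Y) \<le> K * trace_norm Y) \<and>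
     (\<forall>A\<in>trace_class. \<forall>B\<in>trace_class. F (tensor_op A B) = tensor_op A (\<Phi> B))"
  have "?P (ampliation \<Phi>)"
    using linear_superop_ampliation[OF \<Phi>] ampliation_bound[OF \<Phi>] ampliation_tensor_op[OF \<Phi>] by blast
  from someI[of ?P, OF this] have P: "?P (id_tensor \<Phi>)" unfolding id_tensor_def .
  then obtain K where K: "\<And>Y :: ('a, 'b) tensor \<Rightarrow> ('a, 'b) tensor. Y \<in> trace_class \<Longrightarrow>
      trace_norm (id_tensor \<Phi> Y) \<le> K * trace_norm Y" by blast
  show ?thesis
    by (rule superop_eq_if_tensor_op_eq[OF _ K linear_superop_ampliation[OF \<Phi>]
          ampliation_bound[OF \<Phi>] _ Y])
      (use P in \<open>simp_all add: ampliation_tensor_op[OF \<Phi>]\<close>)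
qed

section \<open>CP-divisibility\<close>

text \<open>Comparing blocks shows that the ampliation of \<open>\<Lambda> t\<close> is that of
  \<open>\<Phi>\<close> after that of \<open>\<Lambda> s\<close>. The ampliation of
  \<open>\<Phi>\<close> is positive and trace preserving, so it contracts Hermitian
  operators.\<close>

lemma CP_divisible_antimono:
  fixes Y :: "('a::complex_hilbert_space, 'b::complex_hilbert_space) tensor \<Rightarrow> ('a, 'b) tensor"
  assumes dyn: "dynamical_map \<Lambda>" and div: "CP_divisible \<Lambda>"
    and Y: "Y \<in> trace_class" "hermitian_op Y"
  shows "antimono_on {0..} (\<lambda>t. trace_norm (id_tensor (\<Lambda> t) Y))"
proof (rule monotone_onI)
  fix s t :: real assume st: "s \<in> {0..}" "t \<in> {0..}" "s \<le> t"
  then obtain \<Phi> where \<Phi>: "propagator \<Lambda> t s \<Phi>" "completely_positive \<Phi>" "trace_preserving \<Phi>"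
    using div unfolding CP_divisible_def by auto
  then have lin: "linear_superop \<Phi>" by (simp add: propagator_def)
  have "0 \<le> s" "0 \<le> t" using st by auto
  note Ls = dynamical_mapD(1-3)[OF dyn \<open>0 \<le> s\<close>] and Lt = dynamical_mapD(1-3)[OF dyn \<open>0 \<le> t\<close>]
  define Z where "Z = ampliation (\<Lambda> s) Y"
  have Z: "Z \<in> trace_class" "hermitian_op Z"
    unfolding Z_def
    by (rule ampliation_trace_class[OF Ls Y(1)],
        rule positive_map_hermitian[OF linear_superop_ampliation[OF Ls] positive_map_ampliation[OF Ls] Y])
  have "ampliation (\<Lambda> t) Y = ampliation \<Phi> Z"
  proof (rule ampliation_eqI[OF Lt Y(1)])
    show "bounded_clinear (ampliation \<Phi> Z)"
      by (rule trace_class_bclin[OF ampliation_trace_class[OF lin \<Phi>(2,3) Z(1)]])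
    fix e f :: 'a assume ef: "e \<in> onb" "f \<in> onb"
    have "block (ampliation \<Phi> Z) e f = \<Phi> (block Z e f)"
      by (rule block_ampliation[OF lin \<Phi>(2,3) Z(1) ef])
    also have "block Z e f = \<Lambda> s (block Y e f)"
      unfolding Z_def by (rule block_ampliation[OF Ls Y(1) ef])
    finally show "block (ampliation \<Phi> Z) e f = \<Lambda> t (block Y e f)"
      using \<Phi>(1) block_trace_class[OF Y(1)] by (simp add: propagator_def)
  qed
  then show "trace_norm (id_tensor (\<Lambda> t) Y) \<le> trace_norm (id_tensor (\<Lambda> s) Y)"
    using ampliation_hermitian_contraction[OF lin \<Phi>(2,3) Z]
    by (simp add: id_tensor_eq_ampliation[OF Ls Y(1)] id_tensor_eq_ampliation[OF Lt Y(1)] Z_def)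
qed

text \<open>It suffices to test complete positivity on tuples of vectors \<open>v i = (\<Sum>e\<in>F. c i e *\<^sub>C e)\<close> with a
  common finite \<open>F \<subseteq> onb\<close>. Collecting the coefficients reduces such a test to the vector
  \<open>(\<Sum>e\<in>F. e \<otimes>\<^sub>v e)\<close> and blocks indexed by \<open>F\<close>, hence to an operator on the tensor product even
  if the number of vectors exceeds the dimension of the Hilbert space.\<close>

lemma completely_positive_onb_blocks:
  fixes \<Phi> :: "'a::complex_hilbert_space superop"
  assumes lin: "linear_superop \<Phi>"
    and pos: "\<And>F L. finite F \<Longrightarrow> F \<subseteq> onb \<Longrightarrow> (\<And>e f. L e f \<in> trace_class) \<Longrightarrow>
      (\<And>w. (\<Sum>e\<in>F. \<Sum>f\<in>F. cinner (w e) (L e f (w f))) \<in> \<real>\<^sub>\<ge>\<^sub>0) \<Longrightarrow>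
      (\<Sum>e\<in>F. \<Sum>f\<in>F. cinner e (\<Phi> (L e f) f)) \<in> \<real>\<^sub>\<ge>\<^sub>0"
  shows "completely_positive \<Phi>"
  unfolding completely_positive_def
proof (intro allI impI)
  fix n and X :: "nat \<Rightarrow> nat \<Rightarrow> 'a \<Rightarrow> 'a"
  assume "(\<forall>i<n. \<forall>j<n. X i j \<in> trace_class) \<and> positive_block n X"
  then have X: "\<And>i j. i < n \<Longrightarrow> j < n \<Longrightarrow> X i j \<in> trace_class"
    and Xpos: "\<And>v. (\<Sum>i<n. \<Sum>j<n. cinner (v i) (X i j (v j))) \<in> \<real>\<^sub>\<ge>\<^sub>0"
    by (auto simp: positive_block_def)
  have bX: "bounded_clinear (X i j)" "bounded_clinear (\<Phi> (X i j))" if "i < n" "j < n" for i j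
    using X[OF that] linear_superop_trace_class[OF lin] trace_class_bclin by blast+
  show "positive_block n (\<lambda>i j. \<Phi> (X i j))"
    unfolding positive_block_def
  proof
    fix v :: "nat \<Rightarrow> 'a"
    define V where "V F i = (\<Sum>e\<in>F. cinner e (v i) *\<^sub>C e)" for F i
    have V: "((\<lambda>F. V F i) \<longlongrightarrow> v i) (finite_subsets_at_top onb)" for i
      using onb_expansion[of "v i"] unfolding has_sum_def V_def .
    have lim: "((\<lambda>F. \<Sum>i<n. \<Sum>j<n. cinner (V F i) (\<Phi> (X i j) (V F j))) \<longlongrightarrow>
        (\<Sum>i<n. \<Sum>j<n. cinner (v i) (\<Phi> (X i j) (v j)))) (finite_subsets_at_top onb)"
    proof (intro tendsto_sum)
      fix i j assume "i \<in> {..<n}" "j \<in> {..<n}"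
      then have "bounded_clinear (\<Phi> (X i j))" by (intro bX) auto
      from tendsto_cinner[OF V bclin_tendsto[OF this V]]
      show "((\<lambda>F. cinner (V F i) (\<Phi> (X i j) (V F j))) \<longlongrightarrow> cinner (v i) (\<Phi> (X i j) (v j)))
        (finite_subsets_at_top onb)" .
    qed
    have "(\<Sum>i<n. \<Sum>j<n. cinner (V F i) (\<Phi> (X i j) (V F j))) \<in> \<real>\<^sub>\<ge>\<^sub>0" if F: "finite F" "F \<subseteq> onb" for F
    proof -
      define c where "c i e = cinner e (v i)" for i e
      define L where "L e f = (\<lambda>x. \<Sum>i<n. \<Sum>j<n. (cnj (c i e) * c j f) *\<^sub>C X i j x)" for e f
      \<comment> \<open>Used twice: with \<open>T = X\<close> and arbitrary \<open>w\<close> it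
        passes positivity from \<open>X\<close> to \<open>L\<close>; with
        \<open>\<Phi> (X i j)\<close> for \<open>T i j\<close> and \<open>w e = e\<close> it reads
        off the conclusion.\<close>
      have collect: "(\<Sum>i<n. \<Sum>j<n. cinner (\<Sum>e\<in>F. c i e *\<^sub>C w e) (T i j (\<Sum>f\<in>F. c j f *\<^sub>C w f))) =
          (\<Sum>e\<in>F. \<Sum>f\<in>F. cinner (w e) (\<Sum>i<n. \<Sum>j<n. (cnj (c i e) * c j f) *\<^sub>C T i j (w f)))"
        if T: "\<And>i j. i < n \<Longrightarrow> j < n \<Longrightarrow> bounded_clinear (T i j)" for T w
      proof -
        have "(\<Sum>i<n. \<Sum>j<n. cinner (\<Sum>e\<in>F. c i e *\<^sub>C w e) (T i j (\<Sum>f\<in>F. c j f *\<^sub>C w f))) =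
            (\<Sum>i<n. \<Sum>j<n. \<Sum>e\<in>F. \<Sum>f\<in>F. cnj (c i e) * c j f * cinner (w e) (T i j (w f)))"
        proof (intro sum.cong refl)
          fix i j assume "i \<in> {..<n}" "j \<in> {..<n}"
          then have "bounded_clinear (T i j)" using T by simp
          then show "cinner (\<Sum>e\<in>F. c i e *\<^sub>C w e) (T i j (\<Sum>f\<in>F. c j f *\<^sub>C w f)) =
              (\<Sum>e\<in>F. \<Sum>f\<in>F. cnj (c i e) * c j f * cinner (w e) (T i j (w f)))"
            unfolding cinner_sum_left
            by (simp add: bclin_sum bclin_scaleC cinner_sum_right cinner_simps sum_distrib_left mult_ac)
        qed
        also have "\<dots> = (\<Sum>i<n. \<Sum>e\<in>F. \<Sum>f\<in>F. \<Sum>j<n. cnj (c i e) * c j f * cinner (w e) (T i j (w f)))"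
          by (intro sum.cong refl) (subst sum.swap, intro sum.cong refl, subst sum.swap, rule refl)
        also have "\<dots> = (\<Sum>e\<in>F. \<Sum>f\<in>F. \<Sum>i<n. \<Sum>j<n. cnj (c i e) * c j f * cinner (w e) (T i j (w f)))"
          by (subst sum.swap, intro sum.cong refl, subst sum.swap, rule refl)
        finally show ?thesis by (simp add: cinner_sum_right cinner_scaleC_right)
      qed
      have LT: "L e f \<in> trace_class" for e f
        unfolding L_def by (intro trace_class_sum trace_class_scaleC X) auto
      have \<Phi>L: "\<Phi> (L e f) x = (\<Sum>i<n. \<Sum>j<n. (cnj (c i e) * c j f) *\<^sub>C \<Phi> (X i j) x)" for e f x
      proof -
        let ?c = "\<lambda>i j. cnj (c i e) * c j f"
        have T: "(\<lambda>x. \<Sum>j<n. ?c i j *\<^sub>C X i j x) \<in> trace_class" if "i < n" for i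
          using that by (intro trace_class_sum trace_class_scaleC X) auto
        have "\<Phi> (\<lambda>x. \<Sum>j<n. ?c i j *\<^sub>C X i j x) = (\<lambda>x. \<Sum>j<n. ?c i j *\<^sub>C \<Phi> (X i j) x)"
          if "i < n" for i
          using linear_superop_sum[OF lin, of "{..<n}" "\<lambda>j x. ?c i j *\<^sub>C X i j x"] that
          by (simp add: trace_class_scaleC X linear_superop_scaleC[OF lin])
        then show ?thesis
          unfolding L_def
          using linear_superop_sum[OF lin, of "{..<n}" "\<lambda>i x. \<Sum>j<n. ?c i j *\<^sub>C X i j x"] T
          by simp
      qed
      have "(\<Sum>e\<in>F. \<Sum>f\<in>F. cinner e (\<Phi> (L e f) f)) \<in> \<real>\<^sub>\<ge>\<^sub>0"
      proof (rule pos[OF F LT])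
        fix w
        show "(\<Sum>e\<in>F. \<Sum>f\<in>F. cinner (w e) (L e f (w f))) \<in> \<real>\<^sub>\<ge>\<^sub>0"
          using Xpos[of "\<lambda>i. \<Sum>e\<in>F. c i e *\<^sub>C w e"]
          by (simp add: L_def collect[of X] bX(1))
      qed
      then show ?thesis
        using collect[of "\<lambda>i j. \<Phi> (X i j)" "\<lambda>e. e"] bX(2) by (simp add: V_def c_def \<Phi>L)
    qed
    then show "(\<Sum>i<n. \<Sum>j<n. cinner (v i) (\<Phi> (X i j) (v j))) \<in> \<real>\<^sub>\<ge>\<^sub>0"
      by (intro Lim_in_closed_set[OF closed_nonneg_Reals_complex _ _ lim]
          eventually_finite_subsets_at_top_weakI) auto
  qed
qed

lemma antimono_imp_CP_divisible:
  fixes \<Lambda> :: "real \<Rightarrow> 'h::complex_hilbert_space superop"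
  assumes dyn: "dynamical_map \<Lambda>" and surj: "\<forall>t\<ge>0. \<Lambda> t ` trace_class = trace_class"
    and anti: "\<And>Y :: ('h, 'h) tensor \<Rightarrow> ('h, 'h) tensor. Y \<in> trace_class \<Longrightarrow> hermitian_op Y \<Longrightarrow>
      antimono_on {0..} (\<lambda>t. trace_norm (id_tensor (\<Lambda> t) Y))"
  shows "CP_divisible \<Lambda>"
  unfolding CP_divisible_def
proof (intro allI impI)
  fix s t :: real assume st: "0 \<le> s \<and> s \<le> t"
  then have s: "0 \<le> s" and t: "0 \<le> t" by auto
  note Ls = dynamical_mapD[OF dyn s] and Lt = dynamical_mapD[OF dyn t]
  have le: "trace_norm (ampliation (\<Lambda> t) Y) \<le> trace_norm (ampliation (\<Lambda> s) Y)"
    if Y: "Y \<in> trace_class" "hermitian_op Y" for Y :: "('h, 'h) tensor \<Rightarrow> ('h, 'h) tensor"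
    using monotone_onD[OF anti[OF Y], of s t] st
    by (simp add: id_tensor_eq_ampliation[OF Ls(1-3) Y(1)] id_tensor_eq_ampliation[OF Lt(1-3) Y(1)])
  have surj_s: "\<Lambda> s ` trace_class = trace_class" using surj s by blast
  obtain \<Phi> where \<Phi>: "linear_superop \<Phi>" "trace_preserving \<Phi>"
    "\<And>A. A \<in> trace_class \<Longrightarrow> \<Lambda> t A = \<Phi> (\<Lambda> s A)"
  proof (rule propagator_exists[OF Ls(1,4,3) Lt(1,4,3) surj_s])
    fix X assume X: "X \<in> trace_class" "hermitian_op X" "\<Lambda> s X = (\<lambda>x. 0)"
    show "\<Lambda> t X = (\<lambda>x. 0)"
    \<comment> \<open>Monotonicity concerns operators on the tensor product, so \<open>X\<close> is
      embedded as \<open>E \<otimes> X\<close> with a rank one projection \<open>E\<close>. This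
      takes a unit vector, hence the zero space is treated apart.\<close>
    proof (cases "\<exists>e::'h. e \<in> onb")
      case False
      then have "x = 0" for x :: 'h using onb_total by blast
      then show ?thesis by (simp add: fun_eq_iff)
    next
      case True
      then obtain e :: 'h where e: "e \<in> onb" by blast
      define E where "E x = cinner e x *\<^sub>C e" for x
      have E: "E \<in> trace_class" unfolding E_def[abs_def] by (rule trace_class_rank_one)
      have rep: "tensor_op E B = (\<lambda>t. e \<otimes>\<^sub>v B (slice e t))" if "B \<in> trace_class" for B
        unfolding E_def[abs_def] by (rule tensor_op_rank_one_left[OF trace_class_bclin[OF that]])
      have EX: "tensor_op E X \<in> trace_class" by (rule tensor_op_trace_class(1)[OF E X(1)])
      have tX: "\<Lambda> t X \<in> trace_class" by (rule linear_superop_trace_class[OF Lt(1) X(1)])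
      have "hermitian_op (tensor_op E X)"
        using trace_class_bclin[OF EX]
        by (simp add: hermitian_op_iff rep[OF X(1)] hermitian_op_cinner[OF X(2)]
            flip: cinner_slice cinner_slice_left)
      from le[OF EX this] have "trace_norm (tensor_op E (\<Lambda> t X)) \<le> trace_norm (tensor_op E (\<Lambda> s X))"
        by (simp add: ampliation_tensor_op[OF Ls(1-3) E X(1)] ampliation_tensor_op[OF Lt(1-3) E X(1)])
      also have "tensor_op E (\<Lambda> s X) = (\<lambda>t. 0)"
        by (simp add: X(3) rep[OF trace_class_zero] bclin_zero[OF bounded_clinear_tensor_vec_right])
      finally have "trace_norm (tensor_op E (\<Lambda> t X)) \<le> 0" by (simp add: trace_norm_zero)
      moreover have T: "tensor_op E (\<Lambda> t X) \<in> trace_class" by (rule tensor_op_trace_class(1)[OF E tX])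
      ultimately have "tensor_op E (\<Lambda> t X) = (\<lambda>t. 0)"
        using trace_norm_nonneg[OF trace_class_bclin[OF T]] by (intro trace_norm_eq_0 T) simp
      \<comment> \<open>The block at \<open>(e, e)\<close> recovers \<open>\<Lambda> t X\<close>,
        because \<open>cinner e (E e) = 1\<close>.\<close>
      then have "block (tensor_op E (\<Lambda> t X)) e e b = 0" for b
        by (simp add: block_def bclin_zero[OF bounded_clinear_slice])
      then show ?thesis by (simp add: fun_eq_iff block_tensor_op[OF E tX] E_def cinner_onb e)
    qed
  qed blast
  have "completely_positive \<Phi>"
  proof (rule completely_positive_onb_blocks[OF \<Phi>(1)])
    fix F :: "'h set" and L :: "'h \<Rightarrow> 'h \<Rightarrow> 'h \<Rightarrow> 'h"
    assume F: "finite F" "F \<subseteq> onb" and L: "\<And>e f. L e f \<in> trace_class"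
      and Lpos: "\<And>w. (\<Sum>e\<in>F. \<Sum>f\<in>F. cinner (w e) (L e f (w f))) \<in> \<real>\<^sub>\<ge>\<^sub>0"
    define S where "S = block_sum F L"
    have ST: "S \<in> trace_class" unfolding S_def by (rule block_sum_trace_class[OF L])
    have S: "positive_op S"
      using trace_class_bclin[OF ST] Lpos by (simp add: positive_op_def S_def cinner_block_sum)
    \<comment> \<open>Preimages under \<open>\<Lambda> s\<close> are chosen for each block
      separately; \<open>F\<close> is finite, so they assemble into a trace class operator.\<close>
    have "\<exists>R. R \<in> trace_class \<and> \<Lambda> s R = L e f" for e f
      using L surj_s by (metis (no_types) image_iff)
    then obtain R where R: "\<And>e f. R e f \<in> trace_class" "\<And>e f. \<Lambda> s (R e f) = L e f" by metis
    have RT: "block_sum F R \<in> trace_class" by (rule block_sum_trace_class[OF R(1)])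
    have SR: "ampliation (\<Lambda> s) (block_sum F R) = S"
    proof (rule ampliation_eqI[OF Ls(1-3) RT trace_class_bclin[OF ST]])
      fix e f :: 'h assume "e \<in> onb" "f \<in> onb"
      then show "block S e f = \<Lambda> s (block (block_sum F R) e f)"
        by (simp add: S_def block_block_sum[OF F] trace_class_bclin L R linear_superop_zero[OF Ls(1)])
    qed
    \<comment> \<open>The blockwise choice may fail to be Hermitian; its real part is Hermitian and
      has the same image \<open>S\<close>.\<close>
    obtain G where G: "G \<in> trace_class" "hermitian_op G" "ampliation (\<Lambda> s) G = S"
    proof (rule hermitian_preimage[OF linear_superop_ampliation[OF Ls(1-3)]
          positive_map_ampliation[OF Ls(1-3)] RT])
      show "hermitian_op (ampliation (\<Lambda> s) (block_sum F R))"
        unfolding SR by (rule positive_op_hermitian[OF S])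
    qed (simp add: SR)
    define Z where "Z = ampliation (\<Lambda> t) G"
    have ZT: "Z \<in> trace_class" unfolding Z_def by (rule ampliation_trace_class[OF Lt(1-3) G(1)])
    have Z: "positive_op Z"
    proof (rule positive_op_if_trace_norm_le[OF ZT])
      show "hermitian_op Z"
        unfolding Z_def by (rule positive_map_hermitian[OF linear_superop_ampliation[OF Lt(1-3)]
              positive_map_ampliation[OF Lt(1-3)] G(1,2)])
      \<comment> \<open>Both traces are that of \<open>G\<close>, since both ampliations preserve
        the trace.\<close>
      have "op_trace Z = op_trace S"
        using trace_preserving_ampliation[OF Lt(1-3)] trace_preserving_ampliation[OF Ls(1-3)] G
        by (metis Z_def trace_preserving_def)
      then show "trace_norm Z \<le> Re (op_trace Z)"
        using le[OF G(1,2)] by (simp add: Z_def G(3) op_trace_positive[OF S])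
    qed
    have "block Z e f = \<Phi> (L e f)" if "e \<in> F" "f \<in> F" for e f
    proof -
      have ef: "e \<in> onb" "f \<in> onb" using that F(2) by auto
      have "block Z e f = \<Phi> (\<Lambda> s (block G e f))"
        by (simp add: Z_def block_ampliation[OF Lt(1-3) G(1) ef] \<Phi>(3) block_trace_class[OF G(1)])
      also have "\<Lambda> s (block G e f) = block S e f"
        by (simp add: block_ampliation[OF Ls(1-3) G(1) ef] flip: G(3))
      also have "\<dots> = L e f"
        using that by (simp add: S_def block_block_sum[OF F ef] trace_class_bclin L)
      finally show ?thesis .
    qed
    \<comment> \<open>This is the form of \<open>Z\<close> at the vector
      \<open>\<Sum>e\<in>F. e \<otimes>\<^sub>v e\<close>.\<close>
    then show "(\<Sum>e\<in>F. \<Sum>f\<in>F. cinner e (\<Phi> (L e f) f)) \<in> \<real>\<^sub>\<ge>\<^sub>0"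
      using positive_op_block_form[OF Z, where F = F and v = "\<lambda>e. e"] by simp
  qed
  then show "\<exists>\<Phi>. propagator \<Lambda> t s \<Phi> \<and> completely_positive \<Phi> \<and> trace_preserving \<Phi>"
    using \<Phi> unfolding propagator_def by blast
qed

section \<open>The four implications together\<close>

theorem theorem2p2:
  fixes \<Lambda> :: "real \<Rightarrow> 'h::complex_hilbert_space superop"
  assumes "separable_space (euclidean :: 'h topology)"
    and "dynamical_map \<Lambda>"
  shows
    "(P_divisible \<Lambda> \<longrightarrow>
        (\<forall>X\<in>trace_class. hermitian_op X \<longrightarrow>
           antimono_on {0..} (\<lambda>t. trace_norm (\<Lambda> t X)) \<and>
           (\<forall>t\<ge>0. \<forall>D. ((\<lambda>t. trace_norm (\<Lambda> t X)) has_real_derivative D) (at t within {0..})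
              \<longrightarrow> D \<le> 0)))
     \<and>
     (CP_divisible \<Lambda> \<longrightarrow>
        (\<forall>Y :: ('h, 'h) tensor \<Rightarrow> ('h, 'h) tensor. Y \<in> trace_class \<longrightarrow> hermitian_op Y \<longrightarrow>
           antimono_on {0..} (\<lambda>t. trace_norm (id_tensor (\<Lambda> t) Y)) \<and>
           (\<forall>t\<ge>0. \<forall>D. ((\<lambda>t. trace_norm (id_tensor (\<Lambda> t) Y)) has_real_derivative D)
                (at t within {0..}) \<longrightarrow> D \<le> 0)))
     \<and>
     ((\<forall>t\<ge>0. \<Lambda> t ` trace_class = trace_class) \<longrightarrow>
        ((\<forall>X\<in>trace_class. hermitian_op X \<longrightarrow>
            antimono_on {0..} (\<lambda>t. trace_norm (\<Lambda> t X)))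
          \<longrightarrow> P_divisible \<Lambda>)
        \<and>
        ((\<forall>Y :: ('h, 'h) tensor \<Rightarrow> ('h, 'h) tensor. Y \<in> trace_class \<longrightarrow> hermitian_op Y \<longrightarrow>
            antimono_on {0..} (\<lambda>t. trace_norm (id_tensor (\<Lambda> t) Y)))
          \<longrightarrow> CP_divisible \<Lambda>))"
proof (intro conjI impI ballI allI)
  fix X :: "'h \<Rightarrow> 'h"
  assume "P_divisible \<Lambda>" "X \<in> trace_class" "hermitian_op X"
  then show *: "antimono_on {0..} (\<lambda>t. trace_norm (\<Lambda> t X))"
    using P_divisible_antimono[OF assms(2)] by blast
  fix t D :: real
  assume "0 \<le> t" "((\<lambda>t. trace_norm (\<Lambda> t X)) has_real_derivative D) (at t within {0..})"
  with * show "D \<le> 0" by (rule antimono_on_derivative_nonpos)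
next
  fix Y :: "('h, 'h) tensor \<Rightarrow> ('h, 'h) tensor"
  assume "CP_divisible \<Lambda>" "Y \<in> trace_class" "hermitian_op Y"
  then show *: "antimono_on {0..} (\<lambda>t. trace_norm (id_tensor (\<Lambda> t) Y))"
    using CP_divisible_antimono[OF assms(2)] by blast
  fix t D :: real
  assume "0 \<le> t" "((\<lambda>t. trace_norm (id_tensor (\<Lambda> t) Y)) has_real_derivative D) (at t within {0..})"
  with * show "D \<le> 0" by (rule antimono_on_derivative_nonpos)
next
  assume "\<forall>t\<ge>0. \<Lambda> t ` trace_class = trace_class"
    "\<forall>X\<in>trace_class. hermitian_op X \<longrightarrow> antimono_on {0..} (\<lambda>t. trace_norm (\<Lambda> t X))"
  then show "P_divisible \<Lambda>" using antimono_imp_P_divisible[OF assms(2)] by blast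
next
  assume "\<forall>t\<ge>0. \<Lambda> t ` trace_class = trace_class"
    "\<forall>Y :: ('h, 'h) tensor \<Rightarrow> ('h, 'h) tensor. Y \<in> trace_class \<longrightarrow> hermitian_op Y \<longrightarrow>
      antimono_on {0..} (\<lambda>t. trace_norm (id_tensor (\<Lambda> t) Y))"
  then show "CP_divisible \<Lambda>" using antimono_imp_CP_divisible[OF assms(2)] by blast
qed


end
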